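(* Let $n\geq 1$. If $X$ is an $n$-dimensional, $\pi_n$-shape injective Peano continuum that can be expressed as an inverse limit of a sequence of compact $n$-dimensional polyhedra $K_i$, $i\in\mathbb{N}$, with $(n-1)$-connected universal covers, then $X$ is completely $\pi_n$-rigid.
   Context: All spaces are Hausdorff and maps are continuous. A Peano continuum is a compact, connected, locally connected metrizable space. Dimension is Lebesgue covering dimension. A map $S^n\to X$ is essential if it is not null-homotopic. The $n$-dimensional infinite earring $\mathbb{E}_n$ is the shrinking wedge of copies $S^n_j$ ($j\in\mathbb{N}$) of $S^n$: as a set it is the one-point union $\bigvee_{j}S^n_j$ with wedge point $b_0$; a set $U$ is open iff $U\cap S^n_j$ is open in $S^n_j$ for all $j$ and, whenever $b_0\in U$, $S^n_j\subseteq U$ for all but finitely many $j$. A map $f:\mathbb{E}_n\to X$ is fully essential if its restriction to $S^n_j$ is essential in $X$ for every $j$. The $\pi_n$-wild set $\mathbf{w}_n(X)$ is the subspace of all $x\in X$ for which there is a fully essential map $(\mathbb{E}_n,b_0)\to(X,x)$. $X$ is $\pi_n$-rigid at $x\in X$ if there exists a fully essential map $f:(\mathbb{E}_n,b_0)\to(X,x)$ such that every map $F:\mathbb{E}_n\times[0,1]\to X$ with $F(a,0)=f(a)$ for all $a\in\mathbb{E}_n$ satisfies $F(b_0,1)=x$. $\mathbf{rg}_n(X)$ is the set of $x$ at which $X$ is $\pi_n$-rigid, and $X$ is completely $\pi_n$-rigid if $\mathbf{rg}_n(X)=\mathbf{w}_n(X)$. A space is $\pi_n$-shape injective if the canonical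 homomorphism $\Psi_n:\pi_n(X,x_0)\to\check{\pi}_n(X,x_0)$ to the $n$-th shape homotopy group is injective; if $(X,x_0)=\varprojlim_{i\in\mathbb{N}}(K_i,k_i)$ is an inverse limit of a sequence of based compact polyhedra and based maps with projections $q_i:X\to K_i$, this means that $\Psi_n:\pi_n(X,x_0)\to\varprojlim_i\pi_n(K_i,k_i)$, $\Psi_n([f])=([q_i\circ f])_i$, is injective (this does not depend on the choice of such an expression). *)

theory Defs
  imports "HOL-Analysis.Analysis"
begin

section \<open>Spaces\<close>

definition Peano_continuum :: "'a topology \<Rightarrow> bool" where
  "Peano_continuum X \<longleftrightarrow>
     compact_space X \<and> connected_space X \<and> locally_connected_space X \<and> metrizable_space X"

text \<open>Lebesgue covering dimension, via finite open covers. For compact spaces this agrees with the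
  variant using arbitrary open covers.\<close>

definition covering_dim_le :: "'a topology \<Rightarrow> nat \<Rightarrow> bool" where
  "covering_dim_le X m \<longleftrightarrow>
     (\<forall>\<U>. finite \<U> \<and> (\<forall>U\<in>\<U>. openin X U) \<and> \<Union>\<U> = topspace X \<longrightarrow>
        (\<exists>\<V>. finite \<V> \<and> (\<forall>V\<in>\<V>. openin X V \<and> (\<exists>U\<in>\<U>. V \<subseteq> U)) \<and> \<Union>\<V> = topspace X \<and>
             (\<forall>x\<in>topspace X. card {V\<in>\<V>. x \<in> V} \<le> m + 1)))"

text \<open>The empty space gets dimension \<open>0\<close> here instead of \<open>-1\<close>; this is harmless for \<open>n \<ge> 1\<close>.\<close>

definition has_covering_dim :: "'a topology \<Rightarrow> nat \<Rightarrow> bool" where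
  "has_covering_dim X n \<longleftrightarrow> covering_dim_le X n \<and> (\<forall>m<n. \<not> covering_dim_le X m)"

text \<open>Finite abstract simplicial complexes with vertices in \<open>\<nat>\<close>, realized by barycentric coordinates.
  The complexes of the library live in one Euclidean space of fixed dimension, which is too
  restrictive for arbitrary compact polyhedra; on a finite complex the product topology used below is
  the usual (Euclidean) topology.\<close>

definition finite_complex :: "nat set set \<Rightarrow> bool" where
  "finite_complex \<K> \<longleftrightarrow> finite \<K> \<and>
     (\<forall>\<sigma>\<in>\<K>. finite \<sigma> \<and> \<sigma> \<noteq> {} \<and> (\<forall>\<tau>. \<tau> \<subseteq> \<sigma> \<and> \<tau> \<noteq> {} \<longrightarrow> \<tau> \<in> \<K>))"

definition realization :: "nat set set \<Rightarrow> (nat \<Rightarrow> real) topology" where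
  "realization \<K> = subtopology (powertop_real UNIV)
     {t. (\<forall>v. 0 \<le> t v) \<and> {v. t v \<noteq> 0} \<in> \<K> \<and> (\<Sum>v | t v \<noteq> 0. t v) = 1}"

definition compact_polyhedron :: "'a topology \<Rightarrow> bool" where
  "compact_polyhedron P \<longleftrightarrow> (\<exists>\<K>. finite_complex \<K> \<and> P homeomorphic_space realization \<K>)"

text \<open>\<open>X\<close> is the limit of the sequence \<open>K 0 \<leftarrow> K 1 \<leftarrow> \<dots>\<close> with bonding maps
  \<open>p i : K (i + 1) \<rightarrow> K i\<close> and projections \<open>q i : X \<rightarrow> K i\<close>.\<close>

definition is_inverse_limit ::
  "'a topology \<Rightarrow> (nat \<Rightarrow> 'b topology) \<Rightarrow> (nat \<Rightarrow> 'b \<Rightarrow> 'b) \<Rightarrow> (nat \<Rightarrow> 'a \<Rightarrow> 'b) \<Rightarrow> bool" where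
  "is_inverse_limit X K p q \<longleftrightarrow>
     (\<forall>i. continuous_map (K (Suc i)) (K i) (p i)) \<and>
     homeomorphic_map X
       (subtopology (product_topology K UNIV) {y. \<forall>i. p i (y (Suc i)) = y i})
       (\<lambda>x i. q i x)"

section \<open>Homotopy groups\<close>

definition sphere_base :: "nat \<Rightarrow> real" where
  "sphere_base = (\<lambda>i. if i = 0 then 1 else 0)"

text \<open>The based homotopy class of \<open>f : (S\<^sup>n, *) \<rightarrow> (X, x)\<close>, and the underlying set of \<open>\<pi>\<^sub>n(X, x)\<close>.
  The group operation is not needed to express triviality of the group or injectivity of a homomorphism.\<close>

definition homotopy_class ::
  "nat \<Rightarrow> 'a topology \<Rightarrow> 'a \<Rightarrow> ((nat \<Rightarrow> real) \<Rightarrow> 'a) \<Rightarrow> ((nat \<Rightarrow> real) \<Rightarrow> 'a) set" where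
  "homotopy_class n X x f = {g. homotopic_with (\<lambda>h. h sphere_base = x) (nsphere n) X f g}"

definition homotopy_classes :: "nat \<Rightarrow> 'a topology \<Rightarrow> 'a \<Rightarrow> ((nat \<Rightarrow> real) \<Rightarrow> 'a) set set" where
  "homotopy_classes n X x =
     {homotopy_class n X x f | f. continuous_map (nsphere n) X f \<and> f sphere_base = x}"

text \<open>The map \<open>[f] \<mapsto> [q \<circ> f]\<close> into \<open>\<pi>\<^sub>n(Y, y)\<close>, where \<open>q\<close> sends the base point to \<open>y\<close>; the classes
  in the union all coincide.\<close>

definition induced_class ::
  "nat \<Rightarrow> 'b topology \<Rightarrow> 'b \<Rightarrow> ('a \<Rightarrow> 'b) \<Rightarrow> ((nat \<Rightarrow> real) \<Rightarrow> 'a) set \<Rightarrow> ((nat \<Rightarrow> real) \<Rightarrow> 'b) set"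
  where
  "induced_class n Y y q c = (\<Union>f\<in>c. homotopy_class n Y y (q \<circ> f))"

definition k_connected :: "nat \<Rightarrow> 'a topology \<Rightarrow> bool" where
  "k_connected k X \<longleftrightarrow> topspace X \<noteq> {} \<and> path_connected_space X \<and>
     (\<forall>m\<in>{1..k}. \<forall>x\<in>topspace X. homotopy_classes m X x = {homotopy_class m X x (\<lambda>_. x)})"

text \<open>The values \<open>shape_map n K q x\<^sub>0 c\<close> for \<open>c \<in> \<pi>\<^sub>n(X, x\<^sub>0)\<close> are coherent families, i.e. elements of the
  limit of the groups \<open>\<pi>\<^sub>n(K i, q i x\<^sub>0)\<close>, whenever the \<open>q i\<close> are the projections of an inverse limit.\<close>

definition shape_map ::
  "nat \<Rightarrow> (nat \<Rightarrow> 'b topology) \<Rightarrow> (nat \<Rightarrow> 'a \<Rightarrow> 'b) \<Rightarrow> 'a \<Rightarrow>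
    ((nat \<Rightarrow> real) \<Rightarrow> 'a) set \<Rightarrow> nat \<Rightarrow> ((nat \<Rightarrow> real) \<Rightarrow> 'b) set" where
  "shape_map n K q x\<^sub>0 c = (\<lambda>i. induced_class n (K i) (q i x\<^sub>0) (q i) c)"

text \<open>For compact metrizable \<open>X\<close>. Such a space always has an expression as an inverse limit of
  compact polyhedra, and injectivity does not depend on the expression; we quantify over all of them.
  Every compact polyhedron is homeomorphic to a space on the type \<open>nat \<Rightarrow> real\<close>, so fixing that type
  is no restriction.\<close>

definition pi_shape_injective :: "nat \<Rightarrow> 'a topology \<Rightarrow> bool" where
  "pi_shape_injective n X \<longleftrightarrow>
     (\<forall>(K :: nat \<Rightarrow> (nat \<Rightarrow> real) topology) p q.
        (\<forall>i. compact_polyhedron (K i)) \<and> is_inverse_limit X K p q \<longrightarrow>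
        (\<forall>x\<^sub>0\<in>topspace X. inj_on (shape_map n K q x\<^sub>0) (homotopy_classes n X x\<^sub>0)))"

section \<open>Infinite earrings\<close>

text \<open>\<open>earring_incl j\<close> embeds \<open>S\<^sup>n\<close> as the \<open>j\<close>-th sphere of the shrinking wedge, whose wedge point
  is \<open>None\<close>.\<close>

definition earring_incl :: "nat \<Rightarrow> (nat \<Rightarrow> real) \<Rightarrow> (nat \<times> (nat \<Rightarrow> real)) option" where
  "earring_incl j x = (if x = sphere_base then None else Some (j, x))"

abbreviation wedge_point :: "(nat \<times> (nat \<Rightarrow> real)) option" where
  "wedge_point \<equiv> None"

definition earring_open :: "nat \<Rightarrow> (nat \<times> (nat \<Rightarrow> real)) option set \<Rightarrow> bool" where
  "earring_open n U \<longleftrightarrow>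
     U \<subseteq> (\<Union>j. earring_incl j ` topspace (nsphere n)) \<and>
     (\<forall>j. openin (nsphere n) {x \<in> topspace (nsphere n). earring_incl j x \<in> U}) \<and>
     (wedge_point \<in> U \<longrightarrow> finite {j. \<not> earring_incl j ` topspace (nsphere n) \<subseteq> U})"

definition earring :: "nat \<Rightarrow> (nat \<times> (nat \<Rightarrow> real)) option topology" where
  "earring n = topology (earring_open n)"

lemma istopology_earring_open: "istopology (earring_open n)"
  unfolding istopology_def
proof (intro conjI allI impI)
  fix S T assume S: "earring_open n S" and T: "earring_open n T"
  have "{x \<in> topspace (nsphere n). earring_incl j x \<in> S \<inter> T} =
      {x \<in> topspace (nsphere n). earring_incl j x \<in> S} \<inter> {x \<in> topspace (nsphere n). earring_incl j x \<in> T}" for j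
    by blast
  moreover have "{j. \<not> earring_incl j ` topspace (nsphere n) \<subseteq> S \<inter> T} =
      {j. \<not> earring_incl j ` topspace (nsphere n) \<subseteq> S} \<union> {j. \<not> earring_incl j ` topspace (nsphere n) \<subseteq> T}"
    by blast
  ultimately show "earring_open n (S \<inter> T)"
    using S T unfolding earring_open_def by (auto intro: openin_Int)
next
  fix \<K> assume \<K>: "\<forall>K\<in>\<K>. earring_open n K"
  have "{x \<in> topspace (nsphere n). earring_incl j x \<in> \<Union>\<K>} =
      (\<Union>K\<in>\<K>. {x \<in> topspace (nsphere n). earring_incl j x \<in> K})" for j
    by blast
  then have "openin (nsphere n) {x \<in> topspace (nsphere n). earring_incl j x \<in> \<Union>\<K>}" for j
    using \<K> unfolding earring_open_def by auto
  moreover have "finite {j. \<not> earring_incl j ` topspace (nsphere n) \<subseteq> \<Union>\<K>}" if None: "wedge_point \<in> \<Union>\<K>"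
  proof -
    obtain K where K: "K \<in> \<K>" "wedge_point \<in> K"
      using None by blast
    then have "finite {j. \<not> earring_incl j ` topspace (nsphere n) \<subseteq> K}"
      using \<K> unfolding earring_open_def by blast
    then show ?thesis
      by (rule rev_finite_subset) (use K in blast)
  qed
  moreover have "\<Union>\<K> \<subseteq> (\<Union>j. earring_incl j ` topspace (nsphere n))"
    using \<K> unfolding earring_open_def by blast
  ultimately show "earring_open n (\<Union>\<K>)"
    unfolding earring_open_def by blast
qed

lemma openin_earring: "openin (earring n) = earring_open n"
  by (simp add: earring_def istopology_earring_open)

lemma topspace_earring: "topspace (earring n) = (\<Union>j. earring_incl j ` topspace (nsphere n))"
proof -
  have "{x \<in> topspace (nsphere n). earring_incl j x \<in> (\<Union>j. earring_incl j ` topspace (nsphere n))}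
      = topspace (nsphere n)" for j
    by blast
  moreover have "{j. \<not> earring_incl j ` topspace (nsphere n) \<subseteq>
      (\<Union>j. earring_incl j ` topspace (nsphere n))} = {}"
    by blast
  ultimately have "earring_open n (\<Union>j. earring_incl j ` topspace (nsphere n))"
    unfolding earring_open_def by simp
  then have "(\<Union>j. earring_incl j ` topspace (nsphere n)) \<subseteq> topspace (earring n)"
    by (intro openin_subset) (simp add: openin_earring)
  moreover have "topspace (earring n) \<subseteq> (\<Union>j. earring_incl j ` topspace (nsphere n))"
    using openin_topspace[of "earring n"] by (simp only: openin_earring earring_open_def)
  ultimately show ?thesis
    by blast
qed

section \<open>Wildness and rigidity\<close>

definition essential :: "nat \<Rightarrow> 'a topology \<Rightarrow> ((nat \<Rightarrow> real) \<Rightarrow> 'a) \<Rightarrow> bool" where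
  "essential n X g \<longleftrightarrow> continuous_map (nsphere n) X g \<and>
     \<not> (\<exists>c. homotopic_with (\<lambda>_. True) (nsphere n) X g (\<lambda>_. c))"

definition fully_essential ::
  "nat \<Rightarrow> 'a topology \<Rightarrow> ((nat \<times> (nat \<Rightarrow> real)) option \<Rightarrow> 'a) \<Rightarrow> bool" where
  "fully_essential n X f \<longleftrightarrow>
     continuous_map (earring n) X f \<and> (\<forall>j. essential n X (f \<circ> earring_incl j))"

definition wild_set :: "nat \<Rightarrow> 'a topology \<Rightarrow> 'a set" where
  "wild_set n X = {x \<in> topspace X. \<exists>f. fully_essential n X f \<and> f wedge_point = x}"

definition pi_rigid_at :: "nat \<Rightarrow> 'a topology \<Rightarrow> 'a \<Rightarrow> bool" where
  "pi_rigid_at n X x \<longleftrightarrow>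
     (\<exists>f. fully_essential n X f \<and> f wedge_point = x \<and>
        (\<forall>F. continuous_map (prod_topology (earring n) (top_of_set {0..1::real})) X F \<and>
             (\<forall>a\<in>topspace (earring n). F (a, 0) = f a) \<longrightarrow> F (wedge_point, 1) = x))"

definition rigid_set :: "nat \<Rightarrow> 'a topology \<Rightarrow> 'a set" where
  "rigid_set n X = {x \<in> topspace X. pi_rigid_at n X x}"

definition completely_pi_rigid :: "nat \<Rightarrow> 'a topology \<Rightarrow> bool" where
  "completely_pi_rigid n X \<longleftrightarrow> rigid_set n X = wild_set n X"

definition universal_cover ::
  "'c::topological_space set \<Rightarrow> ('c \<Rightarrow> 'b) \<Rightarrow> 'b::topological_space set \<Rightarrow> bool" where
  "universal_cover C c B \<longleftrightarrow> covering_space C c B \<and> simply_connected C"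

end

(* The key point is that every fully essential map is rigid. Suppose a homotopy of a fully essential map f
   moves the wedge point from x to y, and y is not x. For large j the j-th spheres at the two ends of the
   homotopy have disjoint images in all K_i with i large, so it suffices to see that homotopic maps of the
   n-sphere into K_i with disjoint images are null-homotopic: then the j-th sphere of f is null-homotopic
   by shape injectivity. For this, lift to the universal cover C (for n = 1 use K_i itself). Cut K_i into
   small cells. As C is (n-1)-connected, the identity of C is homotopic to a map h which is constant on
   the preimage of the (n-1)-skeleton. Replacing h by the constant on the cells which miss the first image
   gives a continuous map which agrees with h on the first image and is constant on the second, so that
   the first map is homotopic to a constant. *)

theory Submission
  imports Defs "HOL-Homology.Homology"
begin

section \<open>Spheres and quotients of compact spaces\<close>

text \<open>\<open>C\<close> may be non-compact and gets no cell structure of its own. All cells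
  stay downstairs, small enough to be evenly covered, and the homotopy upstairs is built over one
  cell at a time and there sheet by sheet. The prism \<open>{0..1} \<times> e\<close> over a k-cell
  is bounded by a k-sphere. Hence prescribing both ends of the homotopy needs null-homotopies of
  k-spheres in \<open>C\<close>; (n - 1)-connectedness provides them for k < n, and over the n-cells
  the final end must be left free.

  The bound n on the dimension of the cells has to be extracted from covering dimension. It rests on
  the fact that a simplex with m + 1 vertices has covering dimension at least m, which comes down to
  spheres being non-contractible.

  Two gaps separate the polyhedra from \<open>X\<close>. Disjointness of the images is visible only
  from some index on, so null-homotopies are pushed down to the earlier indices by the bonding maps.
  And these null-homotopies are free, whereas shape injectivity concerns based classes.\<close>

abbreviation homotopic_in ::
  "'a::topological_space set \<Rightarrow> 'b::topological_space set \<Rightarrow> ('a \<Rightarrow> 'b) \<Rightarrow> ('a \<Rightarrow> 'b) \<Rightarrow> bool" where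
  "homotopic_in \<equiv> homotopic_with_canon (\<lambda>_. True)"

abbreviation Sph :: "nat \<Rightarrow> (nat \<Rightarrow> real) set" where
  "Sph n \<equiv> topspace (nsphere n)"

text \<open>The type class topology on \<open>nat \<Rightarrow> real\<close> is the product
  topology. This is the bridge between the abstract topologies of the theorem and arguments with
  \<open>continuous_on\<close>, \<open>compact\<close> and coverings of sets.\<close>

lemma euclidean_nsphere: "nsphere n = top_of_set (Sph n)"
  by (simp add: nsphere euclidean_product_topology)

lemma topspace_nsphere: "Sph n = {x. (\<Sum>i\<le>n. (x i)\<^sup>2) = 1 \<and> (\<forall>i>n. x i = 0)}"
  by (simp add: nsphere)

lemma continuous_on_coordinate:
  assumes "continuous_on S f"
  shows "continuous_on S (\<lambda>x. f x i :: 'b::topological_space)"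
  using continuous_on_compose2[OF continuous_on_product_coordinates assms] by blast

text \<open>Closed and bounded does not imply compact in \<open>nat \<Rightarrow> real\<close>.
  Instead, the sphere is a closed subset of a product of intervals, which is compact by
  Tychonoff.\<close>

lemma compact_topspace_nsphere: "compact (Sph n)"
proof -
  have "compactin (product_topology (\<lambda>i::nat. euclideanreal) UNIV) (Pi\<^sub>E UNIV (\<lambda>i. {-1..1}))"
    by (subst compactin_PiE) auto
  then have "compact (Pi\<^sub>E UNIV (\<lambda>i::nat. {-1..1::real}))"
    by (simp add: euclidean_product_topology)
  moreover have "closed (Sph n)"
  proof -
    have "Sph n = {x. (\<Sum>i\<le>n. (x i)\<^sup>2) = 1} \<inter> (\<Inter>i\<in>{n<..}. {x. x i = 0})"
      by (auto simp: topspace_nsphere)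
    moreover have "closed {x::nat\<Rightarrow>real. (\<Sum>i\<le>n. (x i)\<^sup>2) = 1}" "closed (\<Inter>i\<in>{n<..}. {x::nat\<Rightarrow>real. x i = 0})"
      by (intro closed_Collect_eq closed_INT ballI continuous_intros continuous_on_product_coordinates)+
    ultimately show ?thesis by (simp add: closed_Int)
  qed
  moreover have "Sph n \<subseteq> Pi\<^sub>E UNIV (\<lambda>i::nat. {-1..1::real})"
  proof (clarsimp simp: topspace_nsphere PiE_iff)
    fix x :: "nat \<Rightarrow> real" and i
    assume x: "(\<Sum>i\<le>n. (x i)\<^sup>2) = 1" "\<forall>i>n. x i = 0"
    have "(x i)\<^sup>2 \<le> 1"
    proof (cases "i \<le> n")
      case True
      then show ?thesis
        using x member_le_sum[of i "{..n}" "\<lambda>i. (x i)\<^sup>2"] by auto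
    qed (use x in auto)
    then show "- 1 \<le> x i \<and> x i \<le> 1"
      using abs_square_le_1[of "x i"] by (auto simp: abs_le_iff)
  qed
  ultimately show ?thesis
    using compact_Int_closed by (fastforce simp: inf.absorb2)
qed

text \<open>A continuous map from a compact space to a Hausdorff space is closed, hence a quotient
  map onto its image, so maps that respect its fibres descend. Maps on spheres, cubes and balls are
  obtained in this way from maps on cylinders.\<close>

lemma continuous_on_compact_quotient:
  fixes P :: "'a::topological_space \<Rightarrow> 'b::t2_space" and H :: "'a \<Rightarrow> 'c::topological_space"
  assumes "compact A" "continuous_on A P" "continuous_on A H"
    and compat: "\<And>x y. \<lbrakk>x \<in> A; y \<in> A; P x = P y\<rbrakk> \<Longrightarrow> H x = H y"
  obtains G where "continuous_on (P ` A) G" "\<And>x. x \<in> A \<Longrightarrow> G (P x) = H x"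
proof -
  define G where "G = (\<lambda>y. H (inv_into A P y))"
  have G: "G (P x) = H x" if "x \<in> A" for x
    unfolding G_def by (rule compat) (use that in \<open>auto simp: f_inv_into_f inv_into_into\<close>)
  have "closedin (top_of_set (P ` A)) (P ` A \<inter> G -` U)" if "closed U" for U
  proof -
    have "P ` A \<inter> G -` U = P ` (A \<inter> H -` U)"
      using G by auto
    moreover have "closedin (top_of_set A) (A \<inter> H -` U)"
      using assms(3) that continuous_closedin_preimage by blast
    then have "compact (A \<inter> H -` U)"
      using assms(1) by (rule closedin_compact[rotated])
    then have "compact (P ` (A \<inter> H -` U))"
      by (intro compact_continuous_image continuous_on_subset[OF assms(2)]) auto
    ultimately show ?thesis
      by (auto intro!: closed_subset compact_imp_closed)
  qed
  then have "continuous_on (P ` A) G"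
    unfolding continuous_closedin_preimage_eq by blast
  with G that show ?thesis by blast
qed

text \<open>The suspension parametrization of the sphere: latitude \<open>s\<close>, longitude \<open>y\<close>.\<close>

definition sphere_susp :: "(nat \<Rightarrow> real) \<times> real \<Rightarrow> nat \<Rightarrow> real" where
  "sphere_susp = (\<lambda>(y, s) i. case i of 0 \<Rightarrow> s | Suc j \<Rightarrow> sqrt (1 - s\<^sup>2) * y j)"

lemma continuous_on_sphere_susp: "continuous_on A sphere_susp"
proof (rule continuous_on_coordinatewise_then_product)
  fix i :: nat
  have "continuous_on A (\<lambda>x::(nat \<Rightarrow> real) \<times> real. case i of 0 \<Rightarrow> snd x | Suc j \<Rightarrow> sqrt (1 - (snd x)\<^sup>2) * fst x j)"
    by (cases i) (auto intro!: continuous_intros continuous_on_coordinate[OF continuous_on_fst[OF continuous_on_id]])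
  then show "continuous_on A (\<lambda>x. sphere_susp x i)"
    by (simp add: sphere_susp_def case_prod_beta)
qed

lemma sum_squares_shift: "(\<Sum>i\<le>Suc n. (x i)\<^sup>2) = (x 0)\<^sup>2 + (\<Sum>i\<le>n. (x (Suc i) :: real)\<^sup>2)"
  by (rule sum.atMost_Suc_shift)

lemma sphere_susp_in:
  assumes "y \<in> Sph n" "s \<in> {-1..1}"
  shows "sphere_susp (y, s) \<in> Sph (Suc n)"
proof -
  have "s\<^sup>2 \<le> 1"
    using assms(2) by (simp add: abs_square_le_1 abs_le_iff)
  then show ?thesis
    using assms(1)
    by (auto simp del: sum.atMost_Suc simp: topspace_nsphere sum_squares_shift sphere_susp_def power_mult_distrib
        simp flip: sum_distrib_left split: nat.split)
qed

lemma sphere_susp_onto: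
  assumes "x \<in> Sph (Suc n)"
  obtains y s where "y \<in> Sph n" "s \<in> {-1..1}" "x = sphere_susp (y, s)"
proof -
  define s r where "s = x 0" and "r = (\<Sum>i\<le>n. (x (Suc i))\<^sup>2)"
  have x0: "x (Suc i) = 0" if "i > n" for i
    using assms that by (auto simp del: sum.atMost_Suc simp: topspace_nsphere sum_squares_shift s_def r_def)
  have eq: "s\<^sup>2 + r = 1"
    using assms by (simp del: sum.atMost_Suc add: topspace_nsphere sum_squares_shift s_def r_def)
  have "r \<ge> 0"
    by (simp add: r_def sum_nonneg)
  then have s: "s \<in> {-1..1}"
    using eq abs_square_le_1[of s] by (auto simp: abs_le_iff)
  show thesis
  proof (cases "r = 0")
    case True
    then have "x (Suc i) = 0" for i
      using x0[of i] unfolding r_def by (cases "i \<le> n") (auto simp: sum_nonneg_eq_0_iff)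
    moreover have "sqrt (1 - s\<^sup>2) = 0"
      using eq True by simp
    \<comment> \<open>At a pole every longitude serves; the base point of the lower sphere is
      taken.\<close>
    ultimately have "x = sphere_susp ((\<lambda>i. if i = 0 then 1 else 0), s)"
      by (auto simp: sphere_susp_def s_def fun_eq_iff split: nat.split)
    then show thesis
      using that in_topspace_nsphere s by blast
  next
    case False
    define y where "y = (\<lambda>i. x (Suc i) / sqrt r)"
    have "y \<in> Sph n"
      using x0 \<open>r \<ge> 0\<close> False
      by (auto simp: topspace_nsphere y_def power_divide r_def simp flip: sum_divide_distrib)
    moreover have "x = sphere_susp (y, s)"
    proof
      have "sqrt (1 - s\<^sup>2) = sqrt r"
        using eq by (simp add: algebra_simps)
      then show "x i = sphere_susp (y, s) i" for i
        using False by (cases i) (auto simp: sphere_susp_def s_def y_def)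
    qed
    ultimately show thesis
      using that s by blast
  qed
qed

text \<open>The longitude is lost only at the two poles \<open>s\<^sup>2 = 1\<close>. These are
  therefore the only identifications that a map on the cylinder has to respect.\<close>

lemma sphere_susp_eq:
  assumes "sphere_susp (y, s) = sphere_susp (y', s')"
  shows "s = s'" "s\<^sup>2 \<noteq> 1 \<Longrightarrow> y = y'"
proof -
  show s: "s = s'"
    using fun_cong[OF assms, of 0] by (simp add: sphere_susp_def)
  show "y = y'" if "s\<^sup>2 \<noteq> 1"
  proof
    fix i show "y i = y' i"
      using fun_cong[OF assms, of "Suc i"] that by (simp add: sphere_susp_def s)
  qed
qed

lemma sphere_susp_image: "sphere_susp ` (Sph n \<times> {-1..1}) = Sph (Suc n)"
proof
  show "Sph (Suc n) \<subseteq> sphere_susp ` (Sph n \<times> {-1..1})"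
  proof
    fix x assume "x \<in> Sph (Suc n)"
    then obtain y s where "y \<in> Sph n" "s \<in> {-1..1}" "x = sphere_susp (y, s)"
      by (rule sphere_susp_onto)
    then show "x \<in> sphere_susp ` (Sph n \<times> {-1..1})"
      using imageI[OF SigmaI[of y "Sph n" s "\<lambda>_. {-1..1}"], of sphere_susp] by simp
  qed
  show "sphere_susp ` (Sph n \<times> {-1..1}) \<subseteq> Sph (Suc n)"
  proof
    fix x assume "x \<in> sphere_susp ` (Sph n \<times> {-1..1})"
    then obtain z where z: "x = sphere_susp z" "z \<in> Sph n \<times> {-1..1}"
      by (rule imageE)
    then show "x \<in> Sph (Suc n)"
      using sphere_susp_in[of "fst z" n "snd z"] by (simp only: mem_Times_iff prod.collapse)
  qed
qed

text \<open>The sphere is the union of its meridians, which are connected and all pass through the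
  pole \<open>s = 1\<close>.\<close>

lemma connected_topspace_nsphere: "connected (Sph (Suc n))"
proof -
  let ?S = "Sph n"
  have "sphere_susp ` (?S \<times> {-1..1}) = (\<Union>y\<in>?S. sphere_susp ` ({y} \<times> {-1..1}))"
    by auto
  moreover have "connected (\<Union>y\<in>?S. sphere_susp ` ({y} \<times> {-1..1}))"
  proof (rule connected_Union)
    show "connected A" if A: "A \<in> (\<lambda>y. sphere_susp ` ({y} \<times> {-1..1})) ` ?S" for A
      using A by (auto intro!: connected_continuous_image continuous_on_sphere_susp connected_Times)
    have "sphere_susp (y, 1) = (\<lambda>i. if i = 0 then 1 else 0)" for y
      by (auto simp: sphere_susp_def fun_eq_iff split: nat.split)
    then have "(\<lambda>i. if i = 0 then 1 else 0) \<in> sphere_susp ` ({y} \<times> {-1..1})" for y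
      by (intro image_eqI[of _ _ "(y, 1)"]) auto
    then show "\<Inter>((\<lambda>y. sphere_susp ` ({y} \<times> {-1..1})) ` ?S) \<noteq> {}"
      by blast
  qed
  ultimately show ?thesis
    using sphere_susp_image by metis
qed

section \<open>Lifting to covering spaces\<close>

lemma continuous_on_openin_cover:
  assumes "\<And>z. z \<in> S \<Longrightarrow> \<exists>M. openin (top_of_set S) M \<and> z \<in> M \<and> continuous_on M f"
  shows "continuous_on S f"
  unfolding continuous_on_def
proof
  fix z assume z: "z \<in> S"
  then obtain M where M: "openin (top_of_set S) M" "z \<in> M" "continuous_on M f"
    using assms by blast
  then obtain W where W: "open W" "M = S \<inter> W"
    by (auto simp: openin_open)
  then have "at z within S = at z within M"
    using M(2) by (intro at_within_nhd[of z W]) auto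
  then show "(f \<longlongrightarrow> f z) (at z within S)"
    using M by (simp add: continuous_on_def)
qed

lemma covering_space_sheets:
  assumes "covering_space C c B"
  obtains T v where "\<And>b. b \<in> B \<Longrightarrow> b \<in> T b" "\<And>b. b \<in> B \<Longrightarrow> openin (top_of_set B) (T b)"
    "\<And>b. b \<in> B \<Longrightarrow> \<Union>(v b) = C \<inter> c -` T b"
    "\<And>b u. \<lbrakk>b \<in> B; u \<in> v b\<rbrakk> \<Longrightarrow> openin (top_of_set C) u"
    "\<And>b. b \<in> B \<Longrightarrow> pairwise disjnt (v b)"
    "\<And>b u. \<lbrakk>b \<in> B; u \<in> v b\<rbrakk> \<Longrightarrow> \<exists>q. homeomorphism u (T b) c q"
proof -
  have "\<forall>b\<in>B. \<exists>T v. b \<in> T \<and> openin (top_of_set B) T \<and> \<Union>v = C \<inter> c -` T \<and>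
      (\<forall>u\<in>v. openin (top_of_set C) u) \<and> pairwise disjnt v \<and> (\<forall>u\<in>v. \<exists>q. homeomorphism u T c q)"
    using assms unfolding covering_space_def by metis
  then obtain T v where "\<forall>b\<in>B. b \<in> T b \<and> openin (top_of_set B) (T b) \<and> \<Union>(v b) = C \<inter> c -` T b \<and>
      (\<forall>u\<in>v b. openin (top_of_set C) u) \<and> pairwise disjnt (v b) \<and> (\<forall>u\<in>v b. \<exists>q. homeomorphism u (T b) c q)"
    by metis
  then show thesis
    by (intro that[of T v]) auto
qed

text \<open>Agreement of two lifts is a locally constant property: near a given point each lift
  stays in its own sheet, and two sheets are equal or disjoint.\<close>

lemma covering_lift_unique:
  fixes g1 :: "'d::topological_space \<Rightarrow> 'c::topological_space"
  assumes cov: "covering_space C c B" and T: "connected T"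
    and g1: "continuous_on T g1" "g1 \<in> T \<rightarrow> C" and g2: "continuous_on T g2" "g2 \<in> T \<rightarrow> C"
    and eq: "\<And>x. x \<in> T \<Longrightarrow> c (g1 x) = c (g2 x)"
    and a: "a \<in> T" "g1 a = g2 a" and x: "x \<in> T"
  shows "g1 x = g2 x"
proof -
  have loc: "\<exists>N. openin (top_of_set T) N \<and> z \<in> N \<and> (\<forall>w\<in>N. g1 w = g2 w \<longleftrightarrow> g1 z = g2 z)" if z: "z \<in> T" for z
  proof -
    have "c (g1 z) \<in> B"
      using cov z g1 covering_space_imp_surjective by fastforce
    then obtain S v where S: "c (g1 z) \<in> S" "openin (top_of_set B) S" and v: "\<Union>v = C \<inter> c -` S"
      "\<And>u. u \<in> v \<Longrightarrow> openin (top_of_set C) u" "pairwise disjnt v" "\<And>u. u \<in> v \<Longrightarrow> \<exists>q. homeomorphism u S c q"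
      using cov unfolding covering_space_def by metis
    have "g1 z \<in> \<Union>v" "g2 z \<in> \<Union>v"
      using v(1) S(1) g1 g2 z eq by auto
    then obtain u1 u2 where u: "u1 \<in> v" "g1 z \<in> u1" "u2 \<in> v" "g2 z \<in> u2"
      by blast
    define N where "N = (T \<inter> g1 -` u1) \<inter> (T \<inter> g2 -` u2)"
    have "openin (top_of_set T) N"
      unfolding N_def using g1 g2 u v(2) by (intro openin_Int continuous_openin_preimage) auto
    moreover have "z \<in> N"
      using z u by (auto simp: N_def)
    moreover have "g1 w = g2 w \<longleftrightarrow> g1 z = g2 z" if w: "w \<in> N" for w
    proof (cases "u1 = u2")
      case True
      obtain q where "homeomorphism u1 S c q"
        using v(4) u by blast
      then have "inj_on c u1"
        by (metis homeomorphism_def inj_on_def)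
      moreover have "w \<in> T" "g1 w \<in> u1" "g2 w \<in> u1" "g2 z \<in> u1"
        using w u True by (auto simp: N_def)
      ultimately show ?thesis
        using eq z u by (metis inj_onD)
    next
      case False
      then have "u1 \<inter> u2 = {}"
        using v(3) u by (metis pairwiseD disjnt_def)
      then show ?thesis
        using w u by (auto simp: N_def)
    qed
    ultimately show ?thesis
      by blast
  qed
  show ?thesis
  proof (rule connected_induction_simple[OF T a(1) x, of "\<lambda>z. g1 z = g2 z"])
    show "\<exists>N. openin (top_of_set T) N \<and> z \<in> N \<and> (\<forall>x\<in>N. \<forall>y\<in>N. g1 x = g2 x \<longrightarrow> g1 y = g2 y)"
      if "z \<in> T" for z
      using loc[OF that] by metis
  qed (use a in auto)
qed

lemma covering_lift_const:
  fixes g :: "'d::topological_space \<Rightarrow> 'c::topological_space"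
  assumes "covering_space C c B" "connected T" "continuous_on T g" "g \<in> T \<rightarrow> C"
    and "\<And>x. x \<in> T \<Longrightarrow> c (g x) = b" "x \<in> T" "y \<in> T"
  shows "g x = g y"
  using covering_lift_unique[of C c B T g "\<lambda>_. g y" y x] assms by force

text \<open>A Lebesgue number on the compact cylinder permits cutting time into \<open>N\<close>
  steps such that, during one step and for nearby parameters, \<open>h\<close> stays in one evenly
  covered set; the lift is extended step by step. Since \<open>Y\<close> need not be locally
  connected, the sheet is chosen for each \<open>y\<close> separately, and continuity in
  \<open>y\<close> is recovered from uniqueness of lifts along the time interval.\<close>

lemma covering_lift_homotopy:
  fixes h :: "real \<times> 'd::metric_space \<Rightarrow> 'b::topological_space" and f :: "'d \<Rightarrow> 'c::topological_space"
  assumes cov: "covering_space C c B" and Y: "compact Y"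
    and h: "continuous_on ({0..1} \<times> Y) h" "h \<in> ({0..1} \<times> Y) \<rightarrow> B"
    and f: "continuous_on Y f" "f \<in> Y \<rightarrow> C" "\<And>y. y \<in> Y \<Longrightarrow> h (0, y) = c (f y)"
  obtains k where "continuous_on ({0..1} \<times> Y) k" "k \<in> ({0..1} \<times> Y) \<rightarrow> C"
    "\<And>y. y \<in> Y \<Longrightarrow> k (0, y) = f y" "\<And>z. z \<in> {0..1} \<times> Y \<Longrightarrow> c (k z) = h z"
proof -
  obtain T v where T: "\<And>b. b \<in> B \<Longrightarrow> b \<in> T b" "\<And>b. b \<in> B \<Longrightarrow> openin (top_of_set B) (T b)"
      and v: "\<And>b. b \<in> B \<Longrightarrow> \<Union>(v b) = C \<inter> c -` T b"
        "\<And>b u. \<lbrakk>b \<in> B; u \<in> v b\<rbrakk> \<Longrightarrow> openin (top_of_set C) u"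
        "\<And>b. b \<in> B \<Longrightarrow> pairwise disjnt (v b)"
        "\<And>b u. \<lbrakk>b \<in> B; u \<in> v b\<rbrakk> \<Longrightarrow> \<exists>q. homeomorphism u (T b) c q"
    by (rule covering_space_sheets[OF cov]) (rule that)
  define Z where "Z = {0..1::real} \<times> Y"
  have "compact Z"
    unfolding Z_def using Y by (intro compact_Times) auto
  have "\<exists>O'. open O' \<and> z \<in> O' \<and> Z \<inter> O' \<subseteq> h -` T (h z)" if z: "z \<in> Z" for z
  proof -
    have "h z \<in> B"
      using h(2) z by (auto simp: Z_def)
    then have "openin (top_of_set Z) (Z \<inter> h -` T (h z))" "h z \<in> T (h z)"
      using h T unfolding Z_def by (auto intro: continuous_openin_preimage)
    then show ?thesis
      using z unfolding openin_open by blast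
  qed
  then obtain O' where O': "\<And>z. z \<in> Z \<Longrightarrow> open (O' z) \<and> z \<in> O' z \<and> Z \<inter> O' z \<subseteq> h -` T (h z)"
    by metis
  obtain \<epsilon> where \<epsilon>: "\<epsilon> > 0" "\<And>z. z \<in> Z \<Longrightarrow> \<exists>G\<in>O' ` Z. ball z \<epsilon> \<subseteq> G"
    using Heine_Borel_lemma[OF \<open>compact Z\<close>, of "O' ` Z"] O' by blast
  have nbhd: "\<exists>b\<in>B. h ` (Z \<inter> ball z \<epsilon>) \<subseteq> T b" if z: "z \<in> Z" for z
  proof -
    obtain z' where "z' \<in> Z" "ball z \<epsilon> \<subseteq> O' z'"
      using \<epsilon>(2)[OF z] by blast
    moreover have "h z' \<in> B"
      using h(2) \<open>z' \<in> Z\<close> by (auto simp: Z_def)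
    ultimately show ?thesis
      using O' by blast
  qed
  obtain N :: nat where N: "N > 0" "1 / N < \<epsilon>"
    using \<epsilon>(1) by (metis nat_approx_posE of_nat_Suc zero_less_Suc)
  have "\<exists>k. continuous_on ({0..j / N} \<times> Y) k \<and> k \<in> ({0..j / N} \<times> Y) \<rightarrow> C \<and>
      (\<forall>y\<in>Y. k (0, y) = f y) \<and> (\<forall>z\<in>{0..j / N} \<times> Y. c (k z) = h z)" if "j \<le> N" for j :: nat
    using that
  proof (induction j)
    case 0
    have "continuous_on ({0::real} \<times> Y) (\<lambda>z. f (snd z))"
      by (intro continuous_on_compose2[OF f(1)] continuous_intros) auto
    then show ?case
      using f by (intro exI[of _ "\<lambda>z. f (snd z)"]) (auto simp: Pi_iff)
  next
    case (Suc j)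
    then obtain k where k: "continuous_on ({0..j / N} \<times> Y) k" "k \<in> ({0..j / N} \<times> Y) \<rightarrow> C"
      "\<And>y. y \<in> Y \<Longrightarrow> k (0, y) = f y" "\<And>z. z \<in> {0..j / N} \<times> Y \<Longrightarrow> c (k z) = h z"
      by auto
    define s where "s = j / N"
    define J where "J = {s..Suc j / N}"
    have s: "0 \<le> s" "s \<in> J" "J \<subseteq> {0..1}" "s \<in> {0..j/N}"
      using Suc.prems N by (auto simp: s_def J_def field_simps)
    have ball: "(t, y) \<in> Z \<inter> ball (s, y) \<epsilon>" if "t \<in> J" "y \<in> Y" for t y
    proof -
      have "t \<in> {0..1}"
        using that s by auto
      moreover have "s \<le> t" "t \<le> s + 1 / N"
        using that by (auto simp: J_def s_def add_divide_distrib)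
      ultimately show ?thesis
        using that N by (auto simp: Z_def dist_Pair_Pair dist_real_def)
    qed
    have sZ: "(s, y) \<in> Z" if "y \<in> Y" for y
      using that s by (auto simp: Z_def)
    have sheet: "\<exists>u q b. b \<in> B \<and> h ` (Z \<inter> ball (s, y) \<epsilon>) \<subseteq> T b \<and> openin (top_of_set C) u \<and> k (s, y) \<in> u \<and>
        homeomorphism u (T b) c q" if y: "y \<in> Y" for y
    proof -
      obtain b where b: "b \<in> B" "h ` (Z \<inter> ball (s, y) \<epsilon>) \<subseteq> T b"
        using nbhd[OF sZ[OF y]] by blast
      have "c (k (s, y)) \<in> T b"
        using b(2) k(4)[of "(s, y)"] ball[OF s(2) y] s y by auto
      moreover have "k (s, y) \<in> C"
        using k(2) s y by auto
      ultimately have "k (s, y) \<in> \<Union>(v b)"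
        using v(1)[OF b(1)] by simp
      then obtain u where u: "u \<in> v b" "k (s, y) \<in> u" ..
      then obtain q where "homeomorphism u (T b) c q"
        using v(4) b(1) by blast
      with b u v(2)[OF b(1) u(1)] show ?thesis
        by (intro exI[of _ u] exI[of _ q] exI[of _ b]) auto
    qed
    then obtain u q b where u: "\<And>y. y \<in> Y \<Longrightarrow> b y \<in> B \<and> h ` (Z \<inter> ball (s, y) \<epsilon>) \<subseteq> T (b y) \<and>
        openin (top_of_set C) (u y) \<and> k (s, y) \<in> u y \<and> homeomorphism (u y) (T (b y)) c (q y)"
      by metis
    have uC: "u y \<subseteq> C" if "y \<in> Y" for y
      using u[OF that] openin_imp_subset by blast
    \<comment> \<open>The branch \<open>q y\<close> is an arbitrary choice for each
      \<open>y\<close>, so nothing about continuity in \<open>y\<close> is built in.\<close>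
    define k' where "k' = (\<lambda>(t, y). q y (h (t, y)))"
    have hom: "c ` u y = T (b y)" "q y ` T (b y) = u y" "continuous_on (T (b y)) (q y)"
        "\<And>x. x \<in> u y \<Longrightarrow> q y (c x) = x" "\<And>x. x \<in> T (b y) \<Longrightarrow> c (q y x) = x" if "y \<in> Y" for y
      using u[OF that] by (auto simp: homeomorphism_def)
    have hT: "h z \<in> T (b y)" if "z \<in> Z \<inter> ball (s, y) \<epsilon>" "y \<in> Y" for z y
      using u[OF that(2)] that(1) by blast
    have k': "k' (t, y) \<in> u y" "c (k' (t, y)) = h (t, y)" if "t \<in> J" "y \<in> Y" for t y
      using hom[OF that(2)] hT[OF ball[OF that] that(2)] by (auto simp: k'_def)
    have k's: "k' (s, y) = k (s, y)" if y: "y \<in> Y" for y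
    proof -
      have "c (k (s, y)) = h (s, y)"
        using k(4)[of "(s, y)"] s y by simp
      then show ?thesis
        using hom(4)[OF y, of "k (s, y)"] u[OF y] by (simp add: k'_def)
    qed
    have contt: "continuous_on J (\<lambda>t. k' (t, y))" if y: "y \<in> Y" for y
    proof -
      have "continuous_on J (\<lambda>t. h (t, y))"
        using s y by (intro continuous_on_compose2[OF h(1)] continuous_intros) auto
      then show ?thesis
        unfolding k'_def using continuous_on_compose2[OF hom(3)[OF y], of J "\<lambda>t. h (t, y)"] hT[OF ball[OF _ y] y]
        by (simp add: image_subset_iff)
    qed
    have cont: "continuous_on (J \<times> Y) k'"
    proof -
      have "\<exists>M. openin (top_of_set (J \<times> Y)) M \<and> z \<in> M \<and> continuous_on M k'" if z: "z \<in> J \<times> Y" for z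
      proof -
        obtain t0 y0 where y0: "z = (t0, y0)" "t0 \<in> J" "y0 \<in> Y"
          using z by auto
        have "continuous_on Y (\<lambda>y. k (s, y))"
          using s by (intro continuous_on_compose2[OF k(1)] continuous_intros) auto
        moreover have "(\<lambda>y. k (s, y)) \<in> Y \<rightarrow> C"
          using k(2) s by auto
        ultimately have 1: "openin (top_of_set Y) (Y \<inter> (\<lambda>y. k (s, y)) -` u y0)"
          using u[OF y0(3)] continuous_openin_preimage by blast
        \<comment> \<open>The slack in \<open>1 / N < \<epsilon>\<close> bounds how far
          \<open>y\<close> may move away from \<open>y0\<close> while \<open>h\<close> still maps
          \<open>J \<times> {y}\<close> into \<open>T (b y0)\<close>.\<close>
        obtain \<delta> where \<delta>: "\<delta> > 0" "1 / N + \<delta> \<le> \<epsilon>"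
          using N(2) by (metis add.commute diff_gt_0_iff_gt le_diff_eq order_refl)
        define M where "M = Y \<inter> (\<lambda>y. k (s, y)) -` u y0 \<inter> ball y0 \<delta>"
        have M: "openin (top_of_set Y) M" "y0 \<in> M"
          unfolding M_def using 1 \<delta> u[OF y0(3)] y0 by (auto intro: openin_Int_open)
        have h0: "h (t, y) \<in> T (b y0)" if "t \<in> J" "y \<in> M" for t y
        proof -
          have "dist (s, y0) (t, y) \<le> \<bar>s - t\<bar> + dist y0 y"
            using sqrt_sum_squares_le_sum_abs[of "dist s t" "dist y0 y"] by (simp add: dist_Pair_Pair dist_real_def)
          also have "\<dots> < \<epsilon>"
            using that \<delta> N by (auto simp: M_def J_def s_def diff_divide_distrib add_divide_distrib)
          finally show ?thesis
            using that s by (intro hT[OF _ y0(3)]) (auto simp: Z_def M_def)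
        qed
        have conth: "continuous_on (J \<times> M) (\<lambda>z. q y0 (h z))"
        proof (rule continuous_on_compose2[OF hom(3)[OF y0(3)]])
          show "continuous_on (J \<times> M) h"
            by (rule continuous_on_subset[OF h(1)]) (use s in \<open>auto simp: M_def\<close>)
        qed (use h0 in auto)
        \<comment> \<open>The branches chosen at \<open>y\<close> and at \<open>y0\<close> may
          differ, but along \<open>J\<close> both lift the path of \<open>y\<close> and both start
          at \<open>k (s, y)\<close>. Hence near \<open>y0\<close> the single continuous branch
          \<open>q y0\<close> describes \<open>k'\<close>.\<close>
        have "k' (t, y) = q y0 (h (t, y))" if ty: "t \<in> J" "y \<in> M" for t y
        proof -
          have y: "y \<in> Y" "k (s, y) \<in> u y0"
            using ty by (auto simp: M_def)
          show ?thesis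
          proof (rule covering_lift_unique[OF cov, of J "\<lambda>t. k' (t, y)" "\<lambda>t. q y0 (h (t, y))" s t])
            show "continuous_on J (\<lambda>t. q y0 (h (t, y)))"
              using ty by (intro continuous_on_compose2[OF conth] continuous_intros) auto
            show "(\<lambda>t. k' (t, y)) \<in> J \<rightarrow> C"
              using k' y(1) uC by blast
            show "(\<lambda>t. q y0 (h (t, y))) \<in> J \<rightarrow> C"
              using h0 ty(2) hom(2)[OF y0(3)] uC[OF y0(3)] by blast
            show "c (k' (t, y)) = c (q y0 (h (t, y)))" if "t \<in> J" for t
              using k'(2)[OF that y(1)] hom(5)[OF y0(3) h0[OF that ty(2)]] by simp
            have "q y0 (c (k (s, y))) = k (s, y)"
              by (rule hom(4)[OF y0(3) y(2)])
            then show "k' (s, y) = q y0 (h (s, y))"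
              using k's y k(4)[of "(s, y)"] s by auto
          qed (use contt y s ty in \<open>auto simp: J_def\<close>)
        qed
        then have "continuous_on (J \<times> M) k'"
          using conth by (subst continuous_on_cong) auto
        moreover have "openin (top_of_set (J \<times> Y)) (J \<times> M)"
          using M by (simp add: openin_Times)
        ultimately show ?thesis
          using y0 M by blast
      qed
      then show ?thesis
        by (rule continuous_on_openin_cover)
    qed
    define K where "K = (\<lambda>z. if fst z \<le> s then k z else k' z)"
    have "continuous_on ({0..s} \<times> Y \<union> J \<times> Y) K"
      unfolding K_def
    proof (rule continuous_on_cases_local)
      show "closedin (top_of_set ({0..s} \<times> Y \<union> J \<times> Y)) ({0..s} \<times> Y)"
        unfolding closedin_closed
        by (intro exI[of _ "{..s} \<times> UNIV"]) (use s(1) in \<open>auto simp: closed_Times J_def\<close>)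
      show "closedin (top_of_set ({0..s} \<times> Y \<union> J \<times> Y)) (J \<times> Y)"
        unfolding closedin_closed
        by (intro exI[of _ "{s..} \<times> UNIV"]) (use s(1) s(2) in \<open>auto simp: closed_Times J_def\<close>)
      show "continuous_on ({0..s} \<times> Y) k"
        using k(1) by (simp add: s_def)
      show "k z = k' z" if "z \<in> {0..s} \<times> Y \<and> \<not> fst z \<le> s \<or> z \<in> J \<times> Y \<and> fst z \<le> s" for z
        using that k's by (force simp: J_def)
    qed (use cont in auto)
    moreover have "{0..Suc j / N} \<times> Y = {0..s} \<times> Y \<union> J \<times> Y"
      using s(1) s(2) by (auto simp: J_def)
    moreover have "K z \<in> C \<and> c (K z) = h z" if z: "z \<in> {0..s} \<times> Y \<union> J \<times> Y" for z
    proof (cases "fst z \<le> s")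
      case True
      then have "z \<in> {0..j / N} \<times> Y"
        using z s(1) by (auto simp: s_def J_def)
      then show ?thesis
        using True funcset_mem[OF k(2)] k(4)[of z] unfolding K_def by simp
    next
      case False
      then obtain t y where "z = (t, y)" "t \<in> J" "y \<in> Y"
        using z by auto
      then show ?thesis
        using False k'[of t y] uC[of y] by (auto simp: K_def)
    qed
    moreover have "K (0, y) = f y" if "y \<in> Y" for y
      using k(3)[OF that] s by (simp add: K_def)
    ultimately have "continuous_on ({0..Suc j / N} \<times> Y) K \<and> K \<in> ({0..Suc j / N} \<times> Y) \<rightarrow> C \<and>
        (\<forall>y\<in>Y. K (0, y) = f y) \<and> (\<forall>z\<in>{0..Suc j / N} \<times> Y. c (K z) = h z)"
      by auto
    then show ?case
      by (rule exI[of _ K])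
  qed
  from this[of N] show thesis
    using N that by auto
qed

text \<open>Read along the meridians, the map is a homotopy between two constants on the sphere of
  dimension \<open>m + 1\<close>. Its lift is started at a constant; the final stage lifts a
  constant on a connected space and is thus constant, so that the lift descends to the suspension.
  On a circle this breaks down, because the sphere of longitudes then has two points.\<close>

lemma covering_lift_sphere:
  fixes f :: "(nat \<Rightarrow> real) \<Rightarrow> 'b::topological_space" and c :: "'c::topological_space \<Rightarrow> 'b"
  assumes cov: "covering_space C c B"
    and f: "continuous_on (Sph (Suc (Suc m))) f" "f \<in> Sph (Suc (Suc m)) \<rightarrow> B"
  obtains F where "continuous_on (Sph (Suc (Suc m))) F"
    "F \<in> Sph (Suc (Suc m)) \<rightarrow> C" "\<And>x. x \<in> Sph (Suc (Suc m)) \<Longrightarrow> c (F x) = f x"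
proof -
  define Y where "Y = Sph (Suc m)"
  define S where "S = Sph (Suc (Suc m))"
  define P where "P = (\<lambda>(t::real, y). sphere_susp (y, 2 * t - 1))"
  have P: "continuous_on A P" for A
    unfolding P_def case_prod_beta
    by (intro continuous_on_compose2[OF continuous_on_sphere_susp[of UNIV]] continuous_intros) auto
  have im: "P ` ({0..1} \<times> Y) = S"
  proof -
    have "P ` ({0..1} \<times> Y) = sphere_susp ` (Y \<times> {-1..1})"
    proof -
      have "(\<lambda>(t::real, y). (y, 2 * t - 1)) ` ({0..1} \<times> Y) = Y \<times> {-1..1}"
      proof (intro subset_antisym subsetI)
        fix z :: "(nat \<Rightarrow> real) \<times> real" assume "z \<in> Y \<times> {-1..1}"
        then show "z \<in> (\<lambda>(t::real, y). (y, 2 * t - 1)) ` ({0..1} \<times> Y)"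
          by (intro image_eqI[of _ _ "((snd z + 1) / 2, fst z)"]) (auto simp: field_simps)
      qed auto
      then have "sphere_susp ` ((\<lambda>(t::real, y). (y, 2 * t - 1)) ` ({0..1} \<times> Y)) = sphere_susp ` (Y \<times> {-1..1})"
        by simp
      then show ?thesis
        by (simp add: image_image P_def case_prod_beta)
    qed
    then show ?thesis
      using sphere_susp_image[of "Suc m"] by (simp add: S_def Y_def)
  qed
  have pole: "P (t, y) = (\<lambda>i. if i = 0 then 2 * t - 1 else 0)" if "t = 0 \<or> t = 1" for t y
    using that by (auto simp: P_def sphere_susp_def fun_eq_iff split: nat.split)
  define h where "h = (\<lambda>z. f (P z))"
  have h: "continuous_on ({0..1} \<times> Y) h" "h \<in> ({0..1} \<times> Y) \<rightarrow> B"
  proof -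
    show "continuous_on ({0..1} \<times> Y) h"
      unfolding h_def by (rule continuous_on_compose2[OF f(1) P]) (use im in \<open>simp add: S_def\<close>)
    show "h \<in> ({0..1} \<times> Y) \<rightarrow> B"
      unfolding h_def using im funcset_mem[OF f(2)] S_def by blast
  qed
  have Y: "compact Y" "connected Y" "Y \<noteq> {}"
    unfolding Y_def using in_topspace_nsphere by (auto simp: compact_topspace_nsphere connected_topspace_nsphere)
  then obtain y0 where y0: "y0 \<in> Y"
    by blast
  then have "h (0, y0) \<in> c ` C"
    using h(2) covering_space_imp_surjective[OF cov] by auto
  then obtain e where e: "e \<in> C" "c e = h (0, y0)"
    by force
  have "h (0, y) = c e" for y
    using pole[of 0] e by (simp add: h_def)
  then obtain k where k: "continuous_on ({0..1} \<times> Y) k" "k \<in> ({0..1} \<times> Y) \<rightarrow> C"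
    "\<And>y. y \<in> Y \<Longrightarrow> k (0, y) = e" "\<And>z. z \<in> {0..1} \<times> Y \<Longrightarrow> c (k z) = h z"
    using covering_lift_homotopy[OF cov Y(1) h, of "\<lambda>_. e"] e(1) by auto
  have k1: "k (1, y) = k (1, y')" if y: "y \<in> Y" "y' \<in> Y" for y y'
  proof (rule covering_lift_const[OF cov Y(2) _ _ _ y])
    show "continuous_on Y (\<lambda>y. k (1, y))"
      by (intro continuous_on_compose2[OF k(1)] continuous_intros) auto
    show "(\<lambda>y. k (1, y)) \<in> Y \<rightarrow> C"
      using k(2) by auto
    show "c (k (1, y)) = h (1, y0)" if "y \<in> Y" for y
      using that k(4)[of "(1, y)"] pole[of 1] by (simp add: h_def)
  qed
  have compat: "k z = k z'" if z: "z \<in> {0..1} \<times> Y" "z' \<in> {0..1} \<times> Y" "P z = P z'" for z z'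
  proof -
    obtain t y t' y' where [simp]: "z = (t, y)" "z' = (t', y')"
      by (meson surj_pair)
    have eq: "sphere_susp (y, 2 * t - 1) = sphere_susp (y', 2 * t' - 1)"
      using z(3) by (simp add: P_def)
    have t: "t' = t"
      using sphere_susp_eq(1)[OF eq] by simp
    show ?thesis
    proof (cases "(2 * t - 1)\<^sup>2 = 1")
      case True
      then have "t = 0 \<or> t = 1"
        by (auto simp: power2_eq_1_iff)
      then show ?thesis
        using z(1,2) t k(3)[of y] k(3)[of y'] k1[of y y'] by auto
    next
      case False
      then show ?thesis
        using sphere_susp_eq(2)[OF eq] t by simp
    qed
  qed
  obtain F where F: "continuous_on (P ` ({0..1} \<times> Y)) F" "\<And>z. z \<in> {0..1} \<times> Y \<Longrightarrow> F (P z) = k z"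
    by (rule continuous_on_compact_quotient[OF compact_Times[OF compact_Icc Y(1)] P k(1)], erule (2) compat, rule that)
  show thesis
  proof (rule that[of F])
    have "F x \<in> C \<and> c (F x) = f x" if "x \<in> S" for x
    proof -
      have "x \<in> P ` ({0..1} \<times> Y)"
        using that im by simp
      then obtain z where z: "x = P z" "z \<in> {0..1} \<times> Y"
        by (rule imageE)
      then show ?thesis
        using F(2)[OF z(2)] k(4)[OF z(2)] funcset_mem[OF k(2) z(2)] by (simp add: h_def)
    qed
    then show "F \<in> Sph (Suc (Suc m)) \<rightarrow> C"
      "\<And>x. x \<in> Sph (Suc (Suc m)) \<Longrightarrow> c (F x) = f x"
      by (auto simp: S_def)
  qed (use F(1) im in \<open>simp add: S_def\<close>)
qed

section \<open>Extending maps over prisms\<close>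

lemma continuous_on_Max_image:
  fixes f :: "'i \<Rightarrow> 'a::topological_space \<Rightarrow> real"
  assumes "finite A" "A \<noteq> {}" "\<And>i. i \<in> A \<Longrightarrow> continuous_on S (f i)"
  shows "continuous_on S (\<lambda>x. Max ((\<lambda>i. f i x) ` A))"
  using assms
proof (induction rule: finite_ne_induct)
  case (insert i A)
  then have "(\<lambda>x. Max ((\<lambda>i. f i x) ` insert i A)) = (\<lambda>x. max (f i x) (Max ((\<lambda>i. f i x) ` A)))"
    by (simp add: Max_insert)
  then show ?case
    using insert by (auto intro: continuous_on_max)
qed auto

lemma homotopic_with_canon_imp:
  assumes "homotopic_with_canon P S T f g"
  shows "\<exists>H. continuous_on ({0..1::real} \<times> S) H \<and> H \<in> ({0..1} \<times> S) \<rightarrow> T \<and>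
    (\<forall>x. H (0, x) = f x) \<and> (\<forall>x. H (1, x) = g x)"
  using assms unfolding homotopic_with_def
proof (elim exE conjE)
  fix H assume "continuous_map (prod_topology (top_of_set {0..1::real}) (top_of_set S)) (top_of_set T) H"
    "\<forall>x. H (0, x) = f x" "\<forall>x. H (1, x) = g x"
  then show ?thesis
    by (intro exI[of _ H]) (simp add: image_subset_iff_funcset)
qed

text \<open>The cube \<open>[-1, 1]\<^sup>k\<^sup>+\<^sup>1\<close> is the cone over its boundary, which is radially identified with the sphere.\<close>

lemma extend_from_cube_boundary:
  fixes k :: nat and F :: "(nat \<Rightarrow> real) \<Rightarrow> 'c::topological_space"
  defines "W \<equiv> {w. (\<forall>i\<le>k. \<bar>w i\<bar> \<le> 1) \<and> (\<forall>i>k. w i = 0)}"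
  defines "W' \<equiv> {w \<in> W. \<exists>i\<le>k. \<bar>w i\<bar> = 1}"
  assumes null: "\<And>g. \<lbrakk>continuous_on (Sph k) g; g \<in> Sph k \<rightarrow> C\<rbrakk> \<Longrightarrow>
      \<exists>a. homotopic_in (Sph k) C g (\<lambda>_. a)"
    and F: "continuous_on W' F" "F \<in> W' \<rightarrow> C"
  obtains G where "continuous_on W G" "G \<in> W \<rightarrow> C" "\<And>w. w \<in> W' \<Longrightarrow> G w = F w"
proof -
  define S where "S = Sph k"
  define \<mu> where "\<mu> = (\<lambda>y::nat \<Rightarrow> real. Max ((\<lambda>i. \<bar>y i\<bar>) ` {..k}))"
  \<comment> \<open>The point of maximum norm \<open>1 - t\<close> on the ray through
    \<open>y\<close>: on the boundary of the cube for \<open>t = 0\<close>, and its centre for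
    \<open>t = 1\<close>, where the null-homotopy no longer depends on \<open>y\<close>.\<close>
  define \<kappa> where "\<kappa> = (\<lambda>(t::real, y::nat \<Rightarrow> real) i. (1 - t) * (y i / \<mu> y))"
  define n2 where "n2 = (\<lambda>y::nat \<Rightarrow> real. sqrt (\<Sum>i\<le>k. (y i)\<^sup>2))"
  have S: "y \<in> S \<longleftrightarrow> n2 y = 1 \<and> (\<forall>i>k. y i = 0)" for y
    by (auto simp: S_def topspace_nsphere n2_def)
  have mu_ge: "\<bar>y i\<bar> \<le> \<mu> y" if "i \<le> k" for i y
    unfolding \<mu>_def using that by (intro Max_ge) auto
  have mu_ex: "\<exists>i\<le>k. \<mu> y = \<bar>y i\<bar>" for y
  proof -
    have "\<mu> y \<in> (\<lambda>i. \<bar>y i\<bar>) ` {..k}"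
      unfolding \<mu>_def by (rule Max_in) auto
    then show ?thesis by auto
  qed
  have mu_nonneg: "\<mu> y \<ge> 0" for y
    using mu_ex[of y] by auto
  have mu_scale: "\<mu> (\<lambda>i. a * y i) = \<bar>a\<bar> * \<mu> y" for a y
  proof (rule antisym)
    obtain i where "i \<le> k" "\<mu> (\<lambda>i. a * y i) = \<bar>a * y i\<bar>"
      using mu_ex by blast
    then show "\<mu> (\<lambda>i. a * y i) \<le> \<bar>a\<bar> * \<mu> y"
      using mu_ge[of i y] by (simp add: abs_mult mult_left_mono)
    obtain i where "i \<le> k" "\<mu> y = \<bar>y i\<bar>"
      using mu_ex by blast
    then show "\<bar>a\<bar> * \<mu> y \<le> \<mu> (\<lambda>i. a * y i)"
      using mu_ge[of i "\<lambda>i. a * y i"] by (simp add: abs_mult)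
  qed
  have n2_scale: "n2 (\<lambda>i. a * y i) = \<bar>a\<bar> * n2 y" for a y
    by (simp add: n2_def power_mult_distrib real_sqrt_mult flip: sum_distrib_left)
  have n2_0: "n2 y = 0 \<longleftrightarrow> (\<forall>i\<le>k. y i = 0)" for y
    by (auto simp: n2_def sum_nonneg_eq_0_iff)
  have mu_0: "\<mu> y = 0 \<longleftrightarrow> (\<forall>i\<le>k. y i = 0)" for y
  proof
    assume "\<mu> y = 0"
    then show "\<forall>i\<le>k. y i = 0"
      using mu_ge[of _ y] by simp
  next
    assume "\<forall>i\<le>k. y i = 0"
    then show "\<mu> y = 0"
      using mu_ex[of y] by auto
  qed
  have mu_pos: "\<mu> y > 0" if "y \<in> S" for y
    using that mu_0[of y] n2_0[of y] mu_nonneg[of y] S[of y] by (simp add: less_le)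
  have cont_mu: "continuous_on A \<mu>" for A
    unfolding \<mu>_def
    by (intro continuous_on_Max_image continuous_intros continuous_on_subset[OF continuous_on_product_coordinates]) auto
  have cont_kappa: "continuous_on ({0..1} \<times> S) \<kappa>"
  proof (rule continuous_on_coordinatewise_then_product)
    fix i
    have "continuous_on ({0..1} \<times> S) (\<lambda>z. (1 - fst z) * (snd z i / \<mu> (snd z)))"
    proof (intro continuous_on_mult continuous_on_divide)
      show "continuous_on ({0..1} \<times> S) (\<lambda>z::real \<times> (nat \<Rightarrow> real). snd z i)"
        by (rule continuous_on_coordinate[OF continuous_on_snd[OF continuous_on_id]])
      show "continuous_on ({0..1} \<times> S) (\<lambda>z::real \<times> (nat \<Rightarrow> real). \<mu> (snd z))"
        by (rule continuous_on_compose2[OF cont_mu[of UNIV] continuous_on_snd[OF continuous_on_id]]) simp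
      show "\<forall>z\<in>{0..1} \<times> S. \<mu> (snd z) \<noteq> 0"
        using mu_pos by (metis less_irrefl mem_Times_iff)
    qed (intro continuous_intros)
    then show "continuous_on ({0..1} \<times> S) (\<lambda>z. \<kappa> z i)"
      by (simp add: \<kappa>_def case_prod_beta)
  qed
  have mu_kappa: "\<mu> (\<kappa> (t, y)) = 1 - t" if "t \<in> {0..1}" "y \<in> S" for t y
    using mu_scale[of "(1 - t) / \<mu> y" y] that mu_pos[OF that(2)] by (simp add: \<kappa>_def mult.commute)
  have onto: "\<exists>y\<in>S. w = \<kappa> (1 - \<mu> w, y)" if w: "w \<in> W" for w
  proof (cases "\<mu> w = 0")
    case True
    then have "w i = 0" for i
      using w mu_0[of w] by (cases "i \<le> k") (auto simp: W_def)
    then show ?thesis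
      using in_topspace_nsphere[of k] True by (auto simp: \<kappa>_def S_def)
  next
    case False
    then have n: "n2 w > 0"
      using n2_0[of w] mu_0[of w] by (simp add: n2_def sum_nonneg less_le)
    define y where "y = (\<lambda>i. (1 / n2 w) * w i)"
    have "n2 y = 1" "\<mu> y = \<mu> w / n2 w"
      using n n2_scale[of "1 / n2 w" w] mu_scale[of "1 / n2 w" w] by (simp_all add: y_def)
    then have "y \<in> S" "w = \<kappa> (1 - \<mu> w, y)"
      using w n False by (auto simp: S \<kappa>_def y_def W_def)
    then show ?thesis by blast
  qed
  have into: "\<kappa> (t, y) \<in> W" if "t \<in> {0..1}" "y \<in> S" for t y
  proof -
    have "\<bar>\<kappa> (t, y) i\<bar> \<le> 1" if "i \<le> k" for i
      using order_trans[OF mu_ge[OF that, of "\<kappa> (t, y)"]] mu_kappa[OF \<open>t \<in> {0..1}\<close> \<open>y \<in> S\<close>] \<open>t \<in> {0..1}\<close> by simp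
    moreover have "\<kappa> (t, y) i = 0" if "i > k" for i
      using that \<open>y \<in> S\<close> S[of y] by (simp add: \<kappa>_def)
    ultimately show ?thesis
      by (simp add: W_def)
  qed
  have W': "w \<in> W' \<longleftrightarrow> w \<in> W \<and> \<mu> w = 1" for w
  proof
    assume w: "w \<in> W'"
    then obtain i where "i \<le> k" "\<bar>w i\<bar> = 1"
      by (auto simp: W'_def)
    moreover have "\<mu> w \<le> 1"
      using mu_ex[of w] w by (auto simp: W'_def W_def)
    ultimately show "w \<in> W \<and> \<mu> w = 1"
      using mu_ge[of i w] w by (simp add: W'_def)
  next
    assume w: "w \<in> W \<and> \<mu> w = 1"
    then show "w \<in> W'"
      using mu_ex[of w] by (auto simp: W'_def)
  qed
  have bd: "\<kappa> (0, y) \<in> W'" if "y \<in> S" for y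
    using into[of 0 y] mu_kappa[of 0 y] that by (simp add: W')
  have "continuous_on S (\<lambda>y. F (\<kappa> (0, y)))"
    by (rule continuous_on_compose2[OF F(1) continuous_on_compose2[OF cont_kappa]])
       (use bd in \<open>auto intro!: continuous_intros\<close>)
  then obtain a where "homotopic_in S C (\<lambda>y. F (\<kappa> (0, y))) (\<lambda>_. a)"
    using null[of "\<lambda>y. F (\<kappa> (0, y))"] bd F(2) unfolding S_def by blast
  from homotopic_with_canon_imp[OF this]
  obtain H where "continuous_on ({0..1::real} \<times> S) H \<and> H \<in> ({0..1} \<times> S) \<rightarrow> C \<and>
    (\<forall>y. H (0, y) = F (\<kappa> (0, y))) \<and> (\<forall>y. H (1, y) = a)" ..
  then have H: "continuous_on ({0..1} \<times> S) H" "H \<in> ({0..1} \<times> S) \<rightarrow> C"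
    "\<And>y. H (0, y) = F (\<kappa> (0, y))" "\<And>y. H (1, y) = a"
    by simp_all
  have compat: "H z = H z'" if z: "z \<in> {0..1} \<times> S" "z' \<in> {0..1} \<times> S" "\<kappa> z = \<kappa> z'" for z z'
  proof -
    obtain t y t' y' where [simp]: "z = (t, y)" "z' = (t', y')"
      by (meson surj_pair)
    have t: "t' = t"
      using z mu_kappa[of t y] mu_kappa[of t' y'] by auto
    show ?thesis
    proof (cases "t = 1")
      case True
      then show ?thesis
        using t z H(4) by simp
    next
      case False
      have *: "(1 / \<mu> y) * y i = (1 / \<mu> y') * y' i" for i
      proof -
        have "(1 - t) * (y i / \<mu> y) = (1 - t) * (y' i / \<mu> y')"
          using fun_cong[OF z(3), of i] t by (simp add: \<kappa>_def)
        then show ?thesis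
          using False by (simp only: mult_cancel_left) simp
      qed
      have "\<mu> y > 0" "\<mu> y' > 0" "n2 y = 1" "n2 y' = 1"
        using z mu_pos[of y] mu_pos[of y'] S[of y] S[of y'] by simp_all
      moreover have "(\<lambda>i. (1 / \<mu> y) * y i) = (\<lambda>i. (1 / \<mu> y') * y' i)"
        using * by (rule ext)
      \<comment> \<open>The points lie on the same ray; comparing Euclidean norms, which are 1 for
        both, gives equal scaling factors.\<close>
      ultimately have "1 / \<mu> y = 1 / \<mu> y'"
        using n2_scale[of "1 / \<mu> y" y] n2_scale[of "1 / \<mu> y'" y'] by simp
      then have "y = y'"
        using * \<open>\<mu> y > 0\<close> by auto
      then show ?thesis
        using t by auto
    qed
  qed
  obtain G where G: "continuous_on (\<kappa> ` ({0..1} \<times> S)) G" "\<And>z. z \<in> {0..1} \<times> S \<Longrightarrow> G (\<kappa> z) = H z"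
    by (rule continuous_on_compact_quotient[OF compact_Times[OF compact_Icc] cont_kappa H(1)],
        simp add: S_def compact_topspace_nsphere, erule (2) compat, rule that)
  have rep: "\<exists>y\<in>S. 1 - \<mu> w \<in> {0..1} \<and> w = \<kappa> (1 - \<mu> w, y)" if "w \<in> W" for w
    using onto[OF that] mu_ex[of w] that mu_nonneg[of w] by (auto simp: W_def)
  show thesis
  proof
    have "W \<subseteq> \<kappa> ` ({0..1} \<times> S)"
    proof
      fix w assume "w \<in> W"
      from rep[OF this] obtain y where "y \<in> S" "1 - \<mu> w \<in> {0..1}" "w = \<kappa> (1 - \<mu> w, y)"
        by blast
      then show "w \<in> \<kappa> ` ({0..1} \<times> S)"
        by (metis SigmaI image_eqI)
    qed
    then show "continuous_on W G"
      using G(1) continuous_on_subset by blast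
    show "G \<in> W \<rightarrow> C"
    proof
      fix w assume "w \<in> W"
      from rep[OF this] obtain y where y: "y \<in> S" "1 - \<mu> w \<in> {0..1}" "w = \<kappa> (1 - \<mu> w, y)"
        by blast
      then have "G w = H (1 - \<mu> w, y)"
        using G(2)[of "(1 - \<mu> w, y)"] by simp
      then show "G w \<in> C"
        using funcset_mem[OF H(2), of "(1 - \<mu> w, y)"] y by simp
    qed
    show "G w = F w" if w: "w \<in> W'" for w
    proof -
      obtain y where y: "y \<in> S" "w = \<kappa> (1 - \<mu> w, y)"
        using rep[of w] w W' by blast
      then have "w = \<kappa> (0, y)"
        using w W' by simp
      then show ?thesis
        using G(2)[of "(0, y)"] H(3) y(1) by simp
    qed
  qed
qed

text \<open>Only the coordinates in \<open>D\<close> vary, the others are frozen at those of the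
  centre \<open>z\<close>; so this is a cell of dimension \<open>card D\<close> in the
  infinite-dimensional ambient space. For \<open>D = {}\<close> it is the point \<open>z\<close>,
  and its rim is empty.\<close>

definition cube :: "(nat \<Rightarrow> real) \<Rightarrow> real \<Rightarrow> nat set \<Rightarrow> (nat \<Rightarrow> real) set" where
  "cube z r D = {s. (\<forall>v\<in>D. \<bar>s v - z v\<bar> \<le> r) \<and> (\<forall>v. v \<notin> D \<longrightarrow> s v = z v)}"

definition cube_rim :: "(nat \<Rightarrow> real) \<Rightarrow> real \<Rightarrow> nat set \<Rightarrow> (nat \<Rightarrow> real) set" where
  "cube_rim z r D = {s \<in> cube z r D. \<exists>v\<in>D. \<bar>s v - z v\<bar> = r}"

text \<open>Time becomes one more coordinate, with index \<open>card D\<close>. After rescaling, the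
  prism is a standard cube of dimension \<open>card D + 1\<close>, whose boundary consists of the
  two ends and the sides. For \<open>D = {}\<close> the extension is a path between two given
  points.\<close>

lemma extend_over_prism:
  fixes F :: "real \<times> (nat \<Rightarrow> real) \<Rightarrow> 'c::topological_space"
  assumes null: "\<And>g. \<lbrakk>continuous_on (Sph (card D)) g; g \<in> Sph (card D) \<rightarrow> C\<rbrakk> \<Longrightarrow>
      \<exists>a. homotopic_in (Sph (card D)) C g (\<lambda>_. a)"
    and D: "finite D" "r > 0"
    and F: "continuous_on ({0,1} \<times> cube z r D \<union> {0..1} \<times> cube_rim z r D) F"
      "F \<in> ({0,1} \<times> cube z r D \<union> {0..1} \<times> cube_rim z r D) \<rightarrow> C"
  obtains G where "continuous_on ({0..1} \<times> cube z r D) G" "G \<in> ({0..1} \<times> cube z r D) \<rightarrow> C"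
    "\<And>x. x \<in> {0,1} \<times> cube z r D \<union> {0..1} \<times> cube_rim z r D \<Longrightarrow> G x = F x"
proof -
  define k where "k = card D"
  obtain d where d: "bij_betw d {..<k} D"
    using D(1) ex_bij_betw_nat_finite[of D] by (auto simp: k_def atLeast0LessThan)
  define e where "e = inv_into {..<k} d"
  have e: "e v < k" "d (e v) = v" if "v \<in> D" for v
    using d that bij_betw_inv_into_right[OF d that] inv_into_into[of v d "{..<k}"] by (auto simp: e_def bij_betw_def)
  have d': "d i \<in> D" "e (d i) = i" if "i < k" for i
    using d that bij_betw_inv_into_left[OF d, of i] by (auto simp: e_def bij_betw_def)
  define W where "W = {w::nat\<Rightarrow>real. (\<forall>i\<le>k. \<bar>w i\<bar> \<le> 1) \<and> (\<forall>i>k. w i = 0)}"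
  define W' where "W' = {w \<in> W. \<exists>i\<le>k. \<bar>w i\<bar> = 1}"
  define \<beta> where "\<beta> = (\<lambda>w. ((w k + 1) / 2, \<lambda>v. if v \<in> D then z v + r * w (e v) else z v))"
  define \<gamma> where "\<gamma> = (\<lambda>(t, s) i. if i < k then (s (d i) - z (d i)) / r else if i = k then 2 * t - 1 else (0::real))"
  have contb: "continuous_on A \<beta>" for A
  proof -
    have "continuous_on A (\<lambda>w. if v \<in> D then z v + r * w (e v) else z v)" for v
      by (cases "v \<in> D") (auto intro!: continuous_intros continuous_on_subset[OF continuous_on_product_coordinates])
    then show ?thesis
      unfolding \<beta>_def
      by (intro continuous_on_Pair continuous_on_coordinatewise_then_product continuous_intros
          continuous_on_subset[OF continuous_on_product_coordinates]) auto
  qed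
  have contc: "continuous_on A \<gamma>" for A
  proof (rule continuous_on_coordinatewise_then_product)
    fix i
    have "continuous_on A (\<lambda>x. if i < k then (snd x (d i) - z (d i)) / r else if i = k then 2 * fst x - 1 else 0)"
      by (cases "i < k"; cases "i = k")
        (use D(2) in \<open>auto intro!: continuous_intros continuous_on_coordinate[OF continuous_on_snd[OF continuous_on_id]]\<close>)
    then show "continuous_on A (\<lambda>x. \<gamma> x i)"
      by (simp add: \<gamma>_def case_prod_beta)
  qed
  have W'b: "\<beta> w \<in> {0,1} \<times> cube z r D \<union> {0..1} \<times> cube_rim z r D" if w: "w \<in> W'" for w
  proof -
    have le: "\<bar>w i\<bar> \<le> 1" if "i \<le> k" for i
      using w that by (auto simp: W'_def W_def)
    obtain i where i: "i \<le> k" "\<bar>w i\<bar> = 1"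
      using w by (auto simp: W'_def)
    have c: "snd (\<beta> w) \<in> cube z r D"
      using le e D(2) by (auto simp: \<beta>_def cube_def abs_mult less_imp_le)
    have t: "fst (\<beta> w) \<in> {0..1}"
      using le[of k] by (auto simp: \<beta>_def abs_le_iff)
    show ?thesis
    proof (cases "i = k")
      case True
      then have "fst (\<beta> w) \<in> {0,1}"
        using i by (auto simp: \<beta>_def abs_if split: if_splits)
      then show ?thesis
        using c by (simp add: mem_Times_iff)
    next
      case False
      then have "snd (\<beta> w) \<in> cube_rim z r D"
        using i c d'[of i] D(2) by (auto simp: cube_rim_def \<beta>_def abs_mult intro!: bexI[of _ "d i"])
      then show ?thesis
        using t by (simp add: mem_Times_iff)
    qed
  qed
  have Wc: "\<gamma> x \<in> W" "\<beta> (\<gamma> x) = x" if x: "x \<in> {0..1} \<times> cube z r D" for x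
  proof -
    obtain t s where [simp]: "x = (t, s)" and t: "0 \<le> t" "t \<le> 1" and s: "s \<in> cube z r D"
      using x by auto
    show "\<gamma> x \<in> W"
      using t s D(2) d'(1) by (auto simp: W_def \<gamma>_def cube_def)
    show "\<beta> (\<gamma> x) = x"
      using s D(2) e by (auto simp: \<beta>_def \<gamma>_def fun_eq_iff cube_def)
  qed
  have Wc': "\<gamma> x \<in> W'" if x: "x \<in> {0,1} \<times> cube z r D \<union> {0..1} \<times> cube_rim z r D" for x
  proof -
    obtain t s where [simp]: "x = (t, s)"
      by (meson surj_pair)
    have W: "\<gamma> x \<in> W"
      using x Wc(1) by (auto simp: cube_rim_def)
    show ?thesis
    proof (cases "t \<in> {0,1}")
      case True
      then have "\<bar>\<gamma> x k\<bar> = 1"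
        by (auto simp: \<gamma>_def)
      then show ?thesis
        using W by (auto simp: W'_def)
    next
      case False
      then obtain v where v: "v \<in> D" "\<bar>s v - z v\<bar> = r"
        using x by (auto simp: cube_rim_def)
      then have "\<bar>\<gamma> x (e v)\<bar> = 1" "e v \<le> k"
        using e[OF v(1)] D(2) by (auto simp: \<gamma>_def)
      then show ?thesis
        using W by (auto simp: W'_def)
    qed
  qed
  have "continuous_on W' (F \<circ> \<beta>)" "F \<circ> \<beta> \<in> W' \<rightarrow> C"
  proof -
    show "continuous_on W' (F \<circ> \<beta>)"
      by (rule continuous_on_compose[OF contb continuous_on_subset[OF F(1)]]) (use W'b in blast)
    show "F \<circ> \<beta> \<in> W' \<rightarrow> C"
      using funcset_mem[OF F(2) W'b] by (intro Pi_I) simp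
  qed
  then obtain G where G: "continuous_on W G" "G \<in> W \<rightarrow> C" "\<And>w. w \<in> W' \<Longrightarrow> G w = (F \<circ> \<beta>) w"
    using extend_from_cube_boundary[of k C "F \<circ> \<beta>"] null unfolding W'_def W_def k_def by blast
  show thesis
  proof
    show "continuous_on ({0..1} \<times> cube z r D) (G \<circ> \<gamma>)"
      by (rule continuous_on_compose[OF contc continuous_on_subset[OF G(1)]]) (use Wc in blast)
    show "G \<circ> \<gamma> \<in> ({0..1} \<times> cube z r D) \<rightarrow> C"
      using funcset_mem[OF G(2) Wc(1)] by (intro Pi_I) simp
    show "(G \<circ> \<gamma>) x = F x" if x: "x \<in> {0,1} \<times> cube z r D \<union> {0..1} \<times> cube_rim z r D" for x
    proof -
      have "x \<in> {0..1} \<times> cube z r D"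
        using x by (auto simp: cube_rim_def)
      then show ?thesis
        using G(3)[OF Wc'[OF x]] Wc(2) by simp
    qed
  qed
qed

text \<open>The retraction is the central projection from height \<open>2\<close> above the centre of the cube.\<close>

lemma extend_over_open_prism:
  fixes F :: "real \<times> (nat \<Rightarrow> real) \<Rightarrow> 'c::topological_space"
  assumes D: "finite D" "D \<noteq> {}" "r > 0"
    and F: "continuous_on ({0} \<times> cube z r D \<union> {0..1} \<times> cube_rim z r D) F"
      "F \<in> ({0} \<times> cube z r D \<union> {0..1} \<times> cube_rim z r D) \<rightarrow> C"
  obtains G where "continuous_on ({0..1} \<times> cube z r D) G" "G \<in> ({0..1} \<times> cube z r D) \<rightarrow> C"
    "\<And>x. x \<in> {0} \<times> cube z r D \<union> {0..1} \<times> cube_rim z r D \<Longrightarrow> G x = F x"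
proof -
  define M where "M = (\<lambda>s. Max ((\<lambda>v. \<bar>s v - z v\<bar> / r) ` D))"
  \<comment> \<open>Dividing the vector from the apex \<open>(2, z)\<close> by \<open>M s\<close>
    would bring the point to the sides, dividing it by \<open>(2 - t) / 2\<close> to the floor. The
    larger divisor gives whichever is reached first. As \<open>t \<le> 1\<close>, it is at least
    \<open>1 / 2\<close>.\<close>
  define m where "m = (\<lambda>(t, s). max (M s) ((2 - t) / 2))"
  define \<rho> where "\<rho> = (\<lambda>(t::real, s). (2 - (2 - t) / m (t, s), \<lambda>v. z v + (s v - z v) / m (t, s)))"
  have M_ge: "\<bar>s v - z v\<bar> / r \<le> M s" if "v \<in> D" for v s
    unfolding M_def using that D by (intro Max_ge) auto
  have M_ex: "\<exists>v\<in>D. M s = \<bar>s v - z v\<bar> / r" for s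
  proof -
    have "M s \<in> (\<lambda>v. \<bar>s v - z v\<bar> / r) ` D"
      unfolding M_def using D by (intro Max_in) auto
    then show ?thesis by auto
  qed
  have M_nonneg: "M s \<ge> 0" for s
    using M_ex[of s] D by auto
  have M_le: "M s \<le> 1" if "s \<in> cube z r D" for s
    using M_ex[of s] that D by (auto simp: cube_def)
  have M_rim: "M s = 1" if s: "s \<in> cube_rim z r D" for s
  proof -
    obtain v where "v \<in> D" "\<bar>s v - z v\<bar> = r"
      using s by (auto simp: cube_rim_def)
    then show ?thesis
      using M_ge[of v s] M_le[of s] s D by (auto simp: cube_rim_def)
  qed
  have M_cont: "continuous_on A M" for A
    unfolding M_def using D
    by (intro continuous_on_Max_image continuous_intros continuous_on_subset[OF continuous_on_product_coordinates]) auto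
  have m_pos: "m x > 0" if "x \<in> {0..1} \<times> cube z r D" for x
    using that by (auto simp: m_def less_max_iff_disj)
  have m_cont: "continuous_on A m" for A
    unfolding m_def case_prod_beta
    by (intro continuous_intros continuous_on_max continuous_on_compose2[OF M_cont[of UNIV]]) auto
  have cont: "continuous_on ({0..1} \<times> cube z r D) \<rho>"
  proof -
    have ne: "\<forall>x\<in>{0..1} \<times> cube z r D. m x \<noteq> 0"
      using m_pos by force
    have "continuous_on ({0..1} \<times> cube z r D) (\<lambda>x. z v + (snd x v - z v) / m x)" for v
      by (intro continuous_on_add continuous_on_divide continuous_on_diff continuous_on_const m_cont ne
          continuous_on_coordinate[OF continuous_on_snd[OF continuous_on_id]])
    then have "continuous_on ({0..1} \<times> cube z r D) (\<lambda>x. (2 - (2 - fst x) / m x, \<lambda>v. z v + (snd x v - z v) / m x))"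
      by (intro continuous_on_Pair continuous_on_coordinatewise_then_product continuous_on_diff continuous_on_divide
          continuous_on_const continuous_on_fst continuous_on_id m_cont ne)
    then show ?thesis
      by (simp add: \<rho>_def case_prod_beta)
  qed
  have into: "\<rho> x \<in> {0} \<times> cube z r D \<union> {0..1} \<times> cube_rim z r D" if x: "x \<in> {0..1} \<times> cube z r D" for x
  proof -
    obtain t s where [simp]: "x = (t, s)" and t: "0 \<le> t" "t \<le> 1" and s: "s \<in> cube z r D"
      using x by auto
    have mp: "m (t, s) > 0"
      using m_pos x by simp
    have c: "snd (\<rho> x) \<in> cube z r D"
    proof -
      have "\<bar>(s v - z v) / m (t, s)\<bar> \<le> r" if v: "v \<in> D" for v
      proof -
        have "\<bar>s v - z v\<bar> / r \<le> m (t, s)"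
          using M_ge[OF v, of s] by (simp add: m_def le_max_iff_disj)
        then show ?thesis
          using mp D(3) by (simp add: abs_divide field_simps)
      qed
      then show ?thesis
        using s by (auto simp: cube_def \<rho>_def)
    qed
    show ?thesis
    proof (cases "M s \<le> (2 - t) / 2")
      case True
      then have "m (t, s) = (2 - t) / 2"
        by (simp add: m_def max_absorb2)
      then have "fst (\<rho> x) = 0"
        using t by (simp add: \<rho>_def field_simps)
      then show ?thesis
        using c by (simp add: mem_Times_iff)
    next
      case False
      then have m: "m (t, s) = M s"
        by (simp add: m_def)
      obtain v where v: "v \<in> D" "M s = \<bar>s v - z v\<bar> / r"
        using M_ex by blast
      then have "\<bar>s v - z v\<bar> = M s * r"
        using D(3) by simp
      moreover have "M s > 0"
        using mp m by simp
      ultimately have "\<bar>(s v - z v) / M s\<bar> = r"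
        by (simp add: abs_divide)
      then have "snd (\<rho> x) \<in> cube_rim z r D"
        using c v(1) m by (auto simp: cube_rim_def \<rho>_def)
      moreover have "fst (\<rho> x) \<in> {0..1}"
        using False t M_le[OF s] m mp by (auto simp: \<rho>_def field_simps)
      ultimately show ?thesis
        by (simp add: mem_Times_iff)
    qed
  qed
  have fixed: "\<rho> x = x" if x: "x \<in> {0} \<times> cube z r D \<union> {0..1} \<times> cube_rim z r D" for x
  proof -
    have "m x = 1"
      using x M_le M_rim by (auto simp: m_def max_def)
    then show ?thesis
      by (cases x) (simp add: \<rho>_def)
  qed
  show thesis
  proof
    show "continuous_on ({0..1} \<times> cube z r D) (F \<circ> \<rho>)"
      by (rule continuous_on_compose[OF cont continuous_on_subset[OF F(1)]]) (use into in blast)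
    show "F \<circ> \<rho> \<in> ({0..1} \<times> cube z r D) \<rightarrow> C"
      using funcset_mem[OF F(2) into] by (intro Pi_I) simp
    show "(F \<circ> \<rho>) x = F x" if "x \<in> {0} \<times> cube z r D \<union> {0..1} \<times> cube_rim z r D" for x
      using fixed[OF that] by simp
  qed
qed

section \<open>Deforming a space over a cell complex\<close>

definition evenly_covered ::
  "'c::topological_space set \<Rightarrow> ('c \<Rightarrow> 'b::topological_space) \<Rightarrow> 'b set \<Rightarrow> bool" where
  "evenly_covered C c T \<longleftrightarrow> (\<exists>v. \<Union>v = C \<inter> c -` T \<and> (\<forall>u\<in>v. openin (top_of_set C) u) \<and>
     pairwise disjnt v \<and> (\<forall>u\<in>v. \<exists>q. homeomorphism u T c q))"

lemma openin_Int_subset: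
  assumes "openin (top_of_set S) U" "T \<subseteq> S"
  shows "openin (top_of_set T) (U \<inter> T)"
  using assms by (auto simp: openin_open)

text \<open>Extension problems over a cell downstairs are solved separately in each sheet above it.\<close>

lemma extend_over_cell_preimage:
  fixes c :: "'c::topological_space \<Rightarrow> 'b::topological_space"
  assumes c: "continuous_on C c" "c \<in> C \<rightarrow> B"
    and T: "evenly_covered C c T" "e \<subseteq> T"
    and W: "closedin (top_of_set B) W" and e: "closedin (top_of_set B) e"
    and J: "closed J" "J \<subseteq> {0..1::real}"
    and G: "continuous_on ({0..1} \<times> (C \<inter> c -` W) \<union> J \<times> C) G"
      "G \<in> ({0..1} \<times> (C \<inter> c -` W) \<union> J \<times> C) \<rightarrow> C"
    and ext: "\<And>F. \<lbrakk>continuous_on (J \<times> e \<union> {0..1} \<times> (e \<inter> W)) F; F \<in> (J \<times> e \<union> {0..1} \<times> (e \<inter> W)) \<rightarrow> C\<rbrakk> \<Longrightarrow>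
      \<exists>F'. continuous_on ({0..1} \<times> e) F' \<and> F' \<in> ({0..1} \<times> e) \<rightarrow> C \<and> (\<forall>x\<in>J \<times> e \<union> {0..1} \<times> (e \<inter> W). F' x = F x)"
  shows "\<exists>G'. continuous_on ({0..1} \<times> (C \<inter> c -` (W \<union> e)) \<union> J \<times> C) G' \<and>
    G' \<in> ({0..1} \<times> (C \<inter> c -` (W \<union> e)) \<union> J \<times> C) \<rightarrow> C \<and>
    (\<forall>x\<in>{0..1} \<times> (C \<inter> c -` W) \<union> J \<times> C. G' x = G x)"
proof -
  define R where "R = J \<times> e \<union> {0..1} \<times> (e \<inter> W)"
  define A where "A = {0..1} \<times> (C \<inter> c -` W) \<union> J \<times> C"
  define A' where "A' = {0..1::real} \<times> (C \<inter> c -` e)"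
  from T(1) obtain v where v: "\<Union>v = C \<inter> c -` T" and v_open: "\<And>u. u \<in> v \<Longrightarrow> openin (top_of_set C) u"
    and disj: "pairwise disjnt v" and "\<forall>u\<in>v. \<exists>q. homeomorphism u T c q"
    unfolding evenly_covered_def by auto
  then obtain q where hom: "\<And>u. u \<in> v \<Longrightarrow> homeomorphism u T c (q u)"
    by metis
  have uC: "u \<subseteq> C" if "u \<in> v" for u
    using openin_imp_subset[OF v_open[OF that]] .
  have q: "q u s \<in> u" "c (q u s) = s" if "u \<in> v" "s \<in> T" for u s
    using hom[OF that(1)] that(2) by (auto simp: homeomorphism_def)
  have qc: "q u (c z) = z" if "u \<in> v" "z \<in> u" for u z
    using hom[OF that(1)] that(2) by (auto simp: homeomorphism_def)
  have "\<exists>F'. continuous_on ({0..1} \<times> e) F' \<and> F' \<in> ({0..1} \<times> e) \<rightarrow> C \<and> (\<forall>x\<in>R. F' x = G (fst x, q u (snd x)))"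
    if u: "u \<in> v" for u
    unfolding R_def
  proof (rule ext)
    have into: "(\<lambda>x. (fst x, q u (snd x))) x \<in> A" if "x \<in> J \<times> e \<union> {0..1} \<times> (e \<inter> W)" for x
    proof -
      have "snd x \<in> T"
        using that T(2) by auto
      then show ?thesis
        using q[OF u, of "snd x"] uC[OF u] that by (auto simp: A_def)
    qed
    have "continuous_on (J \<times> e \<union> {0..1} \<times> (e \<inter> W)) (\<lambda>x. q u (snd x))"
    proof (rule continuous_on_compose2[of T "q u"])
      show "continuous_on T (q u)"
        using hom[OF u] by (simp add: homeomorphism_def)
    qed (use T(2) in \<open>auto intro!: continuous_intros\<close>)
    then have "continuous_on (J \<times> e \<union> {0..1} \<times> (e \<inter> W)) (\<lambda>x. (fst x, q u (snd x)))"
      by (intro continuous_intros)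
    then show "continuous_on (J \<times> e \<union> {0..1} \<times> (e \<inter> W)) (\<lambda>x. G (fst x, q u (snd x)))"
      by (rule continuous_on_compose2[OF G(1)]) (use into A_def in blast)
    show "(\<lambda>x. G (fst x, q u (snd x))) \<in> (J \<times> e \<union> {0..1} \<times> (e \<inter> W)) \<rightarrow> C"
      using funcset_mem[OF G(2)] into unfolding A_def by (intro Pi_I) simp
  qed
  then obtain F where F: "\<And>u. u \<in> v \<Longrightarrow> continuous_on ({0..1} \<times> e) (F u)"
    "\<And>u. u \<in> v \<Longrightarrow> F u \<in> ({0..1} \<times> e) \<rightarrow> C"
    "\<And>u x. \<lbrakk>u \<in> v; x \<in> R\<rbrakk> \<Longrightarrow> F u x = G (fst x, q u (snd x))"
    by metis
  define sh where "sh = (\<lambda>z. SOME u. u \<in> v \<and> z \<in> u)"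
  have sh: "sh z = u" if "u \<in> v" "z \<in> u" for u z
  proof -
    have "sh z \<in> v \<and> z \<in> sh z"
      unfolding sh_def by (rule someI) (use that in auto)
    then show ?thesis
      using that pairwiseD[OF disj, of "sh z" u] by (auto simp: disjnt_def)
  qed
  have sheet: "\<exists>u\<in>v. snd x \<in> u" if "x \<in> A'" for x
  proof -
    have "snd x \<in> \<Union>v"
      using that T(2) v by (auto simp: A'_def)
    then show ?thesis by simp
  qed
  define H where "H = (\<lambda>x. F (sh (snd x)) (fst x, c (snd x)))"
  \<comment> \<open>There may be infinitely many sheets, so closed pieces cannot be glued here. But
    sheets are open, and near each point \<open>H\<close> is described by the extension
    \<open>F u\<close> of a single sheet.\<close>
  have H_cont: "continuous_on A' H"
  proof (rule continuous_on_openin_cover)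
    fix x assume x: "x \<in> A'"
    from sheet[OF x] obtain u where u: "u \<in> v" "snd x \<in> u" ..
    define M where "M = {0..1::real} \<times> (u \<inter> (C \<inter> c -` e))"
    have "openin (top_of_set A') M"
    proof -
      have "openin (top_of_set (C \<inter> c -` e)) (u \<inter> (C \<inter> c -` e))"
        using v_open[OF u(1)] by (rule openin_Int_subset) simp
      then show ?thesis
        unfolding A'_def M_def by (intro openin_Times) auto
    qed
    moreover have "x \<in> M"
      using x u by (auto simp: A'_def M_def)
    moreover have "continuous_on M H"
    proof -
      have "continuous_on M (\<lambda>x. c (snd x))"
        by (rule continuous_on_compose2[OF c(1)]) (auto simp: M_def intro!: continuous_intros)
      then have "continuous_on M (\<lambda>x. (fst x, c (snd x)))"
        by (intro continuous_intros)
      then have "continuous_on M (\<lambda>x. F u (fst x, c (snd x)))"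
        by (rule continuous_on_compose2[OF F(1)[OF u(1)]]) (auto simp: M_def)
      moreover have "H y = F u (fst y, c (snd y))" if "y \<in> M" for y
        using sh[OF u(1), of "snd y"] that by (auto simp: H_def M_def)
      ultimately show ?thesis
        by (metis (no_types, lifting) continuous_on_cong)
    qed
    ultimately show "\<exists>M. openin (top_of_set A') M \<and> x \<in> M \<and> continuous_on M H"
      by blast
  qed
  have agree: "G x = H x" if x: "x \<in> A" "x \<in> A'" for x
  proof -
    from sheet[OF x(2)] obtain u where u: "u \<in> v" "snd x \<in> u" ..
    have "(fst x, c (snd x)) \<in> R"
      using x by (auto simp: A_def A'_def R_def)
    then show ?thesis
      using F(3)[OF u(1)] sh[OF u] qc[OF u] by (simp add: H_def)
  qed
  define G' where "G' = (\<lambda>x. if x \<in> A then G x else H x)"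
  have dom: "{0..1} \<times> (C \<inter> c -` (W \<union> e)) \<union> J \<times> C = A \<union> A'"
    by (auto simp: A_def A'_def)
  have cl: "closedin (top_of_set ({0..1} \<times> C)) A" "closedin (top_of_set ({0..1} \<times> C)) A'"
  proof -
    have *: "closedin (top_of_set C) (C \<inter> c -` K)" if "closedin (top_of_set B) K" for K
      using continuous_closedin_preimage_gen[OF c that] .
    have "closedin (top_of_set {0..1}) J"
      using J by (simp add: closed_subset)
    then show "closedin (top_of_set ({0..1} \<times> C)) A" "closedin (top_of_set ({0..1} \<times> C)) A'"
      unfolding A_def A'_def using *[OF W] *[OF e] by (intro closedin_Un closedin_Times closedin_subtopology_refl[THEN iffD2]; simp)+
  qed
  have sub: "A \<union> A' \<subseteq> {0..1} \<times> C"
    using cl closedin_imp_subset by blast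
  have "continuous_on (A \<union> A') G'"
    unfolding G'_def
  proof (rule continuous_on_cases_local)
    show "closedin (top_of_set (A \<union> A')) A" "closedin (top_of_set (A \<union> A')) A'"
      using cl sub by (auto intro: closedin_subset_trans)
    show "continuous_on A G"
      using G(1) by (simp add: A_def)
  qed (use H_cont agree in auto)
  moreover have "G' \<in> (A \<union> A') \<rightarrow> C"
  proof (rule Pi_I)
    fix x assume x: "x \<in> A \<union> A'"
    show "G' x \<in> C"
    proof (cases "x \<in> A")
      case True
      then show ?thesis
        using funcset_mem[OF G(2)] by (simp add: G'_def A_def)
    next
      case False
      with x have "x \<in> A'"
        by simp
      from sheet[OF this] obtain u where u: "u \<in> v" "snd x \<in> u" ..
      then show ?thesis
        using False x funcset_mem[OF F(2)[OF u(1)], of "(fst x, c (snd x))"] sh[OF u]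
        by (auto simp: G'_def H_def A'_def)
    qed
  qed
  moreover have "\<forall>x\<in>A. G' x = G x"
    by (simp add: G'_def)
  ultimately show ?thesis
    unfolding dom A_def[symmetric] by blast
qed

text \<open>Cells of one dimension are added one after the other. Distinct ones meet only inside
  \<open>rim e\<close>, which belongs to \<open>W\<close>, so the cells already added impose no new
  boundary condition on the next one. The set \<open>J\<close> of prescribed times is
  \<open>{0,1}\<close> below the top dimension and \<open>{0}\<close> in it.\<close>

lemma extend_over_cells_preimage:
  fixes c :: "'c::topological_space \<Rightarrow> 'b::topological_space" and cl rim :: "'e \<Rightarrow> 'b set"
  assumes c: "continuous_on C c" "c \<in> C \<rightarrow> B"
    and E: "finite E" "\<And>e. e \<in> E \<Longrightarrow> closedin (top_of_set B) (cl e)"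
      "\<And>e. e \<in> E \<Longrightarrow> \<exists>T. evenly_covered C c T \<and> cl e \<subseteq> T"
    and W: "closedin (top_of_set B) W"
    and rim: "\<And>e. e \<in> E \<Longrightarrow> cl e \<inter> W = rim e"
      "\<And>e e'. \<lbrakk>e \<in> E; e' \<in> E; e \<noteq> e'\<rbrakk> \<Longrightarrow> cl e \<inter> cl e' \<subseteq> rim e"
    and J: "closed J" "J \<subseteq> {0..1::real}"
    and G: "continuous_on ({0..1} \<times> (C \<inter> c -` W) \<union> J \<times> C) G"
      "G \<in> ({0..1} \<times> (C \<inter> c -` W) \<union> J \<times> C) \<rightarrow> C"
    and ext: "\<And>e F. \<lbrakk>e \<in> E; continuous_on (J \<times> cl e \<union> {0..1} \<times> rim e) F; F \<in> (J \<times> cl e \<union> {0..1} \<times> rim e) \<rightarrow> C\<rbrakk> \<Longrightarrow>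
      \<exists>F'. continuous_on ({0..1} \<times> cl e) F' \<and> F' \<in> ({0..1} \<times> cl e) \<rightarrow> C \<and> (\<forall>x\<in>J \<times> cl e \<union> {0..1} \<times> rim e. F' x = F x)"
  shows "\<exists>G'. continuous_on ({0..1} \<times> (C \<inter> c -` (W \<union> \<Union>(cl ` E))) \<union> J \<times> C) G' \<and>
    G' \<in> ({0..1} \<times> (C \<inter> c -` (W \<union> \<Union>(cl ` E))) \<union> J \<times> C) \<rightarrow> C \<and>
    (\<forall>x\<in>{0..1} \<times> (C \<inter> c -` W) \<union> J \<times> C. G' x = G x)"
  using E rim ext
proof (induction E rule: finite_induct)
  case empty
  then show ?case
    using G by auto
next
  case (insert e E)
  let ?W = "W \<union> \<Union>(cl ` E)"
  have "\<exists>G'. continuous_on ({0..1} \<times> (C \<inter> c -` ?W) \<union> J \<times> C) G' \<and>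
    G' \<in> ({0..1} \<times> (C \<inter> c -` ?W) \<union> J \<times> C) \<rightarrow> C \<and>
    (\<forall>x\<in>{0..1} \<times> (C \<inter> c -` W) \<union> J \<times> C. G' x = G x)"
    by (rule insert.IH) (use insert.prems in \<open>simp_all\<close>)
  then obtain G1 where G1: "continuous_on ({0..1} \<times> (C \<inter> c -` ?W) \<union> J \<times> C) G1"
    "G1 \<in> ({0..1} \<times> (C \<inter> c -` ?W) \<union> J \<times> C) \<rightarrow> C"
    "\<forall>x\<in>{0..1} \<times> (C \<inter> c -` W) \<union> J \<times> C. G1 x = G x"
    by metis
  obtain T where T: "evenly_covered C c T" "cl e \<subseteq> T"
    using insert.prems(2)[of e] by auto
  have "cl e \<inter> cl e' \<subseteq> rim e" if "e' \<in> E" for e'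
    using insert.prems(4)[of e e'] insert.hyps(2) that by auto
  then have rim_e: "cl e \<inter> ?W = rim e"
    using insert.prems(3)[of e] by auto
  have closed: "closedin (top_of_set B) ?W"
    using W insert.prems(1) insert.hyps(1) by (intro closedin_Un closedin_Union) auto
  have "\<exists>G'. continuous_on ({0..1} \<times> (C \<inter> c -` (?W \<union> cl e)) \<union> J \<times> C) G' \<and>
    G' \<in> ({0..1} \<times> (C \<inter> c -` (?W \<union> cl e)) \<union> J \<times> C) \<rightarrow> C \<and>
    (\<forall>x\<in>{0..1} \<times> (C \<inter> c -` ?W) \<union> J \<times> C. G' x = G1 x)"
    by (rule extend_over_cell_preimage[OF c T closed _ J G1(1,2)])
       (use insert.prems(1,5)[of e] rim_e in simp_all)
  then obtain G' where G': "continuous_on ({0..1} \<times> (C \<inter> c -` (?W \<union> cl e)) \<union> J \<times> C) G'"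
    "G' \<in> ({0..1} \<times> (C \<inter> c -` (?W \<union> cl e)) \<union> J \<times> C) \<rightarrow> C"
    "\<forall>x\<in>{0..1} \<times> (C \<inter> c -` ?W) \<union> J \<times> C. G' x = G1 x"
    by metis
  have "W \<union> \<Union>(cl ` insert e E) = ?W \<union> cl e"
    by auto
  moreover have "\<forall>x\<in>{0..1} \<times> (C \<inter> c -` W) \<union> J \<times> C. G' x = G x"
    using G'(3) G1(3) by auto
  ultimately show ?case
    using G' by metis
qed

text \<open>A space over an \<open>n\<close>-dimensional cell complex is deformed so that the preimage of the
  \<open>(n - 1)\<close>-skeleton goes to a point; the deformed identity can then be made constant on those cells
  which miss \<open>A\<close> without affecting the others.\<close>

lemma nullhomotopic_if_homotopic_into_disjoint:
  fixes c :: "'c::topological_space \<Rightarrow> 'b::topological_space" and cl rim :: "'e \<Rightarrow> 'b set"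
    and lev :: "'e \<Rightarrow> nat" and f g :: "'s::topological_space \<Rightarrow> 'c"
  assumes c: "continuous_on C c" "c \<in> C \<rightarrow> B" and "C \<noteq> {}"
    and E: "finite E" "\<Union>(cl ` E) = B" "\<And>e. e \<in> E \<Longrightarrow> closedin (top_of_set B) (cl e)"
      "\<And>e. e \<in> E \<Longrightarrow> \<exists>T. evenly_covered C c T \<and> cl e \<subseteq> T" "\<And>e. e \<in> E \<Longrightarrow> lev e \<le> n"
    and rim: "\<And>e. e \<in> E \<Longrightarrow> rim e \<subseteq> cl e"
      "\<And>e. e \<in> E \<Longrightarrow> rim e \<subseteq> \<Union>(cl ` {e' \<in> E. lev e' < lev e})"
      "\<And>e e'. \<lbrakk>e \<in> E; e' \<in> E; e \<noteq> e'; lev e' \<le> lev e\<rbrakk> \<Longrightarrow> cl e \<inter> cl e' \<subseteq> rim e"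
    and low: "\<And>e F. \<lbrakk>e \<in> E; lev e < n; continuous_on ({0,1} \<times> cl e \<union> {0..1::real} \<times> rim e) F;
        F \<in> ({0,1} \<times> cl e \<union> {0..1} \<times> rim e) \<rightarrow> C\<rbrakk> \<Longrightarrow>
      \<exists>F'. continuous_on ({0..1} \<times> cl e) F' \<and> F' \<in> ({0..1} \<times> cl e) \<rightarrow> C \<and>
        (\<forall>x\<in>{0,1} \<times> cl e \<union> {0..1} \<times> rim e. F' x = F x)"
    and top: "\<And>e F. \<lbrakk>e \<in> E; lev e = n; continuous_on ({0} \<times> cl e \<union> {0..1::real} \<times> rim e) F;
        F \<in> ({0} \<times> cl e \<union> {0..1} \<times> rim e) \<rightarrow> C\<rbrakk> \<Longrightarrow>
      \<exists>F'. continuous_on ({0..1} \<times> cl e) F' \<and> F' \<in> ({0..1} \<times> cl e) \<rightarrow> C \<and>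
        (\<forall>x\<in>{0} \<times> cl e \<union> {0..1} \<times> rim e. F' x = F x)"
    and sep: "\<And>e. e \<in> E \<Longrightarrow> cl e \<inter> A = {} \<or> cl e \<inter> A' = {}"
    and fg: "homotopic_in S C f g" "c \<circ> f \<in> S \<rightarrow> A" "c \<circ> g \<in> S \<rightarrow> A'"
  shows "\<exists>a. homotopic_in S C f (\<lambda>_. a)"
proof -
  obtain p where p: "p \<in> C"
    using \<open>C \<noteq> {}\<close> by blast
  \<comment> \<open>The skeleton of dimension \<open>k - 1\<close>; thus \<open>W 0\<close> is
    empty.\<close>
  define W where "W = (\<lambda>k. \<Union>(cl ` {e \<in> E. lev e < k}))"
  have W_Suc: "W (Suc k) = W k \<union> \<Union>(cl ` {e \<in> E. lev e = k})" for k
    by (auto simp: W_def less_Suc_eq)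
  have W_closed: "closedin (top_of_set B) (W k)" for k
    unfolding W_def using E(1,3) by (intro closedin_Union) auto
  have W_cl: "cl e \<inter> W (lev e) = rim e" if e: "e \<in> E" for e
  proof -
    have "cl e \<inter> cl e' \<subseteq> rim e" if "e' \<in> E" "lev e' < lev e" for e'
      using rim(3)[OF e that(1)] that by auto
    then have "cl e \<inter> W (lev e) \<subseteq> rim e"
      unfolding W_def by blast
    then show ?thesis
      using rim(1,2)[OF e] unfolding W_def by blast
  qed
  have W_lev: "cl e \<inter> W k = rim e" if "e \<in> {e \<in> E. lev e = k}" for e k
    using W_cl[of e] that by simp
  have rim_disj: "cl e \<inter> cl e' \<subseteq> rim e" if "e \<in> {e \<in> E. lev e = k}" "e' \<in> {e \<in> E. lev e = k}" "e \<noteq> e'" for e e' k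
    using rim(3)[of e e'] that by simp
  \<comment> \<open>A partial homotopy from the identity to the constant \<open>p\<close>: both ends
    are fixed on all of \<open>C\<close> in advance, the times between only over the
    skeleton.\<close>
  define Q where "Q = (\<lambda>k G. continuous_on ({0..1::real} \<times> (C \<inter> c -` W k) \<union> {0,1} \<times> C) G \<and>
      G \<in> ({0..1} \<times> (C \<inter> c -` W k) \<union> {0,1} \<times> C) \<rightarrow> C \<and> (\<forall>z\<in>C. G (0, z) = z \<and> G (1, z) = p))"
  have "\<exists>G. Q k G"
    if "k \<le> n" for k
    using that
  proof (induction k)
    case 0
    have "continuous_on ({0} \<times> C \<union> {1} \<times> C) (\<lambda>x. if fst x = (0::real) then snd x else p)"
    proof (rule continuous_on_cases_local)
      show "closedin (top_of_set ({0} \<times> C \<union> {1} \<times> C)) ({0::real} \<times> C)"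
        unfolding closedin_closed by (rule exI[of _ "{0} \<times> UNIV"]) (auto simp: closed_Times)
      show "closedin (top_of_set ({0} \<times> C \<union> {1} \<times> C)) ({1::real} \<times> C)"
        unfolding closedin_closed by (rule exI[of _ "{1} \<times> UNIV"]) (auto simp: closed_Times)
    qed (auto intro!: continuous_intros)
    moreover have "{0..1::real} \<times> (C \<inter> c -` W 0) \<union> {0,1} \<times> C = {0} \<times> C \<union> {1} \<times> C"
      by (auto simp: W_def)
    ultimately have "Q 0 (\<lambda>x. if fst x = (0::real) then snd x else p)"
      unfolding Q_def using p by (simp add: Pi_iff ball_Un)
    then show ?case
      by (rule exI[of "Q 0"])
  next
    case (Suc k)
    then obtain G where "Q k G"
      by (meson Suc_leD)
    then have G: "continuous_on ({0..1::real} \<times> (C \<inter> c -` W k) \<union> {0,1} \<times> C) G"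
      "G \<in> ({0..1} \<times> (C \<inter> c -` W k) \<union> {0,1} \<times> C) \<rightarrow> C" "\<forall>z\<in>C. G (0, z) = z \<and> G (1, z) = p"
      unfolding Q_def by - (elim conjE, assumption)+
    have "\<exists>G'. continuous_on ({0..1} \<times> (C \<inter> c -` W (Suc k)) \<union> {0,1} \<times> C) G' \<and>
        G' \<in> ({0..1} \<times> (C \<inter> c -` W (Suc k)) \<union> {0,1} \<times> C) \<rightarrow> C \<and>
        (\<forall>x\<in>{0..1} \<times> (C \<inter> c -` W k) \<union> {0,1} \<times> C. G' x = G x)"
      unfolding W_Suc
    proof (rule extend_over_cells_preimage[where rim = rim and E = "{e \<in> E. lev e = k}", OF c _ _ _ W_closed W_lev rim_disj _ _ G(1,2)])
      fix e F
      assume "e \<in> {e \<in> E. lev e = k}" "continuous_on ({0, 1} \<times> cl e \<union> {0..1::real} \<times> rim e) F"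
        "F \<in> ({0,1} \<times> cl e \<union> {0..1} \<times> rim e) \<rightarrow> C"
      then show "\<exists>F'. continuous_on ({0..1} \<times> cl e) F' \<and> F' \<in> ({0..1} \<times> cl e) \<rightarrow> C \<and>
          (\<forall>x\<in>{0,1} \<times> cl e \<union> {0..1} \<times> rim e. F' x = F x)"
        using Suc.prems by (intro low) auto
    qed (use E in auto)
    then obtain G' where G': "continuous_on ({0..1} \<times> (C \<inter> c -` W (Suc k)) \<union> {0,1} \<times> C) G'"
        "G' \<in> ({0..1} \<times> (C \<inter> c -` W (Suc k)) \<union> {0,1} \<times> C) \<rightarrow> C"
        "\<forall>x\<in>{0..1} \<times> (C \<inter> c -` W k) \<union> {0,1} \<times> C. G' x = G x"
      by (elim exE conjE) (rule that)
    then have "\<forall>z\<in>C. G' (0, z) = z \<and> G' (1, z) = p"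
      using G(3) by simp
    with G' have "Q (Suc k) G'"
      unfolding Q_def by (intro conjI)
    then show ?case
      by (rule exI[of "Q (Suc k)"])
  qed
  then obtain G where "Q n G"
    by blast
  then have G: "continuous_on ({0..1::real} \<times> (C \<inter> c -` W n) \<union> {0,1} \<times> C) G"
      "G \<in> ({0..1} \<times> (C \<inter> c -` W n) \<union> {0,1} \<times> C) \<rightarrow> C" "\<forall>z\<in>C. G (0, z) = z \<and> G (1, z) = p"
    unfolding Q_def by - (elim conjE, assumption)+
  \<comment> \<open>The end at time 1 is now forgotten away from the skeleton: keeping it would
    require null-homotopies of n-spheres in \<open>C\<close>. What comes out at time 1 is
    \<open>h\<close>, which equals \<open>p\<close> only over \<open>W n\<close>.\<close>
  have G0: "continuous_on ({0..1::real} \<times> (C \<inter> c -` W n) \<union> {0} \<times> C) G"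
      "G \<in> ({0..1} \<times> (C \<inter> c -` W n) \<union> {0} \<times> C) \<rightarrow> C"
    by (rule continuous_on_subset[OF G(1)], blast) (use funcset_mem[OF G(2)] in auto)
  have "\<exists>G'. continuous_on ({0..1} \<times> (C \<inter> c -` (W n \<union> \<Union>(cl ` {e \<in> E. lev e = n}))) \<union> {0} \<times> C) G' \<and>
      G' \<in> ({0..1} \<times> (C \<inter> c -` (W n \<union> \<Union>(cl ` {e \<in> E. lev e = n}))) \<union> {0} \<times> C) \<rightarrow> C \<and>
      (\<forall>x\<in>{0..1} \<times> (C \<inter> c -` W n) \<union> {0} \<times> C. G' x = G x)"
  proof (rule extend_over_cells_preimage[where rim = rim and E = "{e \<in> E. lev e = n}", OF c _ _ _ W_closed W_lev rim_disj _ _ G0])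
    fix e F
    assume "e \<in> {e \<in> E. lev e = n}" "continuous_on ({0} \<times> cl e \<union> {0..1::real} \<times> rim e) F"
      "F \<in> ({0} \<times> cl e \<union> {0..1} \<times> rim e) \<rightarrow> C"
    then show "\<exists>F'. continuous_on ({0..1} \<times> cl e) F' \<and> F' \<in> ({0..1} \<times> cl e) \<rightarrow> C \<and>
        (\<forall>x\<in>{0} \<times> cl e \<union> {0..1} \<times> rim e. F' x = F x)"
      by (intro top) auto
  qed (use E in auto)
  moreover have "{0..1} \<times> (C \<inter> c -` (W n \<union> \<Union>(cl ` {e \<in> E. lev e = n}))) \<union> {0} \<times> C = {0..1::real} \<times> C"
  proof -
    have "{e \<in> E. lev e < Suc n} = E"
      using E(5) by (auto simp: less_Suc_eq_le)
    then have "W (Suc n) = B"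
      using E(2) by (simp add: W_def)
    then show ?thesis
      unfolding W_Suc using c(2) by auto
  qed
  ultimately obtain G' where G': "continuous_on ({0..1::real} \<times> C) G'" "G' \<in> ({0..1} \<times> C) \<rightarrow> C"
      "\<forall>x\<in>{0..1} \<times> (C \<inter> c -` W n) \<union> {0} \<times> C. G' x = G x"
    by (simp only:) (elim exE conjE, rule that)
  define h where "h = (\<lambda>z. G' (1, z))"
  have h_skel: "h z = p" if "z \<in> C" "c z \<in> W n" for z
    using that G(3) G'(3) by (simp add: h_def)
  have h_C: "h \<in> C \<rightarrow> C"
    using funcset_mem[OF G'(2)] by (simp add: h_def)
  have h_cont: "continuous_on C h"
    unfolding h_def by (intro continuous_on_compose2[OF G'(1)] continuous_intros) auto
  have id_h: "homotopic_in C C id h"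
  proof -
    have "homotopic_in C C (\<lambda>z. G' (0, z)) h"
      unfolding homotopic_with_def h_def
      using G'(1,2) by (intro exI[of _ G']) (simp add: image_subset_iff_funcset)
    then show ?thesis
      by (rule homotopic_with_eq) (use G(3) G'(3) in auto)
  qed
  define R R' where "R = \<Union>(cl ` {e \<in> E. cl e \<inter> A \<noteq> {}})" and "R' = \<Union>(cl ` {e \<in> E. cl e \<inter> A = {}})"
  have RR': "R \<union> R' = B"
    using E(2) by (auto simp: R_def R'_def)
  have R_closed: "closedin (top_of_set B) R" "closedin (top_of_set B) R'"
    unfolding R_def R'_def using E(1,3) by (intro closedin_Union; auto)+
  \<comment> \<open>A common point of two different cells lies in the rim of the one of larger
    level, hence in a cell of level below \<open>n\<close>. So \<open>h\<close> and the constant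
    \<open>p\<close> agree over \<open>R \<inter> R'\<close>.\<close>
  have R_int: "R \<inter> R' \<subseteq> W n"
  proof
    fix x assume "x \<in> R \<inter> R'"
    then obtain e e' where e: "e \<in> E" "x \<in> cl e" "cl e \<inter> A \<noteq> {}" "e' \<in> E" "x \<in> cl e'" "cl e' \<inter> A = {}"
      unfolding R_def R'_def by blast
    then have "e \<noteq> e'"
      by blast
    have "\<exists>d. d \<in> E \<and> x \<in> rim d"
    proof (cases "lev e' \<le> lev e")
      case True
      then show ?thesis
        using rim(3)[of e e'] e \<open>e \<noteq> e'\<close> by blast
    next
      case False
      then show ?thesis
        using rim(3)[of e' e] e \<open>e \<noteq> e'\<close> by auto
    qed
    then obtain d where d: "d \<in> E" "x \<in> rim d" by blast
    then show "x \<in> W n"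
      using subsetD[OF rim(2)[OF d(1)] d(2)] E(5)[OF d(1)] by (auto simp: W_def)
  qed
  define \<phi> where "\<phi> = (\<lambda>z. if c z \<in> R then h z else p)"
  have \<phi>_cont: "continuous_on C \<phi>"
  proof -
    have "C = (C \<inter> c -` R) \<union> (C \<inter> c -` R')"
      using RR' c(2) by auto
    moreover have "continuous_on ((C \<inter> c -` R) \<union> (C \<inter> c -` R')) \<phi>"
      unfolding \<phi>_def
    proof (rule continuous_on_cases_local)
      show "closedin (top_of_set ((C \<inter> c -` R) \<union> (C \<inter> c -` R'))) (C \<inter> c -` R)"
        "closedin (top_of_set ((C \<inter> c -` R) \<union> (C \<inter> c -` R'))) (C \<inter> c -` R')"
        using continuous_closedin_preimage_gen[OF c R_closed(1)] continuous_closedin_preimage_gen[OF c R_closed(2)]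
          \<open>C = (C \<inter> c -` R) \<union> (C \<inter> c -` R')\<close> by simp_all
      show "continuous_on (C \<inter> c -` R) h"
        using h_cont by (rule continuous_on_subset) auto
      show "h z = p" if "z \<in> C \<inter> c -` R \<and> c z \<notin> R \<or> z \<in> C \<inter> c -` R' \<and> c z \<in> R" for z
        using that R_int by (intro h_skel) auto
    qed auto
    ultimately show ?thesis by simp
  qed
  have \<phi>_C: "\<phi> \<in> C \<rightarrow> C"
    using h_C p by (auto simp: \<phi>_def)
  have fC: "continuous_on S f" "f \<in> S \<rightarrow> C" "g \<in> S \<rightarrow> C"
    using homotopic_with_imp_continuous[OF fg(1)] homotopic_with_imp_funspace1[OF fg(1)]
      homotopic_with_imp_funspace2[OF fg(1)] by auto
  have "homotopic_in S C (id \<circ> f) (h \<circ> f)"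
    by (rule homotopic_with_compose_continuous_right[OF id_h fC(1,2)])
  moreover have "homotopic_in S C (h \<circ> f) (\<lambda>_. p)"
  proof (rule homotopic_with_eq[where f' = "h \<circ> f"])
    show "homotopic_in S C (\<phi> \<circ> f) (\<phi> \<circ> g)"
      by (rule homotopic_with_compose_continuous_left[OF fg(1) \<phi>_cont \<phi>_C])
    show "(h \<circ> f) x = (\<phi> \<circ> f) x" if "x \<in> topspace (top_of_set S)" for x
    proof -
      have "c (f x) \<in> A" "f x \<in> C"
        using fg(2) fC that by auto
      moreover have "c (f x) \<in> B"
        using c(2) \<open>f x \<in> C\<close> by auto
      ultimately have "c (f x) \<in> R"
        using E(2) by (auto simp: R_def)
      then show ?thesis by (simp add: \<phi>_def)
    qed
    show "p = (\<phi> \<circ> g) x" if "x \<in> topspace (top_of_set S)" for x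
    proof -
      have "c (g x) \<in> A'"
        using fg(3) that by auto
      \<comment> \<open>The cells that make up \<open>R\<close> meet \<open>A\<close>, so by
        \<open>sep\<close> they miss \<open>A'\<close>.\<close>
      then have "c (g x) \<notin> R"
        using sep by (auto simp: R_def)
      then show ?thesis by (simp add: \<phi>_def)
    qed
  qed auto
  ultimately show ?thesis
    by (metis homotopic_with_trans id_comp)
qed

section \<open>The dimension of a complex\<close>

text \<open>For positive \<open>k\<close> triviality of the based homotopy classes is used and the
  base point forgotten. In dimension 0 the sphere consists of two points, and a null-homotopy is a
  path joining their images.\<close>

lemma k_connected_imp_nullhomotopic:
  fixes g :: "(nat \<Rightarrow> real) \<Rightarrow> 'c::topological_space"
  assumes C: "k_connected (n - 1) (top_of_set C)" and "k < n"
    and g: "continuous_on (Sph k) g" "g \<in> Sph k \<rightarrow> C"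
  shows "\<exists>a. homotopic_in (Sph k) C g (\<lambda>_. a)"
proof (cases "k = 0")
  case True
  have sphere: "Sph k = {x. (x 0 = 1 \<or> x 0 = -1) \<and> (\<forall>i>0. x i = 0)}"
    by (auto simp: topspace_nsphere True power2_eq_1_iff)
  define P M :: "nat \<Rightarrow> real" where "P = (\<lambda>i. if i = 0 then 1 else 0)" and "M = (\<lambda>i. if i = 0 then -1 else 0)"
  have PM: "P \<in> Sph k" "M \<in> Sph k"
    by (auto simp: sphere P_def M_def)
  have cases: "x = P \<or> x = M" if "x \<in> Sph k" for x
    using that by (auto simp: sphere P_def M_def fun_eq_iff)
  have "path_connected C"
    using C by (simp add: k_connected_def)
  then obtain \<gamma> where \<gamma>: "path \<gamma>" "path_image \<gamma> \<subseteq> C" "pathstart \<gamma> = g P" "pathfinish \<gamma> = g M"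
    using PM g(2) unfolding path_connected_def by blast
  \<comment> \<open>The argument of \<open>\<gamma>\<close> is \<open>t\<close> at \<open>P\<close>
    and constantly 1 at \<open>M\<close>: the image of \<open>P\<close> travels along the path to
    that of \<open>M\<close>, which stays.\<close>
  define H where "H = (\<lambda>(t::real, x::nat\<Rightarrow>real). \<gamma> ((1 - x 0) / 2 + t * ((1 + x 0) / 2)))"
  have arg: "(1 - x 0) / 2 + t * ((1 + x 0) / 2) \<in> {0..1}" if "t \<in> {0..1}" "x \<in> Sph k" for t x
    using cases[OF that(2)] that(1) by (auto simp: P_def M_def)
  have "continuous_on ({0..1} \<times> Sph k) H"
    unfolding H_def case_prod_beta
  proof (rule continuous_on_compose2[of "{0..1}" \<gamma>])
    show "continuous_on {0..1} \<gamma>"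
      using \<gamma>(1) by (simp add: path_def)
    show "continuous_on ({0..1} \<times> Sph k) (\<lambda>p. (1 - snd p 0) / 2 + fst p * ((1 + snd p 0) / 2))"
      by (intro continuous_on_add continuous_on_diff continuous_on_mult continuous_on_divide continuous_on_const
          continuous_on_fst continuous_on_id continuous_on_coordinate[OF continuous_on_snd[OF continuous_on_id]]) auto
  qed (use arg in auto)
  moreover have "H \<in> ({0..1} \<times> Sph k) \<rightarrow> C"
  proof (rule Pi_I)
    fix z assume "z \<in> {0..1::real} \<times> Sph k"
    then have "(1 - snd z 0) / 2 + fst z * ((1 + snd z 0) / 2) \<in> {0..1}"
      using arg[of "fst z" "snd z"] by (simp add: mem_Times_iff)
    then have "H z \<in> path_image \<gamma>"
      unfolding H_def case_prod_beta path_image_def by (rule imageI)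
    then show "H z \<in> C"
      using \<gamma>(2) by blast
  qed
  ultimately have "homotopic_in (Sph k) C (\<lambda>x. H (0, x)) (\<lambda>x. H (1, x))"
    unfolding homotopic_with_def by (intro exI[of _ H]) (simp add: image_subset_iff_funcset)
  then have "homotopic_in (Sph k) C g (\<lambda>_. g M)"
  proof (rule homotopic_with_eq)
    show "g x = H (0, x)" if "x \<in> topspace (top_of_set (Sph k))" for x
      using cases[of x] that \<gamma>(3,4) by (auto simp: H_def P_def M_def pathstart_def pathfinish_def)
    show "g M = H (1, x)" if "x \<in> topspace (top_of_set (Sph k))" for x
      using cases[of x] that \<gamma>(3,4) by (auto simp: H_def P_def M_def pathstart_def pathfinish_def)
  qed auto
  then show ?thesis by blast
next
  case False
  define x where "x = g sphere_base"
  have base: "sphere_base \<in> Sph k"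
    using in_topspace_nsphere by (simp add: sphere_base_def)
  have cont: "continuous_map (nsphere k) (top_of_set C) g"
    using g by (subst euclidean_nsphere) (simp add: image_subset_iff_funcset)
  have "homotopy_class k (top_of_set C) x g \<in> homotopy_classes k (top_of_set C) x"
    unfolding homotopy_classes_def using cont x_def by blast
  moreover have "k \<in> {1..n - 1}"
    using False \<open>k < n\<close> by auto
  moreover have "x \<in> topspace (top_of_set C)"
    using g(2) base by (auto simp: x_def)
  ultimately have "homotopy_class k (top_of_set C) x g = homotopy_class k (top_of_set C) x (\<lambda>_. x)"
    using C unfolding k_connected_def by blast
  moreover have "g \<in> homotopy_class k (top_of_set C) x g"
    unfolding homotopy_class_def using cont by (simp add: x_def)
  ultimately have "homotopic_with (\<lambda>h. h sphere_base = x) (nsphere k) (top_of_set C) (\<lambda>_. x) g"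
    by (simp add: homotopy_class_def)
  then have "homotopic_with (\<lambda>_. True) (nsphere k) (top_of_set C) g (\<lambda>_. x)"
    by (metis (mono_tags, lifting) homotopic_with_mono homotopic_with_symD)
  then show ?thesis
    by (subst (asm) euclidean_nsphere) blast
qed

text \<open>A map of a simplex to its boundary which preserves all faces would contract the boundary sphere.\<close>

lemma no_face_preserving_map_to_boundary:
  fixes \<sigma> :: "nat set" and g :: "(nat \<Rightarrow> real) \<Rightarrow> nat \<Rightarrow> real"
  defines "\<Delta> \<equiv> {t::nat\<Rightarrow>real. (\<forall>v. 0 \<le> t v) \<and> (\<forall>v. v \<notin> \<sigma> \<longrightarrow> t v = 0) \<and> (\<Sum>v\<in>\<sigma>. t v) = 1}"
  assumes \<sigma>: "finite \<sigma>" "card \<sigma> = k + 2"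
    and g: "continuous_on \<Delta> g" "g \<in> \<Delta> \<rightarrow> \<Delta>"
    and face: "\<And>t v. \<lbrakk>t \<in> \<Delta>; t v = 0\<rbrakk> \<Longrightarrow> g t v = 0"
    and bdry: "\<And>t. t \<in> \<Delta> \<Longrightarrow> \<exists>v\<in>\<sigma>. g t v = 0"
  shows False
proof -
  define S where "S = Sph k"
  obtain d where d: "bij_betw d {..<k + 2} \<sigma>"
    using ex_bij_betw_nat_finite[OF \<sigma>(1)] \<sigma>(2) by (auto simp: atLeast0LessThan)
  define e where "e = inv_into {..<k + 2} d"
  have e: "e v \<le> Suc k" "d (e v) = v" if "v \<in> \<sigma>" for v
    using d that bij_betw_inv_into_right[OF d that] inv_into_into[of v d "{..<k + 2}"] by (auto simp: e_def bij_betw_def)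
  have d': "d i \<in> \<sigma>" "e (d i) = i" if "i \<le> Suc k" for i
    using d that bij_betw_inv_into_left[OF d, of i] by (auto simp: e_def bij_betw_def)
  have sum_d: "(\<Sum>v\<in>\<sigma>. h v) = (\<Sum>i\<le>Suc k. h (d i))" for h :: "nat \<Rightarrow> real"
    using sum.reindex_bij_betw[OF d, of h] by (simp add: lessThan_Suc_atMost)
  \<comment> \<open>These are linear coordinates on the hyperplane of the simplex in which the
    barycentre is the origin. A boundary point has a vanishing coordinate, so it is not the
    barycentre, and \<open>b\<close> is the radial projection of the boundary to the sphere.\<close>
  define D where "D = (\<lambda>t i. if i \<le> k then t (d i) - t (d (Suc k)) else (0::real))"
  define n2 where "n2 = (\<lambda>y::nat \<Rightarrow> real. sqrt (\<Sum>i\<le>k. (y i)\<^sup>2))"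
  define b where "b = (\<lambda>t i. D t i / n2 (D t))"
  define \<Delta>' where "\<Delta>' = {t \<in> \<Delta>. \<exists>v\<in>\<sigma>. t v = 0}"
  have n2_pos: "n2 y > 0" if "\<exists>i\<le>k. y i \<noteq> 0" for y
  proof -
    have "n2 y \<noteq> 0"
      using that by (auto simp: n2_def sum_nonneg_eq_0_iff)
    then show ?thesis
      by (simp add: n2_def sum_nonneg less_le)
  qed
  have n2_D: "n2 (D t) > 0" if t: "t \<in> \<Delta>'" for t
  proof (rule n2_pos, rule ccontr)
    assume "\<not> (\<exists>i\<le>k. D t i \<noteq> 0)"
    then have eq: "t (d i) = t (d (Suc k))" if "i \<le> Suc k" for i
      using that by (auto simp: D_def le_Suc_eq)
    from t obtain v where v: "v \<in> \<sigma>" "t v = 0"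
      by (auto simp: \<Delta>'_def)
    have "t (d i) = 0" if "i \<le> Suc k" for i
      using eq[OF that] eq[OF e(1)[OF v(1)]] e(2)[OF v(1)] v(2) by simp
    then have "(\<Sum>v\<in>\<sigma>. t v) = 0"
      unfolding sum_d by (intro sum.neutral) simp
    then show False
      using t by (simp add: \<Delta>'_def \<Delta>_def)
  qed
  have b_S: "b t \<in> S" if "t \<in> \<Delta>'" for t
  proof -
    have "(n2 (D t))\<^sup>2 = (\<Sum>i\<le>k. (D t i)\<^sup>2)"
      by (simp add: n2_def sum_nonneg)
    then show ?thesis
      using n2_D[OF that] by (auto simp: S_def topspace_nsphere b_def power_divide D_def simp flip: sum_divide_distrib)
  qed
  have coord: "continuous_on A (\<lambda>t. t v)" for A and v :: nat
    by (rule continuous_on_subset[OF continuous_on_product_coordinates]) simp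
  have b_cont: "continuous_on \<Delta>' b"
  proof (rule continuous_on_coordinatewise_then_product)
    have D_cont: "continuous_on \<Delta>' (\<lambda>t. D t i)" for i
      by (cases "i \<le> k") (auto simp: D_def intro!: continuous_on_diff coord)
    have "continuous_on \<Delta>' (\<lambda>t. n2 (D t))"
      unfolding n2_def by (intro continuous_intros D_cont)
    then show "continuous_on \<Delta>' (\<lambda>t. b t i)" for i
      unfolding b_def using n2_D by (intro continuous_on_divide D_cont) force+
  qed
  define \<mu> where "\<mu> = (\<lambda>y::nat \<Rightarrow> real. - Max ((\<lambda>i. - y i) ` {..Suc k}))"
  have mu_le: "\<mu> y \<le> y i" if "i \<le> Suc k" for i y
  proof -
    have "- y i \<le> Max ((\<lambda>i. - y i) ` {..Suc k})"
      using that by (intro Max_ge) auto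
    then show ?thesis
      unfolding \<mu>_def by linarith
  qed
  have mu_ex: "\<exists>i\<le>Suc k. \<mu> y = y i" for y
  proof -
    have "Max ((\<lambda>i. - y i) ` {..Suc k}) \<in> (\<lambda>i. - y i) ` {..Suc k}"
      by (rule Max_in) auto
    then show ?thesis
      unfolding \<mu>_def by force
  qed
  have mu_cont: "continuous_on A \<mu>" for A
    unfolding \<mu>_def by (intro continuous_on_minus continuous_on_Max_image coord) auto
  \<comment> \<open>The section \<open>a\<close> of \<open>b\<close> shifts \<open>y\<close>, whose
    entry at \<open>Suc k\<close> is 0, until its minimum \<open>\<mu> y\<close> becomes 0, and then
    divides by the sum \<open>s y\<close>. The vanishing minimum puts the result on the
    boundary.\<close>
  define s where "s = (\<lambda>y. \<Sum>i\<le>Suc k. y i - \<mu> y)"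
  define a where "a = (\<lambda>y v. if v \<in> \<sigma> then (y (e v) - \<mu> y) / s y else 0)"
  have s_pos: "s y > 0" if y: "y \<in> S" for y
  proof -
    have nn: "\<And>i. i \<in> {..Suc k} \<Longrightarrow> 0 \<le> y i - \<mu> y"
      using mu_le by simp
    have "s y \<noteq> 0"
    proof
      assume "s y = 0"
      then have "\<forall>i\<in>{..Suc k}. y i - \<mu> y = 0"
        unfolding s_def using nn by (subst (asm) sum_nonneg_eq_0_iff) simp_all
      moreover have "y (Suc k) = 0"
        using y by (auto simp: S_def topspace_nsphere)
      ultimately have "\<mu> y = 0"
        by simp
      with \<open>\<forall>i\<in>{..Suc k}. y i - \<mu> y = 0\<close> have "y i = 0" if "i \<le> k" for i
        using that by simp
      then show False
        using y by (simp add: S_def topspace_nsphere)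
    qed
    moreover have "s y \<ge> 0"
      unfolding s_def using nn by (rule sum_nonneg)
    ultimately show ?thesis by simp
  qed
  have a_\<Delta>: "a y \<in> \<Delta>'" if y: "y \<in> S" for y
  proof -
    have "a y v \<ge> 0" for v
      using s_pos[OF y] mu_le[OF e(1)] by (simp add: a_def)
    moreover have "(\<Sum>v\<in>\<sigma>. a y v) = 1"
    proof -
      have "(\<Sum>v\<in>\<sigma>. a y v) = (\<Sum>i\<le>Suc k. (y i - \<mu> y) / s y)"
        unfolding sum_d using d' by (intro sum.cong) (simp_all add: a_def)
      also have "\<dots> = s y / s y"
        unfolding s_def by (simp only: sum_divide_distrib)
      finally show ?thesis
        using s_pos[OF y] by simp
    qed
    moreover obtain i where "i \<le> Suc k" "\<mu> y = y i"
      using mu_ex by blast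
    then have "d i \<in> \<sigma>" "a y (d i) = 0"
      using d'[of i] by (simp_all add: a_def)
    ultimately show ?thesis
      by (auto simp: \<Delta>'_def \<Delta>_def a_def)
  qed
  have a_cont: "continuous_on S a"
  proof (rule continuous_on_coordinatewise_then_product)
    have "continuous_on S s"
      unfolding s_def by (intro continuous_on_sum continuous_on_diff coord mu_cont)
    then show "continuous_on S (\<lambda>y. a y v)" for v
      using less_imp_neq[OF s_pos] by (cases "v \<in> \<sigma>") (auto simp: a_def intro!: continuous_on_divide continuous_on_diff coord mu_cont)
  qed
  have ba: "b (a y) = y" if y: "y \<in> S" for y
  proof -
    have Sk: "y (Suc k) = 0" "y i = 0" if "i > k" for i
      using y that by (auto simp: S_def topspace_nsphere)
    have Da: "D (a y) i = y i / s y" for i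
    proof (cases "i \<le> k")
      case True
      then show ?thesis
        using d'[of i] d'[of "Suc k"] Sk[of "Suc k"] by (simp add: D_def a_def diff_divide_distrib)
    next
      case False
      then show ?thesis
        using Sk[of i] by (simp add: D_def)
    qed
    have "n2 (D (a y)) = sqrt ((\<Sum>i\<le>k. (y i)\<^sup>2) / (s y)\<^sup>2)"
      unfolding n2_def Da by (simp add: power_divide sum_divide_distrib)
    also have "\<dots> = 1 / s y"
      using y s_pos[OF y] by (simp add: S_def topspace_nsphere real_sqrt_divide)
    finally show ?thesis
      using s_pos[OF y] by (simp add: b_def Da fun_eq_iff)
  qed
  have \<Delta>'_sub: "\<Delta>' \<subseteq> \<Delta>"
    by (auto simp: \<Delta>'_def)
  have g_\<Delta>': "g t \<in> \<Delta>'" if "t \<in> \<Delta>" for t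
    using bdry[OF that] g(2) that by (auto simp: \<Delta>'_def)
  have convex: "(\<lambda>v. (1 - \<tau>) * t v + \<tau> * t' v) \<in> \<Delta>" if "\<tau> \<in> {0..1}" "t \<in> \<Delta>" "t' \<in> \<Delta>" for \<tau> t t'
  proof -
    have "(\<Sum>v\<in>\<sigma>. (1 - \<tau>) * t v + \<tau> * t' v) = 1"
      using that by (simp add: \<Delta>_def sum.distrib flip: sum_distrib_left)
    then show ?thesis
      using that by (auto simp: \<Delta>_def)
  qed
  have line_cont: "continuous_on ({0..1} \<times> S) (\<lambda>z v. (1 - fst z) * h1 (snd z) v + fst z * h2 (snd z) v)"
    if h: "continuous_on S h1" "continuous_on S h2" for h1 h2 :: "(nat \<Rightarrow> real) \<Rightarrow> nat \<Rightarrow> real"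
  proof (rule continuous_on_coordinatewise_then_product)
    fix v
    have *: "continuous_on ({0..1::real} \<times> S) (\<lambda>z. h (snd z) v)" if "continuous_on S h" for h :: "(nat \<Rightarrow> real) \<Rightarrow> nat \<Rightarrow> real"
      by (rule continuous_on_coordinate, rule continuous_on_compose2[OF that continuous_on_snd[OF continuous_on_id]]) auto
    show "continuous_on ({0..1} \<times> S) (\<lambda>z. (1 - fst z) * h1 (snd z) v + fst z * h2 (snd z) v)"
      by (intro continuous_on_add continuous_on_mult continuous_on_diff continuous_on_const continuous_on_fst
          continuous_on_id *[OF h(1)] *[OF h(2)])
  qed
  have ga_cont: "continuous_on S (\<lambda>y. g (a y))"
    by (rule continuous_on_compose2[OF g(1) a_cont]) (use a_\<Delta> \<Delta>'_sub in auto)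
  \<comment> \<open>Since \<open>g\<close> preserves faces, a coordinate that vanishes at
    \<open>a y\<close> vanishes at \<open>g (a y)\<close> too. The segment between them therefore
    stays in the boundary, where \<open>b\<close> is defined.\<close>
  define H1 where "H1 = (\<lambda>z. b (\<lambda>v. (1 - fst z) * a (snd z) v + fst z * g (a (snd z)) v))"
  have H1_in: "(\<lambda>v. (1 - \<tau>) * a y v + \<tau> * g (a y) v) \<in> \<Delta>'" if "\<tau> \<in> {0..1}" "y \<in> S" for \<tau> y
  proof -
    have ay: "a y \<in> \<Delta>" "\<exists>v\<in>\<sigma>. a y v = 0"
      using a_\<Delta>[OF that(2)] by (auto simp: \<Delta>'_def)
    then obtain v where "v \<in> \<sigma>" "a y v = 0" "g (a y) v = 0"
      using face by blast
    then show ?thesis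
      using convex[OF that(1) ay(1) funcset_mem[OF g(2) ay(1)]] by (auto simp: \<Delta>'_def intro!: bexI[of _ v])
  qed
  have "homotopic_in S S (\<lambda>y. H1 (0, y)) (\<lambda>y. H1 (1, y))"
  proof -
    have "continuous_on ({0..1} \<times> S) H1"
      unfolding H1_def by (rule continuous_on_compose2[OF b_cont line_cont[OF a_cont ga_cont]]) (use H1_in in auto)
    moreover have "H1 \<in> ({0..1} \<times> S) \<rightarrow> S"
      using H1_in b_S by (auto simp: H1_def)
    ultimately show ?thesis
      unfolding homotopic_with_def by (intro exI[of _ H1]) (simp add: image_subset_iff_funcset)
  qed
  then have hom1: "homotopic_in S S id (\<lambda>y. b (g (a y)))"
    by (rule homotopic_with_eq) (use ba in \<open>auto simp: H1_def\<close>)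
  define p :: "nat \<Rightarrow> real" where "p = (\<lambda>v. if v = d 0 then 1 else 0)"
  have p: "p \<in> \<Delta>"
    using d'(1)[of 0] \<sigma>(1) by (auto simp: \<Delta>_def p_def)
  \<comment> \<open>This segment to the vertex \<open>p\<close> may cross the interior of the
    simplex, but \<open>g\<close> is applied before \<open>b\<close> and brings it back to the
    boundary.\<close>
  define H2 where "H2 = (\<lambda>z. b (g (\<lambda>v. (1 - fst z) * a (snd z) v + fst z * p v)))"
  have H2_in: "(\<lambda>v. (1 - \<tau>) * a y v + \<tau> * p v) \<in> \<Delta>" if "\<tau> \<in> {0..1}" "y \<in> S" for \<tau> y
    using convex[OF that(1) subsetD[OF \<Delta>'_sub a_\<Delta>[OF that(2)]] p] .
  have "homotopic_in S S (\<lambda>y. H2 (0, y)) (\<lambda>y. H2 (1, y))"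
  proof -
    have "continuous_on ({0..1} \<times> S) H2"
      unfolding H2_def
      by (rule continuous_on_compose2[OF b_cont continuous_on_compose2[OF g(1) line_cont[OF a_cont continuous_on_const]]])
         (use H2_in g_\<Delta>' in auto)
    moreover have "H2 \<in> ({0..1} \<times> S) \<rightarrow> S"
      using H2_in b_S g_\<Delta>' by (auto simp: H2_def)
    ultimately show ?thesis
      unfolding homotopic_with_def by (intro exI[of _ H2]) (simp add: image_subset_iff_funcset)
  qed
  then have "homotopic_in S S (\<lambda>y. b (g (a y))) (\<lambda>_. b (g p))"
    by (rule homotopic_with_eq) (auto simp: H2_def)
  with hom1 have "homotopic_in S S id (\<lambda>_. b (g p))"
    by (rule homotopic_with_trans)
  then have "contractible_space (nsphere k)"
    unfolding contractible_space_def S_def by (subst euclidean_nsphere, subst euclidean_nsphere) blast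
  then show False
    using non_contractible_space_nsphere by blast
qed

section \<open>Realizations of finite complexes and their covering dimension\<close>

lemma euclidean_realization: "realization \<K> = top_of_set (topspace (realization \<K>))"
  by (simp add: realization_def euclidean_product_topology)

lemma topspace_realization:
  "topspace (realization \<K>) = {t. (\<forall>v. 0 \<le> t v) \<and> {v. t v \<noteq> 0} \<in> \<K> \<and> (\<Sum>v | t v \<noteq> 0. t v) = 1}"
  by (simp add: realization_def)

lemma finite_complex_simplex:
  assumes "finite_complex \<K>" "\<sigma> \<in> \<K>"
  shows "finite \<sigma>" "\<sigma> \<noteq> {}"
  using assms unfolding finite_complex_def by blast+

lemma finite_complex_face:
  assumes "finite_complex \<K>" "\<sigma> \<in> \<K>" "\<tau> \<subseteq> \<sigma>" "\<tau> \<noteq> {}"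
  shows "\<tau> \<in> \<K>"
  using assms unfolding finite_complex_def by blast

text \<open>Refine the cover by the open stars of the vertices of \<open>\<sigma>\<close>, assign to
  each member of the refinement a vertex whose star contains it, and use a partition of unity to
  obtain a map \<open>g\<close> of the simplex to itself. It preserves faces, as
  \<open>t v = 0\<close> keeps \<open>t\<close> out of the star of \<open>v\<close>. If
  \<open>\<sigma>\<close> had more than \<open>n + 1\<close> vertices, too few members would contain
  a given point for all coordinates of its image to be positive, and \<open>g\<close> would go into
  the boundary.\<close>

lemma card_simplex_le_covering_dim:
  assumes \<K>: "finite_complex \<K>" and dim: "covering_dim_le (realization \<K>) n" and \<sigma>: "\<sigma> \<in> \<K>"
  shows "card \<sigma> \<le> n + 1"
proof (rule ccontr)
  assume "\<not> card \<sigma> \<le> n + 1"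
  then have large: "card \<sigma> > n + 1"
    by simp
  have fin: "finite \<sigma>"
    using finite_complex_simplex(1)[OF \<K> \<sigma>] .
  define R where "R = topspace (realization \<K>)"
  define \<Delta> where "\<Delta> = {t::nat\<Rightarrow>real. (\<forall>v. 0 \<le> t v) \<and> (\<forall>v. v \<notin> \<sigma> \<longrightarrow> t v = 0) \<and> (\<Sum>v\<in>\<sigma>. t v) = 1}"
  have \<Delta>_R: "\<Delta> \<subseteq> R"
  proof
    fix t assume t: "t \<in> \<Delta>"
    then have sub: "{v. t v \<noteq> 0} \<subseteq> \<sigma>"
      by (auto simp: \<Delta>_def)
    have "(\<Sum>v | t v \<noteq> 0. t v) = (\<Sum>v\<in>\<sigma>. t v)"
      using fin sub by (intro sum.mono_neutral_left) auto
    then have sum: "(\<Sum>v | t v \<noteq> 0. t v) = 1"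
      using t by (simp add: \<Delta>_def)
    have "{v. t v \<noteq> 0} \<noteq> {}"
    proof
      assume empty: "{v. t v \<noteq> 0} = {}"
      show False
        using sum unfolding empty by simp
    qed
    then have "{v. t v \<noteq> 0} \<in> \<K>"
      using finite_complex_face[OF \<K> \<sigma> sub] by simp
    then show "t \<in> R"
      using t sum by (simp add: R_def topspace_realization \<Delta>_def)
  qed
  define U where "U = (\<lambda>v. {t \<in> R. t v > 0})"
  have U_open: "openin (top_of_set R) (U v)" for v
  proof -
    have "U v = R \<inter> {t. t v > 0}"
      by (auto simp: U_def)
    moreover have "open {t::nat\<Rightarrow>real. t v > 0}"
      by (intro open_Collect_less continuous_on_const continuous_on_product_coordinates)
    ultimately show ?thesis
      by (simp add: openin_open_Int)
  qed
  \<comment> \<open>The dimension hypothesis concerns the whole realization, so the rest of it must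
    be covered as well; \<open>U'\<close> does this without touching the simplex
    \<open>\<Delta>\<close>.\<close>
  define U' where "U' = (\<Union>v\<in>- \<sigma>. U v)"
  have cover: "\<Union>(insert U' (U ` \<sigma>)) = R"
  proof -
    have "t \<in> \<Union>(insert U' (U ` \<sigma>))" if t: "t \<in> R" for t
    proof -
      have "{v. t v \<noteq> 0} \<noteq> {}"
        using t finite_complex_simplex(2)[OF \<K>, of "{v. t v \<noteq> 0}"] unfolding R_def topspace_realization by blast
      then obtain v where "t v \<noteq> 0"
        by blast
      then have "t \<in> U v"
        using t by (simp add: U_def R_def topspace_realization less_le)
      then show ?thesis
        by (auto simp: U'_def)
    qed
    then show ?thesis
      by (auto simp: U'_def U_def)
  qed
  have U'_\<Delta>: "U' \<inter> \<Delta> = {}"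
    by (auto simp: U'_def U_def \<Delta>_def)
  have "\<exists>\<V>. finite \<V> \<and> (\<forall>V\<in>\<V>. openin (top_of_set R) V \<and> (\<exists>W\<in>insert U' (U ` \<sigma>). V \<subseteq> W)) \<and>
      \<Union>\<V> = R \<and> (\<forall>x\<in>R. card {V \<in> \<V>. x \<in> V} \<le> n + 1)"
  proof -
    have "openin (top_of_set R) U'"
      unfolding U'_def by (intro openin_Union) (use U_open in auto)
    moreover have "covering_dim_le (top_of_set R) n"
      using dim euclidean_realization[of \<K>] by (simp add: R_def)
    ultimately show ?thesis
      unfolding covering_dim_le_def using fin U_open cover by (elim allE[of _ "insert U' (U ` \<sigma>)"]) auto
  qed
  then obtain \<V> where \<V>01: "finite \<V>" and \<V>02: "\<forall>V\<in>\<V>. openin (top_of_set R) V \<and> (\<exists>W\<in>insert U' (U ` \<sigma>). V \<subseteq> W)"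
      and \<V>03: "\<Union>\<V> = R" and \<V>04: "\<forall>x\<in>R. card {V \<in> \<V>. x \<in> V} \<le> n + 1"
    by (elim exE conjE) (rule that)
  have \<V>: "finite \<V>" "\<And>V. V \<in> \<V> \<Longrightarrow> openin (top_of_set R) V"
      "\<And>V. V \<in> \<V> \<Longrightarrow> \<exists>W\<in>insert U' (U ` \<sigma>). V \<subseteq> W" "\<Union>\<V> = R" "\<And>x. x \<in> R \<Longrightarrow> card {V \<in> \<V>. x \<in> V} \<le> n + 1"
    using \<V>01 bspec[OF \<V>02] \<V>03 bspec[OF \<V>04] by simp_all
  define \<V>' where "\<V>' = {V \<in> \<V>. V \<inter> \<Delta> \<noteq> {}}"
  have fin': "finite \<V>'"
    using \<V>(1) by (simp add: \<V>'_def)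
  have "\<exists>v\<in>\<sigma>. V \<subseteq> U v" if V: "V \<in> \<V>'" for V
  proof -
    obtain W where "W \<in> insert U' (U ` \<sigma>)" "V \<subseteq> W"
      using \<V>(3)[of V] V by (auto simp: \<V>'_def)
    moreover have "W \<noteq> U'"
      using \<open>V \<subseteq> W\<close> U'_\<Delta> V by (auto simp: \<V>'_def)
    ultimately show ?thesis by auto
  qed
  then obtain \<epsilon> where \<epsilon>: "\<And>V. V \<in> \<V>' \<Longrightarrow> \<epsilon> V \<in> \<sigma>" "\<And>V. V \<in> \<V>' \<Longrightarrow> V \<subseteq> U (\<epsilon> V)"
    by metis
  \<comment> \<open>The distance to the complement is positive exactly on \<open>V\<close>. The case
    \<open>V = R\<close> is separate because \<open>infdist\<close> to the empty set is 0 by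
    convention.\<close>
  define w where "w = (\<lambda>V t. if R - V = {} then 1 else infdist t (R - V))"
  have w_cont: "continuous_on \<Delta> (w V)" for V
    by (cases "R - V = {}") (auto simp: w_def[abs_def] intro!: continuous_intros)
  have w_nonneg: "w V t \<ge> 0" for V t
    by (simp add: w_def infdist_nonneg)
  have w_pos: "w V t > 0 \<longleftrightarrow> t \<in> V" if V: "V \<in> \<V>" and t: "t \<in> R" for V t
  proof (cases "R - V = {}")
    case True
    then show ?thesis
      using t by (auto simp: w_def)
  next
    case False
    obtain X where X: "open X" "V = R \<inter> X"
      using \<V>(2)[OF V] by (auto simp: openin_open)
    have "t \<notin> V \<longleftrightarrow> t \<in> closure (R - V)"
    proof
      assume "t \<notin> V"
      then show "t \<in> closure (R - V)"
        using t by (intro subsetD[OF closure_subset]) simp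
    next
      assume *: "t \<in> closure (R - V)"
      have "closure (R - V) \<subseteq> - X"
        using X by (intro closure_minimal) auto
      from subsetD[OF this *] show "t \<notin> V"
        using X(2) by simp
    qed
    moreover have "t \<in> closure (R - V) \<longleftrightarrow> w V t = 0"
      using in_closure_iff_infdist_zero[OF False, of t] False by (simp add: w_def)
    ultimately show ?thesis
      using w_nonneg[of V t] by linarith
  qed
  define s where "s = (\<lambda>t. \<Sum>V\<in>\<V>'. w V t)"
  have s_pos: "s t > 0" if t: "t \<in> \<Delta>" for t
  proof -
    obtain V where "V \<in> \<V>" "t \<in> V"
      using subsetD[OF \<Delta>_R t] unfolding \<V>(4)[symmetric] by (rule UnionE)
    then have "V \<in> \<V>'" "w V t > 0"
      using t w_pos[of V t] subsetD[OF \<Delta>_R t] unfolding \<V>'_def by auto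
    then show ?thesis
      unfolding s_def using fin' w_nonneg by (intro sum_pos2[of _ V]) auto
  qed
  define g where "g = (\<lambda>t v. (\<Sum>V\<in>{V \<in> \<V>'. \<epsilon> V = v}. w V t) / s t)"
  have g_pos: "\<exists>V\<in>\<V>'. \<epsilon> V = v \<and> t \<in> V" if t: "t \<in> \<Delta>" and "g t v \<noteq> 0" for t v
  proof -
    have "(\<Sum>V\<in>{V \<in> \<V>'. \<epsilon> V = v}. w V t) \<noteq> 0"
      using that by (auto simp: g_def)
    then obtain V where "V \<in> \<V>'" "\<epsilon> V = v" "w V t \<noteq> 0"
      using sum.not_neutral_contains_not_neutral by force
    then show ?thesis
      using w_pos[of V t] w_nonneg[of V t] subsetD[OF \<Delta>_R t] unfolding \<V>'_def
      by (intro bexI[of _ V]) auto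
  qed
  have k: "card \<sigma> = (card \<sigma> - 2) + 2"
    using large by simp
  show False
  proof (rule no_face_preserving_map_to_boundary[OF fin k, folded \<Delta>_def])
    show "continuous_on \<Delta> g"
    proof (rule continuous_on_coordinatewise_then_product)
      have "continuous_on \<Delta> s"
        unfolding s_def by (intro continuous_on_sum w_cont)
      then show "continuous_on \<Delta> (\<lambda>t. g t v)" for v
        unfolding g_def using less_imp_neq[OF s_pos] by (intro continuous_on_divide continuous_on_sum w_cont) auto
    qed
    show "g \<in> \<Delta> \<rightarrow> \<Delta>"
    proof (rule Pi_I)
      fix t assume t: "t \<in> \<Delta>"
      have "g t v \<ge> 0" for v
        using s_pos[OF t] w_nonneg by (simp add: g_def sum_nonneg)
      moreover have "g t v = 0" if "v \<notin> \<sigma>" for v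
        using g_pos[OF t, of v] \<epsilon>(1) that by blast
      moreover have "(\<Sum>v\<in>\<sigma>. g t v) = 1"
      proof -
        have "(\<Sum>v\<in>\<sigma>. \<Sum>V\<in>{V \<in> \<V>'. \<epsilon> V = v}. w V t) = s t"
          unfolding s_def using fin fin' \<epsilon>(1) by (intro sum.group) auto
        then show ?thesis
          using s_pos[OF t] by (simp add: g_def flip: sum_divide_distrib)
      qed
      ultimately show "g t \<in> \<Delta>"
        by (simp add: \<Delta>_def)
    qed
    show "g t v = 0" if t: "t \<in> \<Delta>" "t v = 0" for t v
    proof (rule ccontr)
      assume "g t v \<noteq> 0"
      then obtain V where "V \<in> \<V>'" "\<epsilon> V = v" "t \<in> V"
        using g_pos[OF t(1)] by blast
      then show False
        using \<epsilon>(2)[of V] t(2) by (auto simp: U_def)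
    qed
    show "\<exists>v\<in>\<sigma>. g t v = 0" if t: "t \<in> \<Delta>" for t
    proof (rule ccontr)
      assume no: "\<not> (\<exists>v\<in>\<sigma>. g t v = 0)"
      \<comment> \<open>A nonzero coordinate at \<open>v\<close> comes from a member through
        \<open>t\<close> assigned to \<open>v\<close>. If no coordinate vanished, at least
        \<open>card \<sigma>\<close> members would pass through \<open>t\<close>.\<close>
      have "\<sigma> \<subseteq> \<epsilon> ` {V \<in> \<V>'. t \<in> V}"
      proof
        fix v assume "v \<in> \<sigma>"
        with no have "g t v \<noteq> 0"
          by simp
        from g_pos[OF t this] obtain V where "V \<in> \<V>'" "\<epsilon> V = v \<and> t \<in> V" ..
        then show "v \<in> \<epsilon> ` {V \<in> \<V>'. t \<in> V}"
          by (intro image_eqI[of _ _ V]) auto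
      qed
      then have "card \<sigma> \<le> card {V \<in> \<V>'. t \<in> V}"
        using fin' by (intro surj_card_le) auto
      also have "\<dots> \<le> card {V \<in> \<V>. t \<in> V}"
        using \<V>(1) by (intro card_mono) (auto simp: \<V>'_def)
      also have "\<dots> \<le> n + 1"
        using \<V>(5)[OF subsetD[OF \<Delta>_R t]] .
      finally show False
        using large by simp
    qed
  qed
qed

section \<open>Cubical subdivision\<close>

text \<open>Normalizing by the maximum instead of the sum of the coordinates turns the realization into a union
  of faces of the unit cube. Cubical subcomplexes are easily subdivided: cut along a grid.\<close>

definition cubulation :: "nat set set \<Rightarrow> (nat \<Rightarrow> real) set" where
  "cubulation \<K> = {t. (\<forall>v. 0 \<le> t v \<and> t v \<le> 1) \<and> {v. t v \<noteq> 0} \<in> \<K> \<and> (\<exists>v. t v = 1)}"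

text \<open>A finite union of the faces \<open>P \<sigma> v\<close>, which are products of intervals
  and points and compact by Tychonoff.\<close>

lemma compact_cubulation:
  assumes \<K>: "finite_complex \<K>"
  shows "compact (cubulation \<K>)"
proof -
  define P where "P = (\<lambda>\<sigma> v. Pi\<^sub>E UNIV (\<lambda>w::nat. if w = v then {1} else if w \<in> \<sigma> then {0..1} else {0::real}))"
  have "compact (P \<sigma> v)" for \<sigma> v
  proof -
    have "compactin (product_topology (\<lambda>i::nat. euclideanreal) UNIV) (P \<sigma> v)"
      unfolding P_def by (subst compactin_PiE) auto
    then show ?thesis
      by (simp add: euclidean_product_topology)
  qed
  moreover have "finite \<K>"
    using \<K> by (simp add: finite_complex_def)
  ultimately have "compact (\<Union>\<sigma>\<in>\<K>. \<Union>v\<in>\<sigma>. P \<sigma> v)"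
    using finite_complex_simplex(1)[OF \<K>] by (intro compact_UN) auto
  moreover have "cubulation \<K> = (\<Union>\<sigma>\<in>\<K>. \<Union>v\<in>\<sigma>. P \<sigma> v)"
  proof (intro subset_antisym subsetI)
    fix t assume t: "t \<in> cubulation \<K>"
    then obtain v where v: "t v = 1"
      by (auto simp: cubulation_def)
    have "t \<in> P {v. t v \<noteq> 0} v"
      using t v by (simp add: P_def PiE_iff cubulation_def)
    moreover have "v \<in> {v. t v \<noteq> 0}" "{v. t v \<noteq> 0} \<in> \<K>"
      using t v by (simp_all add: cubulation_def)
    ultimately show "t \<in> (\<Union>\<sigma>\<in>\<K>. \<Union>v\<in>\<sigma>. P \<sigma> v)"
      by blast
  next
    fix t assume "t \<in> (\<Union>\<sigma>\<in>\<K>. \<Union>v\<in>\<sigma>. P \<sigma> v)"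
    then obtain \<sigma> v where \<sigma>: "\<sigma> \<in> \<K>" "v \<in> \<sigma>" "t \<in> P \<sigma> v"
      by blast
    have coord: "t w \<in> (if w = v then {1} else if w \<in> \<sigma> then {0..1} else {0})" for w
      using \<sigma>(3) by (simp add: P_def PiE_iff)
    have "{w. t w \<noteq> 0} \<subseteq> \<sigma>"
    proof
      fix w assume "w \<in> {w. t w \<noteq> 0}"
      then show "w \<in> \<sigma>"
        using coord[of w] \<sigma>(2) by (auto split: if_splits)
    qed
    moreover have tv: "t v = 1"
      using coord[of v] by simp
    ultimately have "{w. t w \<noteq> 0} \<in> \<K>"
      using finite_complex_face[OF \<K> \<sigma>(1), of "{w. t w \<noteq> 0}"] by fastforce
    moreover have "0 \<le> t w \<and> t w \<le> 1" for w
      using coord[of w] by (auto split: if_splits)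
    ultimately show "t \<in> cubulation \<K>"
      using tv by (auto simp: cubulation_def)
  qed
  ultimately show ?thesis
    by simp
qed

text \<open>Dividing by the sum of the coordinates is a bijection whose inverse divides by their
  maximum. Continuity of the inverse follows from compactness of the cubulation.\<close>

lemma homeomorphism_cubulation:
  assumes \<K>: "finite_complex \<K>"
  shows "\<exists>f g. homeomorphism (cubulation \<K>) (topspace (realization \<K>)) f g"
proof -
  define V where "V = \<Union>\<K>"
  have V: "finite V"
    using \<K> by (auto simp: V_def finite_complex_def)
  define s where "s = (\<lambda>t::nat\<Rightarrow>real. \<Sum>v\<in>V. t v)"
  define g where "g = (\<lambda>t v. t v / s t)"
  have supp: "(\<Sum>v | t v \<noteq> 0. t v) = s t" if "{v. t v \<noteq> 0} \<in> \<K>" for t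
    unfolding s_def using V that by (intro sum.mono_neutral_left) (auto simp: V_def)
  have s_pos: "s t > 0" if t: "t \<in> cubulation \<K>" for t
  proof -
    obtain v where "t v = 1"
      using t by (auto simp: cubulation_def)
    moreover have "v \<in> V"
      unfolding V_def using t \<open>t v = 1\<close>
      by (intro UnionI[of "{v. t v \<noteq> 0}"]) (simp_all add: cubulation_def)
    ultimately show ?thesis
      unfolding s_def using t V by (intro sum_pos2[of _ v]) (auto simp: cubulation_def)
  qed
  have "continuous_on (cubulation \<K>) g"
  proof (rule continuous_on_coordinatewise_then_product)
    have coord: "continuous_on A (\<lambda>t::nat\<Rightarrow>real. t v)" for A v
      by (rule continuous_on_subset[OF continuous_on_product_coordinates]) simp
    show "continuous_on (cubulation \<K>) (\<lambda>t. g t v)" for v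
      unfolding g_def s_def using less_imp_neq[OF s_pos]
      by (intro continuous_on_divide continuous_on_sum coord) (auto simp: s_def)
  qed
  moreover have "inj_on g (cubulation \<K>)"
  proof (rule inj_onI)
    \<comment> \<open>Compare at a coordinate where \<open>u\<close> equals 1 and \<open>u'\<close>
      is at most 1; exchanging the two points then gives equality of the sums.\<close>
    have le: "s u' \<le> s u" if u: "u \<in> cubulation \<K>" "u' \<in> cubulation \<K>" "g u = g u'" for u u'
    proof -
      obtain v where v: "u v = 1"
        using u by (auto simp: cubulation_def)
      then have "1 / s u = u' v / s u'"
        using fun_cong[OF u(3), of v] by (simp add: g_def)
      also have "\<dots> \<le> 1 / s u'"
        using u(2) s_pos[OF u(2)] by (intro divide_right_mono) (auto simp: cubulation_def)
      finally show ?thesis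
        using s_pos[OF u(1)] s_pos[OF u(2)] by (simp add: field_simps)
    qed
    fix u u' assume u: "u \<in> cubulation \<K>" "u' \<in> cubulation \<K>" "g u = g u'"
    then have "s u = s u'"
      using le[OF u] le[of u' u] by simp
    then show "u = u'"
      using u s_pos[OF u(1)] by (auto simp: g_def fun_eq_iff)
  qed
  moreover have "g ` cubulation \<K> = topspace (realization \<K>)"
  proof (intro subset_antisym subsetI)
    fix t assume "t \<in> g ` cubulation \<K>"
    then obtain u where u: "u \<in> cubulation \<K>" "t = g u"
      by blast
    have supp_eq: "{v. t v \<noteq> 0} = {v. u v \<noteq> 0}"
      using s_pos[OF u(1)] by (simp add: u(2) g_def)
    then have "{v. t v \<noteq> 0} \<in> \<K>"
      using u(1) by (simp add: cubulation_def)
    moreover have "s t = 1"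
      using s_pos[OF u(1)] by (simp add: s_def u(2) g_def flip: sum_divide_distrib)
    moreover have "0 \<le> t v" for v
      using u s_pos[OF u(1)] by (simp add: g_def cubulation_def)
    ultimately show "t \<in> topspace (realization \<K>)"
      using supp[of t] by (simp add: topspace_realization)
  next
    fix t assume t: "t \<in> topspace (realization \<K>)"
    then have tK: "{v. t v \<noteq> 0} \<in> \<K>" and nn: "\<And>v. t v \<ge> 0" and sum: "s t = 1"
      using supp[of t] by (auto simp: topspace_realization)
    have fin: "finite {v. t v \<noteq> 0}" "{v. t v \<noteq> 0} \<noteq> {}"
      using finite_complex_simplex[OF \<K> tK] .
    have "Max (t ` {v. t v \<noteq> 0}) \<in> t ` {v. t v \<noteq> 0}"
      by (rule Max_in) (use fin in \<open>simp_all del: Collect_empty_eq\<close>)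
    then obtain w where w: "t w \<noteq> 0" "t w = Max (t ` {v. t v \<noteq> 0})"
      by auto
    have max: "t v \<le> t w" for v
    proof (cases "t v = 0")
      case False
      then show ?thesis
        unfolding w(2) using fin(1) by (intro Max_ge) auto
    qed (use nn in simp)
    have w_pos: "t w > 0"
      using w(1) nn[of w] by simp
    define u where "u = (\<lambda>v. t v / t w)"
    have "u \<in> cubulation \<K>"
      using tK nn max w_pos by (auto simp: cubulation_def u_def)
    moreover have "s u = 1 / t w"
      using sum by (simp add: s_def u_def flip: sum_divide_distrib)
    then have "t = g u"
      using w_pos by (simp add: g_def u_def fun_eq_iff)
    ultimately show "t \<in> g ` cubulation \<K>"
      by blast
  qed
  ultimately show ?thesis
    using homeomorphism_compact[OF compact_cubulation[OF \<K>]] by blast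
qed

text \<open>The metric of \<open>nat \<Rightarrow> real\<close> weights the coordinates by powers of
  \<open>1 / 2\<close>, whose sum is 2.\<close>

lemma dist_fun_le:
  fixes x y :: "nat \<Rightarrow> real"
  assumes "\<And>v. \<bar>x v - y v\<bar> \<le> \<delta>"
  shows "dist x y \<le> 2 * \<delta>"
proof -
  let ?f = "\<lambda>k. (1 / 2) ^ k * min (dist (x (from_nat k)) (y (from_nat k))) 1"
  have le: "?f k \<le> (1 / 2) ^ k * \<delta>" for k
    using assms[of "from_nat k"] by (intro mult_left_mono) (auto simp: dist_real_def)
  have sums: "(\<lambda>k. (1 / 2 :: real) ^ k * \<delta>) sums (2 * \<delta>)"
    using sums_mult2[OF geometric_sums[of "1 / 2 :: real"], of \<delta>] by simp
  moreover have "summable ?f"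
    by (rule summable_comparison_test'[OF sums_summable[OF sums], of 0]) (use le in \<open>auto simp: abs_mult\<close>)
  ultimately have "suminf ?f \<le> 2 * \<delta>"
    using suminf_le[of ?f, OF le] by (simp add: sums_iff)
  then show ?thesis
    by (simp add: dist_fun_def)
qed

text \<open>A cell of the grid of mesh \<open>1 / N\<close>: \<open>\<beta>\<close> is its lower corner, in units of \<open>1 / N\<close>, and \<open>D\<close> is the set of
  directions in which it extends.\<close>

definition grid_center :: "nat \<Rightarrow> (nat \<Rightarrow> nat) \<times> nat set \<Rightarrow> nat \<Rightarrow> real" where
  "grid_center N = (\<lambda>(\<beta>, D) v. (if v \<in> D then \<beta> v + 1 / 2 else \<beta> v) / N)"

definition grid_cell :: "nat \<Rightarrow> (nat \<Rightarrow> nat) \<times> nat set \<Rightarrow> (nat \<Rightarrow> real) set" where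
  "grid_cell N e = cube (grid_center N e) (1 / (2 * real N)) (snd e)"

definition grid_rim :: "nat \<Rightarrow> (nat \<Rightarrow> nat) \<times> nat set \<Rightarrow> (nat \<Rightarrow> real) set" where
  "grid_rim N e = cube_rim (grid_center N e) (1 / (2 * real N)) (snd e)"

text \<open>For nonnegative \<open>x\<close>, the grid cell that has \<open>x\<close> in its
  relative interior: a coordinate is free to vary unless it is a multiple of
  \<open>1 / N\<close>.\<close>

definition carrier_cell :: "nat \<Rightarrow> (nat \<Rightarrow> real) \<Rightarrow> (nat \<Rightarrow> nat) \<times> nat set" where
  "carrier_cell N x = ((\<lambda>v. nat \<lfloor>N * x v\<rfloor>), {v. N * x v \<notin> \<int>})"

section \<open>Grid cells in integer coordinates\<close>

lemma grid_dist:
  fixes N b :: nat and s :: real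
  assumes "N > 0"
  shows "\<bar>s - (real b + 1 / 2) / N\<bar> \<le> 1 / (2 * real N) \<longleftrightarrow> b \<le> N * s \<and> N * s \<le> real b + 1"
    and "\<bar>s - (real b + 1 / 2) / N\<bar> = 1 / (2 * real N) \<longleftrightarrow> N * s = b \<or> N * s = real b + 1"
proof -
  have "s - (real b + 1 / 2) / N = (N * s - (b + 1 / 2)) / N"
    using assms by (simp add: field_simps)
  then have eq: "\<bar>s - (real b + 1 / 2) / N\<bar> = \<bar>N * s - (b + 1 / 2)\<bar> / N"
    by simp
  have half: "1 / (2 * real N) = (1 / 2) / N"
    by simp
  show "\<bar>s - (real b + 1 / 2) / N\<bar> \<le> 1 / (2 * real N) \<longleftrightarrow> b \<le> N * s \<and> N * s \<le> real b + 1"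
  proof -
    have "\<bar>a\<bar> / N \<le> (1 / 2) / N \<longleftrightarrow> \<bar>a\<bar> \<le> 1 / 2" for a :: real
      by (subst divide_le_cancel) (use assms in simp)
    then show ?thesis
      unfolding eq half by (simp only:) linarith
  qed
  show "\<bar>s - (real b + 1 / 2) / N\<bar> = 1 / (2 * real N) \<longleftrightarrow> N * s = b \<or> N * s = real b + 1"
    unfolding eq half using assms by (subst divide_cancel_right) (auto simp: abs_if)
qed

lemma mem_grid_cell:
  assumes "N > 0"
  shows "s \<in> grid_cell N (\<beta>, D) \<longleftrightarrow>
    (\<forall>v\<in>D. \<beta> v \<le> N * s v \<and> N * s v \<le> real (\<beta> v) + 1) \<and> (\<forall>v. v \<notin> D \<longrightarrow> N * s v = \<beta> v)"
  using assms by (auto simp: grid_cell_def cube_def grid_center_def grid_dist field_simps)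

lemma mem_grid_rim:
  assumes "N > 0"
  shows "s \<in> grid_rim N (\<beta>, D) \<longleftrightarrow> s \<in> grid_cell N (\<beta>, D) \<and> (\<exists>v\<in>D. N * s v = \<beta> v \<or> N * s v = real (\<beta> v) + 1)"
  using assms by (auto simp: grid_rim_def grid_cell_def cube_rim_def grid_center_def grid_dist)

lemma carrier_cell_mem:
  assumes N: "N > 0" and x: "\<And>v. 0 \<le> x v"
  shows "x \<in> grid_cell N (carrier_cell N x)"
proof -
  have fl: "real (nat \<lfloor>N * x v\<rfloor>) = \<lfloor>N * x v\<rfloor>" for v
    using x[of v] by simp
  show ?thesis
  proof -
    have "\<lfloor>N * x v\<rfloor> \<le> N * x v" "N * x v \<le> \<lfloor>N * x v\<rfloor> + 1" for v
      by linarith+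
    moreover have "N * x v = \<lfloor>N * x v\<rfloor>" if "N * x v \<in> \<int>" for v
      using that by (auto simp: Ints_def)
    ultimately show ?thesis
      unfolding carrier_cell_def mem_grid_cell[OF N] fl by simp
  qed
qed

text \<open>The values 0 and 1 are multiples of \<open>1 / N\<close>. Hence the coordinates of
  \<open>x\<close> with these values are frozen on its carrier cell, which keeps the cell in the
  same face of the unit cube, and no other coordinate can leave the unit interval.\<close>

lemma grid_cell_subset:
  assumes N: "N > 0" and \<K>: "finite_complex \<K>" and x: "x \<in> cubulation \<K>"
  shows "grid_cell N (carrier_cell N x) \<subseteq> cubulation \<K>"
proof
  fix s assume s: "s \<in> grid_cell N (carrier_cell N x)"
  have x01: "0 \<le> x v" "x v \<le> 1" for v
    using x by (auto simp: cubulation_def)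
  have fl: "real (nat \<lfloor>N * x v\<rfloor>) = of_int \<lfloor>N * x v\<rfloor>" for v
    using x01(1)[of v] by simp
  have non: "\<lfloor>N * x v\<rfloor> \<le> N * s v \<and> N * s v \<le> \<lfloor>N * x v\<rfloor> + 1" if "N * x v \<notin> \<int>" for v
    using s that unfolding carrier_cell_def mem_grid_cell[OF N] fl by simp
  have int: "s v = x v" if "N * x v \<in> \<int>" for v
  proof -
    have "N * s v = \<lfloor>N * x v\<rfloor>"
      using s that unfolding carrier_cell_def mem_grid_cell[OF N] fl by simp
    also have "\<dots> = N * x v"
      using that by (auto simp: Ints_def)
    finally show ?thesis
      using N by simp
  qed
  have s01: "0 \<le> s v \<and> s v \<le> 1" for v
  proof (cases "N * x v \<in> \<int>")
    case True
    then show ?thesis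
      using int x01[of v] by simp
  next
    case False
    then have "x v \<noteq> 1"
      by auto
    then have "N * x v < N"
      using x01(2)[of v] N by simp
    then have "\<lfloor>N * x v\<rfloor> < int N"
      by (subst floor_less_iff) simp
    then have "\<lfloor>N * x v\<rfloor> + 1 \<le> int N"
      by simp
    then have "N * s v \<le> N * 1"
      using non[OF False] by linarith
    moreover have "0 \<le> N * s v"
    proof -
      have "0 \<le> \<lfloor>N * x v\<rfloor>"
        using x01(1)[of v] by simp
      then show ?thesis
        using non[OF False] by linarith
    qed
    ultimately show ?thesis
      using N by (simp add: zero_le_mult_iff)
  qed
  obtain v where v: "x v = 1"
    using x by (auto simp: cubulation_def)
  then have "s v = 1"
    using int[of v] by simp
  moreover have "{v. s v \<noteq> 0} \<in> \<K>"
  proof (rule finite_complex_face[OF \<K>])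
    show "{v. x v \<noteq> 0} \<in> \<K>"
      using x by (simp add: cubulation_def)
    show "{v. s v \<noteq> 0} \<subseteq> {v. x v \<noteq> 0}"
    proof
      fix v assume "v \<in> {v. s v \<noteq> 0}"
      then show "v \<in> {v. x v \<noteq> 0}"
        using int[of v] by auto
    qed
    have "v \<in> {v. s v \<noteq> 0}"
      using \<open>s v = 1\<close> by simp
    then show "{v. s v \<noteq> 0} \<noteq> {}"
      by blast
  qed
  ultimately show "s \<in> cubulation \<K>"
    using s01 by (auto simp: cubulation_def)
qed

text \<open>Of the at most \<open>n + 1\<close> nonzero coordinates of \<open>x\<close>, one equals
  1 and does not vary; this accounts for the drop to \<open>n\<close>.\<close>

lemma carrier_cell_directions:
  assumes \<K>: "finite_complex \<K>" and x: "x \<in> cubulation \<K>" and le: "\<And>\<sigma>. \<sigma> \<in> \<K> \<Longrightarrow> card \<sigma> \<le> n + 1"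
  shows "finite (snd (carrier_cell N x))" "card (snd (carrier_cell N x)) \<le> n"
proof -
  have supp: "{v. x v \<noteq> 0} \<in> \<K>"
    using x by (simp add: cubulation_def)
  have fin: "finite {v. x v \<noteq> 0}"
    using finite_complex_simplex(1)[OF \<K> supp] .
  obtain v where v: "x v = 1"
    using x by (auto simp: cubulation_def)
  have sub: "snd (carrier_cell N x) \<subseteq> {v. x v \<noteq> 0} - {v}"
  proof
    fix w assume w: "w \<in> snd (carrier_cell N x)"
    have "x w \<noteq> 0 \<and> w \<noteq> v"
      using w v by (auto simp: carrier_cell_def)
    then show "w \<in> {v. x v \<noteq> 0} - {v}"
      by simp
  qed
  then show "finite (snd (carrier_cell N x))"
    using fin by (meson finite_Diff finite_subset)
  have "card ({v. x v \<noteq> 0} - {v}) = card {v. x v \<noteq> 0} - 1"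
    using v fin by (subst card_Diff_singleton) auto
  then show "card (snd (carrier_cell N x)) \<le> n"
    using card_mono[OF finite_Diff[OF fin] sub] le[OF supp] by linarith
qed

lemma finite_carrier_cells:
  assumes \<K>: "finite_complex \<K>"
  shows "finite (carrier_cell N ` cubulation \<K>)"
proof (rule finite_subset)
  have fin: "finite (\<Union>\<K>)"
  proof (rule finite_Union)
    show "finite \<K>"
      using \<K> unfolding finite_complex_def ..
  qed (rule finite_complex_simplex(1)[OF \<K>])
  show "carrier_cell N ` cubulation \<K> \<subseteq>
      {\<beta>. \<forall>v. (v \<in> \<Union>\<K> \<longrightarrow> \<beta> v \<in> {..N}) \<and> (v \<notin> \<Union>\<K> \<longrightarrow> \<beta> v = 0)} \<times> Pow (\<Union>\<K>)"
  proof (rule image_subsetI)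
    fix x assume x: "x \<in> cubulation \<K>"
    have zero: "x v = 0" if "v \<notin> \<Union>\<K>" for v
    proof (rule ccontr)
      assume "x v \<noteq> 0"
      then have "v \<in> {v. x v \<noteq> 0}" by simp
      moreover have "{v. x v \<noteq> 0} \<in> \<K>"
        using x by (simp add: cubulation_def)
      ultimately show False
        using that by blast
    qed
    have "nat \<lfloor>N * x v\<rfloor> \<le> N" for v
    proof -
      have "N * x v \<le> N"
        using x by (simp add: cubulation_def mult_left_le)
      then have "\<lfloor>N * x v\<rfloor> \<le> int N"
        by (simp add: floor_le_iff)
      then show ?thesis by simp
    qed
    moreover have "{v. N * x v \<notin> \<int>} \<subseteq> \<Union>\<K>"
    proof
      fix v assume "v \<in> {v. N * x v \<notin> \<int>}"
      then show "v \<in> \<Union>\<K>"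
        using zero[of v] by (cases "v \<in> \<Union>\<K>") auto
    qed
    ultimately show "carrier_cell N x \<in> {\<beta>. \<forall>v. (v \<in> \<Union>\<K> \<longrightarrow> \<beta> v \<in> {..N}) \<and> (v \<notin> \<Union>\<K> \<longrightarrow> \<beta> v = 0)} \<times> Pow (\<Union>\<K>)"
      using zero by (simp add: carrier_cell_def)
  qed
  show "finite ({\<beta>. \<forall>v. (v \<in> \<Union>\<K> \<longrightarrow> \<beta> v \<in> {..N}) \<and> (v \<notin> \<Union>\<K> \<longrightarrow> \<beta> v = 0)} \<times> Pow (\<Union>\<K>))"
    using fin by (intro finite_cartesian_product finite_set_of_finite_funs) auto
qed

text \<open>A rim point has a multiple of \<open>1 / N\<close> in one of the directions of the cell,
  so its own carrier cell has lost that direction. Thus rims are covered by cells of lower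
  dimension.\<close>

lemma grid_rim_carrier_smaller:
  assumes N: "N > 0" and D: "finite D" and s: "s \<in> grid_rim N (\<beta>, D)"
  shows "card (snd (carrier_cell N s)) < card D"
proof -
  have cell: "s \<in> grid_cell N (\<beta>, D)"
    using s unfolding mem_grid_rim[OF N] ..
  obtain v where v: "v \<in> D" "N * s v = \<beta> v \<or> N * s v = real (\<beta> v) + 1"
    using s unfolding mem_grid_rim[OF N] by blast
  have "N * s v \<in> \<int>"
    using v(2) by (metis Ints_1 Ints_add Ints_of_nat)
  moreover have "N * s w \<in> \<int>" if "w \<notin> D" for w
    using cell that unfolding mem_grid_cell[OF N] by simp
  ultimately have "snd (carrier_cell N s) \<subset> D"
    using v(1) by (auto simp: carrier_cell_def)
  then show ?thesis
    using D by (rule psubset_card_mono[rotated])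
qed

text \<open>Off the rim, the coordinates of \<open>s\<close> in \<open>D\<close> lie strictly
  between consecutive grid values. Another cell through \<open>s\<close> must then extend in all of
  these directions with the same lower corner, and by \<open>card D' \<le> card D\<close> in no
  others, so the two cells coincide.\<close>

lemma grid_cell_Int_subset_rim:
  assumes N: "N > 0" and D': "finite D'" "card D' \<le> card D" and ne: "(\<beta>, D) \<noteq> (\<beta>', D')"
  shows "grid_cell N (\<beta>, D) \<inter> grid_cell N (\<beta>', D') \<subseteq> grid_rim N (\<beta>, D)"
proof
  fix s assume "s \<in> grid_cell N (\<beta>, D) \<inter> grid_cell N (\<beta>', D')"
  then have s: "s \<in> grid_cell N (\<beta>, D)" "s \<in> grid_cell N (\<beta>', D')"
    by auto
  show "s \<in> grid_rim N (\<beta>, D)"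
  proof (rule ccontr)
    assume no: "s \<notin> grid_rim N (\<beta>, D)"
    have open_cell: "\<beta> v < N * s v \<and> N * s v < real (\<beta> v) + 1" if "v \<in> D" for v
    proof -
      have "\<beta> v \<le> N * s v" "N * s v \<le> real (\<beta> v) + 1"
        using s(1) that unfolding mem_grid_cell[OF N] by auto
      moreover have "N * s v \<noteq> \<beta> v" "N * s v \<noteq> real (\<beta> v) + 1"
        using no s(1) that unfolding mem_grid_rim[OF N] by auto
      ultimately show ?thesis
        by simp
    qed
    have both: "v \<in> D' \<and> \<beta>' v = \<beta> v" if v: "v \<in> D" for v
    proof -
      have "v \<in> D'"
      proof (rule ccontr)
        assume "v \<notin> D'"
        then have "N * s v = \<beta>' v"
          using s(2) unfolding mem_grid_cell[OF N] by simp
        then have "real (\<beta> v) < real (\<beta>' v)" "real (\<beta>' v) < real (\<beta> v + 1)"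
          using open_cell[OF v] by simp_all
        then show False
          unfolding of_nat_less_iff by simp
      qed
      then have "\<beta>' v \<le> N * s v" "N * s v \<le> real (\<beta>' v) + 1"
        using s(2) unfolding mem_grid_cell[OF N] by auto
      then have "real (\<beta>' v) < real (\<beta> v + 1)" "real (\<beta> v) < real (\<beta>' v + 1)"
        using open_cell[OF v] by simp_all
      then show ?thesis
        using \<open>v \<in> D'\<close> unfolding of_nat_less_iff by simp
    qed
    then have "D = D'"
      using D' by (intro card_seteq) auto
    moreover have "\<beta> v = \<beta>' v" for v
    proof (cases "v \<in> D")
      case False
      then have "real (\<beta> v) = real (\<beta>' v)"
        using s \<open>D = D'\<close> unfolding mem_grid_cell[OF N] by force
      then show ?thesis by simp
    qed (use both in simp)
    ultimately show False
      using ne by auto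
  qed
qed

section \<open>Homotopic maps with disjoint images\<close>

text \<open>The grid is chosen fine enough, by a Lebesgue number, that every cell lies in an evenly
  covered set and misses one of \<open>A\<close> and \<open>A'\<close>. This makes the cells of the
  grid fit the general deformation argument, with \<open>card (snd e)\<close> as the dimension of
  \<open>e\<close>.\<close>

lemma nullhomotopic_over_cubulation:
  fixes c :: "'c::topological_space \<Rightarrow> nat \<Rightarrow> real" and f g :: "'s::topological_space \<Rightarrow> 'c"
  assumes \<K>: "finite_complex \<K>" and le: "\<And>\<sigma>. \<sigma> \<in> \<K> \<Longrightarrow> card \<sigma> \<le> n + 1" and n: "n \<ge> 1"
    and cov: "covering_space C c (cubulation \<K>)" and "C \<noteq> {}"
    and null: "\<And>k g. \<lbrakk>k < n; continuous_on (Sph k) g; g \<in> Sph k \<rightarrow> C\<rbrakk> \<Longrightarrow>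
      \<exists>a. homotopic_in (Sph k) C g (\<lambda>_. a)"
    and A: "compact A" "compact A'" "A \<inter> A' = {}"
    and fg: "homotopic_in S C f g" "c \<circ> f \<in> S \<rightarrow> A" "c \<circ> g \<in> S \<rightarrow> A'"
  shows "\<exists>a. homotopic_in S C f (\<lambda>_. a)"
proof -
  define Q where "Q = cubulation \<K>"
  have Q: "compact Q"
    unfolding Q_def by (rule compact_cubulation[OF \<K>])
  have c: "continuous_on C c" "c \<in> C \<rightarrow> Q"
    using covering_space_imp_continuous[OF cov] covering_space_imp_surjective[OF cov] by (auto simp: Q_def)
  have "\<exists>X T. open X \<and> b \<in> X \<and> Q \<inter> X \<subseteq> T \<and> evenly_covered C c T \<and> (X \<inter> A = {} \<or> X \<inter> A' = {})" if b: "b \<in> Q" for b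
  proof -
    obtain T where T: "b \<in> T" "openin (top_of_set Q) T" "evenly_covered C c T"
      using cov b unfolding covering_space_def evenly_covered_def Q_def by metis
    then obtain X where X: "open X" "T = Q \<inter> X"
      by (auto simp: openin_open)
    have cl: "closed A" "closed A'"
      using A compact_imp_closed by auto
    \<comment> \<open>By disjointness of \<open>A\<close> and \<open>A'\<close> the closed set
      removed does not contain \<open>b\<close>, and what remains misses that set.\<close>
    define X' where "X' = X - (if b \<in> A then A' else A)"
    have "open X'" "b \<in> X'" "Q \<inter> X' \<subseteq> T" "X' \<inter> A = {} \<or> X' \<inter> A' = {}"
      using X T(1) cl A(3) by (auto simp: X'_def)
    then show ?thesis
      using T(3) by blast
  qed
  then obtain X T where X: "\<And>b. b \<in> Q \<Longrightarrow> open (X b)" "\<And>b. b \<in> Q \<Longrightarrow> b \<in> X b"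
    "\<And>b. b \<in> Q \<Longrightarrow> Q \<inter> X b \<subseteq> T b" "\<And>b. b \<in> Q \<Longrightarrow> evenly_covered C c (T b)"
    "\<And>b. b \<in> Q \<Longrightarrow> X b \<inter> A = {} \<or> X b \<inter> A' = {}"
    by metis
  obtain \<epsilon> where \<epsilon>: "\<epsilon> > 0" "\<And>x. x \<in> Q \<Longrightarrow> \<exists>G\<in>X ` Q. ball x \<epsilon> \<subseteq> G"
  proof (rule Heine_Borel_lemma[OF Q, of "X ` Q"])
    show "Q \<subseteq> \<Union>(X ` Q)"
      using X(2) by blast
    show "\<And>G. G \<in> X ` Q \<Longrightarrow> open G"
      using X(1) by blast
  qed (rule that)
  \<comment> \<open>Points of one cell differ by at most \<open>1 / N\<close> in each coordinate,
    hence by at most \<open>2 / N\<close> in the metric of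
    \<open>nat \<Rightarrow> real\<close>.\<close>
  obtain N :: nat where N: "N > 0" "1 / real N < \<epsilon> / 2"
    using \<epsilon>(1) by (metis half_gt_zero nat_approx_posE of_nat_Suc zero_less_Suc)
  define E where "E = carrier_cell N ` Q"
  have x_cell: "x \<in> grid_cell N (carrier_cell N x)" if "x \<in> Q" for x
    using that by (intro carrier_cell_mem[OF N(1)]) (simp add: Q_def cubulation_def)
  have cell_sub: "grid_cell N e \<subseteq> Q" if "e \<in> E" for e
    using that grid_cell_subset[OF N(1) \<K>] by (auto simp: E_def Q_def)
  have D: "finite (snd e)" "card (snd e) \<le> n" if "e \<in> E" for e
    using that carrier_cell_directions[OF \<K> _ le] by (auto simp: E_def Q_def)
  have small: "\<exists>b\<in>Q. grid_cell N e \<subseteq> X b" if "e \<in> E" for e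
  proof -
    obtain x where x: "x \<in> Q" "e = carrier_cell N x"
      using \<open>e \<in> E\<close> by (auto simp: E_def)
    obtain \<beta> D where e: "e = (\<beta>, D)"
      by (meson surj_pair)
    have "s \<in> ball x \<epsilon>" if s: "s \<in> grid_cell N e" for s
    proof -
      have "\<bar>x v - s v\<bar> \<le> 1 / N" for v
      proof -
        have mem: "s \<in> grid_cell N (\<beta>, D)" "x \<in> grid_cell N (\<beta>, D)"
          using s x_cell[OF x(1)] x(2) e by auto
        have "\<bar>N * x v - N * s v\<bar> \<le> 1"
        proof (cases "v \<in> D")
          case True
          then have "\<beta> v \<le> N * s v" "N * s v \<le> real (\<beta> v) + 1" "\<beta> v \<le> N * x v" "N * x v \<le> real (\<beta> v) + 1"
            using mem unfolding mem_grid_cell[OF N(1)] by auto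
          then show ?thesis by linarith
        next
          case False
          then show ?thesis
            using mem unfolding mem_grid_cell[OF N(1)] by simp
        qed
        moreover have "\<bar>N * x v - N * s v\<bar> = N * \<bar>x v - s v\<bar>"
          by (simp add: abs_mult flip: right_diff_distrib)
        ultimately show ?thesis
          using N(1) by (simp add: field_simps)
      qed
      then have "dist x s \<le> 2 * (1 / N)"
        by (rule dist_fun_le)
      then show ?thesis
        using N(2) by simp
    qed
    moreover obtain b where "b \<in> Q" "ball x \<epsilon> \<subseteq> X b"
      using \<epsilon>(2)[OF x(1)] by blast
    ultimately show ?thesis
      by blast
  qed
  show ?thesis
  proof (rule nullhomotopic_if_homotopic_into_disjoint[of C c Q E "grid_cell N" "\<lambda>e. card (snd e)" n "grid_rim N",
        OF c \<open>C \<noteq> {}\<close> _ _ _ _ _ _ _ _ _ _ _ fg])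
    show "finite E"
      unfolding E_def Q_def by (rule finite_carrier_cells[OF \<K>])
    show "\<Union>(grid_cell N ` E) = Q"
      using x_cell cell_sub by (fastforce simp: E_def)
    show "closedin (top_of_set Q) (grid_cell N e)" if "e \<in> E" for e
    proof -
      have "closed (grid_cell N e)"
      proof -
        have "grid_cell N e = (\<Inter>v\<in>snd e. {s. \<bar>s v - grid_center N e v\<bar> \<le> 1 / (2 * real N)}) \<inter>
            (\<Inter>v\<in>- snd e. {s. s v = grid_center N e v})"
          by (auto simp: grid_cell_def cube_def)
        moreover have "closed {s::nat\<Rightarrow>real. \<bar>s v - grid_center N e v\<bar> \<le> 1 / (2 * real N)}"
          "closed {s::nat\<Rightarrow>real. s v = grid_center N e v}" for v
          by (intro closed_Collect_le closed_Collect_eq continuous_intros continuous_on_product_coordinates)+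
        ultimately show ?thesis
          by (simp only:) (intro closed_Int closed_INT ballI; assumption)
      qed
      then show ?thesis
        using cell_sub[OF that] by (rule closed_subset[rotated])
    qed
    show "\<exists>T. evenly_covered C c T \<and> grid_cell N e \<subseteq> T" if "e \<in> E" for e
    proof -
      obtain b where b: "b \<in> Q" "grid_cell N e \<subseteq> X b"
        using small[OF \<open>e \<in> E\<close>] by blast
      then show ?thesis
        using X(3,4)[OF b(1)] cell_sub[OF \<open>e \<in> E\<close>] by (intro exI[of _ "T b"]) auto
    qed
    show "card (snd e) \<le> n" if "e \<in> E" for e
      by (rule D(2)[OF that])
    show "grid_rim N e \<subseteq> grid_cell N e" if "e \<in> E" for e
      by (auto simp: grid_rim_def grid_cell_def cube_rim_def)
    show "grid_rim N e \<subseteq> \<Union>(grid_cell N ` {e' \<in> E. card (snd e') < card (snd e)})" if "e \<in> E" for e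
    proof
      fix s assume s: "s \<in> grid_rim N e"
      then have "s \<in> Q"
        using cell_sub[OF \<open>e \<in> E\<close>] by (auto simp: grid_rim_def grid_cell_def cube_rim_def)
      moreover have "card (snd (carrier_cell N s)) < card (snd e)"
        using grid_rim_carrier_smaller[OF N(1) D(1)[OF \<open>e \<in> E\<close>], of s "fst e"] s by simp
      ultimately show "s \<in> \<Union>(grid_cell N ` {e' \<in> E. card (snd e') < card (snd e)})"
        using x_cell[of s] by (intro UN_I[of "carrier_cell N s"]) (auto simp: E_def)
    qed
    show "grid_cell N e \<inter> grid_cell N e' \<subseteq> grid_rim N e"
      if "e \<in> E" "e' \<in> E" "e \<noteq> e'" "card (snd e') \<le> card (snd e)" for e e'
      using grid_cell_Int_subset_rim[OF N(1) D(1)[OF that(2)] that(4), of "fst e" "fst e'"] that(3) by simp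
    show "\<exists>F'. continuous_on ({0..1} \<times> grid_cell N e) F' \<and> F' \<in> ({0..1} \<times> grid_cell N e) \<rightarrow> C \<and>
        (\<forall>x\<in>{0,1} \<times> grid_cell N e \<union> {0..1} \<times> grid_rim N e. F' x = F x)"
      if e: "e \<in> E" "card (snd e) < n" and F: "continuous_on ({0,1} \<times> grid_cell N e \<union> {0..1::real} \<times> grid_rim N e) F"
        "F \<in> ({0,1} \<times> grid_cell N e \<union> {0..1} \<times> grid_rim N e) \<rightarrow> C" for e F
    proof -
      obtain G where "continuous_on ({0..1} \<times> grid_cell N e) G" "G \<in> ({0..1} \<times> grid_cell N e) \<rightarrow> C"
        "\<And>x. x \<in> {0,1} \<times> grid_cell N e \<union> {0..1} \<times> grid_rim N e \<Longrightarrow> G x = F x"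
        using extend_over_prism[OF null[OF e(2)] D(1)[OF e(1)] _ F[unfolded grid_cell_def grid_rim_def]] N(1)
        unfolding grid_cell_def grid_rim_def by auto
      then show ?thesis by blast
    qed
    show "\<exists>F'. continuous_on ({0..1} \<times> grid_cell N e) F' \<and> F' \<in> ({0..1} \<times> grid_cell N e) \<rightarrow> C \<and>
        (\<forall>x\<in>{0} \<times> grid_cell N e \<union> {0..1} \<times> grid_rim N e. F' x = F x)"
      if e: "e \<in> E" "card (snd e) = n" and F: "continuous_on ({0} \<times> grid_cell N e \<union> {0..1::real} \<times> grid_rim N e) F"
        "F \<in> ({0} \<times> grid_cell N e \<union> {0..1} \<times> grid_rim N e) \<rightarrow> C" for e F
    proof -
      have "snd e \<noteq> {}"
        using e(2) n by auto
      then obtain G where "continuous_on ({0..1} \<times> grid_cell N e) G" "G \<in> ({0..1} \<times> grid_cell N e) \<rightarrow> C"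
        "\<And>x. x \<in> {0} \<times> grid_cell N e \<union> {0..1} \<times> grid_rim N e \<Longrightarrow> G x = F x"
        using extend_over_open_prism[OF D(1)[OF e(1)] _ _ F[unfolded grid_cell_def grid_rim_def]] N(1)
        unfolding grid_cell_def grid_rim_def by auto
      then show ?thesis by blast
    qed
    show "grid_cell N e \<inter> A = {} \<or> grid_cell N e \<inter> A' = {}" if "e \<in> E" for e
      using small[OF that] X(5) by blast
  qed
qed

section \<open>Transport of coverings and of covering dimension along homeomorphisms\<close>

lemma covering_space_homeomorphism_compose:
  assumes cov: "covering_space C c B" and \<alpha>: "homeomorphism B Q \<alpha> \<alpha>'"
  shows "covering_space C (\<alpha> \<circ> c) Q"
proof
  show "continuous_on C (\<alpha> \<circ> c)"
    using covering_space_imp_continuous[OF cov] covering_space_imp_surjective[OF cov] homeomorphism_cont1[OF \<alpha>]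
    by (intro continuous_on_compose) auto
  show "(\<alpha> \<circ> c) ` C = Q"
    using covering_space_imp_surjective[OF cov] homeomorphism_image1[OF \<alpha>] by (metis image_comp)
  fix x assume x: "x \<in> Q"
  then have "\<alpha>' x \<in> B"
    using homeomorphism_image2[OF \<alpha>] by blast
  then obtain T v where T: "\<alpha>' x \<in> T" "openin (top_of_set B) T" and v: "\<Union>v = C \<inter> c -` T"
    "\<forall>u\<in>v. openin (top_of_set C) u" "pairwise disjnt v" "\<forall>u\<in>v. \<exists>q. homeomorphism u T c q"
    using cov unfolding covering_space_def by metis
  have TB: "T \<subseteq> B"
    using T(2) openin_imp_subset by blast
  have "x \<in> \<alpha> ` T"
    using T(1) homeomorphism_apply2[OF \<alpha> x] by (metis imageI)
  moreover have "openin (top_of_set Q) (\<alpha> ` T)"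
    using homeomorphism_imp_open_map[OF \<alpha> T(2)] .
  moreover have "\<Union>v = C \<inter> (\<alpha> \<circ> c) -` (\<alpha> ` T)"
  proof -
    have "c z \<in> T" if "z \<in> C" "\<alpha> (c z) = \<alpha> s" "s \<in> T" for z s
    proof -
      have "c z \<in> B"
        using that(1) covering_space_imp_surjective[OF cov] by blast
      then have "c z = s"
        using that TB homeomorphism_apply1[OF \<alpha>] by (metis subsetD)
      then show ?thesis
        using that by simp
    qed
    then have "C \<inter> (\<alpha> \<circ> c) -` (\<alpha> ` T) \<subseteq> C \<inter> c -` T"
      by force
    then show ?thesis
      unfolding v(1) by (intro subset_antisym) auto
  qed
  moreover have "\<exists>q. homeomorphism u (\<alpha> ` T) (\<alpha> \<circ> c) q" if "u \<in> v" for u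
  proof -
    from v(4) that obtain q where q: "homeomorphism u T c q"
      by auto
    have "homeomorphism T (\<alpha> ` T) \<alpha> \<alpha>'"
      by (rule homeomorphism_of_subsets[OF \<alpha> TB _ refl]) (use TB homeomorphism_image1[OF \<alpha>] in auto)
    from homeomorphism_compose[OF q this] show ?thesis
      by (rule exI[of _ "q \<circ> \<alpha>'"])
  qed
  ultimately show "\<exists>T. x \<in> T \<and> openin (top_of_set Q) T \<and> (\<exists>v. \<Union>v = C \<inter> (\<alpha> \<circ> c) -` T \<and>
      (\<forall>u\<in>v. openin (top_of_set C) u) \<and> pairwise disjnt v \<and> (\<forall>u\<in>v. \<exists>q. homeomorphism u T (\<alpha> \<circ> c) q))"
    using v(2,3) by (intro exI[of _ "\<alpha> ` T"] conjI exI[of _ v]) auto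
qed

lemma covering_dim_le_homeomorphic_space:
  assumes hom: "X homeomorphic_space Y" and dim: "covering_dim_le X n"
  shows "covering_dim_le Y n"
  unfolding covering_dim_le_def
proof (intro allI impI)
  fix \<U> assume \<U>: "finite \<U> \<and> (\<forall>U\<in>\<U>. openin Y U) \<and> \<Union>\<U> = topspace Y"
  obtain f g where "homeomorphic_maps X Y f g"
    using hom by (auto simp: homeomorphic_space_def)
  then have f: "continuous_map X Y f" and g: "continuous_map Y X g"
    and gf: "\<And>x. x \<in> topspace X \<Longrightarrow> g (f x) = x" and fg: "\<And>y. y \<in> topspace Y \<Longrightarrow> f (g y) = y"
    by (simp_all add: homeomorphic_maps_def)
  have f_open: "open_map X Y f"
    using \<open>homeomorphic_maps X Y f g\<close> by (intro homeomorphic_imp_open_map homeomorphic_maps_imp_map)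
  define \<P> where "\<P> = (\<lambda>U. {x \<in> topspace X. f x \<in> U}) ` \<U>"
  have "finite \<P> \<and> (\<forall>P\<in>\<P>. openin X P) \<and> \<Union>\<P> = topspace X"
  proof (intro conjI)
    show "\<Union>\<P> = topspace X"
      using \<U> continuous_map_funspace[OF f] by (fastforce simp: \<P>_def)
  qed (use \<U> openin_continuous_map_preimage[OF f] in \<open>auto simp: \<P>_def\<close>)
  from dim[unfolded covering_dim_le_def, rule_format, OF this]
  obtain \<V> where \<V>01: "finite \<V>" and \<V>02: "\<forall>V\<in>\<V>. openin X V \<and> (\<exists>P\<in>\<P>. V \<subseteq> P)"
      and \<V>03: "\<Union>\<V> = topspace X" and \<V>04: "\<forall>x\<in>topspace X. card {V \<in> \<V>. x \<in> V} \<le> n + 1"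
    by (elim exE conjE) (rule that)
  have \<V>: "finite \<V>" "\<And>V. V \<in> \<V> \<Longrightarrow> openin X V" "\<And>V. V \<in> \<V> \<Longrightarrow> \<exists>P\<in>\<P>. V \<subseteq> P" "\<Union>\<V> = topspace X"
    "\<And>x. x \<in> topspace X \<Longrightarrow> card {V \<in> \<V>. x \<in> V} \<le> n + 1"
    using \<V>01 bspec[OF \<V>02] \<V>03 bspec[OF \<V>04] by simp_all
  have Vsub: "V \<subseteq> topspace X" if "V \<in> \<V>" for V
    using openin_subset[OF \<V>(2)[OF that]] .
  show "\<exists>\<V>. finite \<V> \<and> (\<forall>V\<in>\<V>. openin Y V \<and> (\<exists>U\<in>\<U>. V \<subseteq> U)) \<and> \<Union>\<V> = topspace Y \<and>
      (\<forall>y\<in>topspace Y. card {V \<in> \<V>. y \<in> V} \<le> n + 1)"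
  proof (intro exI[of _ "(\<lambda>V. f ` V) ` \<V>"] conjI ballI)
    show "finite ((\<lambda>V. f ` V) ` \<V>)"
      using \<V>(1) by simp
  next
    fix W assume "W \<in> (\<lambda>V. f ` V) ` \<V>"
    then obtain V where V: "V \<in> \<V>" "W = f ` V"
      by blast
    show "openin Y W"
      using f_open \<V>(2)[OF V(1)] V(2) by (simp add: open_map_def)
    obtain U where "U \<in> \<U>" "V \<subseteq> {x \<in> topspace X. f x \<in> U}"
      using \<V>(3)[OF V(1)] by (auto simp: \<P>_def)
    then show "\<exists>U\<in>\<U>. W \<subseteq> U"
      using V(2) by (intro bexI[of _ U]) auto
  next
    have "f ` topspace X = topspace Y"
    proof (intro subset_antisym subsetI)
      fix y assume "y \<in> topspace Y"
      then show "y \<in> f ` topspace X"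
        using fg[of y] funcset_mem[OF continuous_map_funspace[OF g], of y] by (intro image_eqI[of _ _ "g y"]) simp_all
    qed (use continuous_map_funspace[OF f] in auto)
    then show "\<Union>((\<lambda>V. f ` V) ` \<V>) = topspace Y"
      by (simp flip: \<V>(4) image_Union)
  next
    fix y assume y: "y \<in> topspace Y"
    have gy: "g y \<in> topspace X"
      using y continuous_map_funspace[OF g] by auto
    have "{W \<in> (\<lambda>V. f ` V) ` \<V>. y \<in> W} \<subseteq> (\<lambda>V. f ` V) ` {V \<in> \<V>. g y \<in> V}"
    proof
      fix W assume "W \<in> {W \<in> (\<lambda>V. f ` V) ` \<V>. y \<in> W}"
      then obtain V x where "V \<in> \<V>" "W = f ` V" "x \<in> V" "y = f x"
        by blast
      moreover have "g y = x"
        using \<open>x \<in> V\<close> \<open>y = f x\<close> Vsub[OF \<open>V \<in> \<V>\<close>] gf by auto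
      ultimately show "W \<in> (\<lambda>V. f ` V) ` {V \<in> \<V>. g y \<in> V}"
        by (intro image_eqI[of _ _ V]) simp_all
    qed
    then have "card {W \<in> (\<lambda>V. f ` V) ` \<V>. y \<in> W} \<le> card {V \<in> \<V>. g y \<in> V}"
      using \<V>(1) by (intro surj_card_le) auto
    then show "card {W \<in> (\<lambda>V. f ` V) ` \<V>. y \<in> W} \<le> n + 1"
      using \<V>(5)[OF gy] by simp
  qed
qed

text \<open>A free null-homotopy extends \<open>f\<close> to the ball. There the sphere can be
  contracted to its base point along straight segments, during which the base point does not
  move.\<close>

lemma free_nullhomotopic_imp_based:
  fixes f :: "(nat \<Rightarrow> real) \<Rightarrow> 'b::topological_space"
  assumes hom: "homotopic_in (Sph n) B f (\<lambda>_. a)"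
  shows "homotopic_with (\<lambda>h. h sphere_base = f sphere_base) (nsphere n) (top_of_set B) f (\<lambda>_. f sphere_base)"
proof -
  define S where "S = Sph n"
  define n2 where "n2 = (\<lambda>y::nat \<Rightarrow> real. sqrt (\<Sum>i\<le>n. (y i)\<^sup>2))"
  define W where "W = {w. (\<Sum>i\<le>n. (w i)\<^sup>2) \<le> (1::real) \<and> (\<forall>i>n. w i = 0)}"
  define \<kappa> where "\<kappa> = (\<lambda>(t::real, y::nat \<Rightarrow> real) i. (1 - t) * y i)"
  have S: "y \<in> S \<longleftrightarrow> n2 y = 1 \<and> (\<forall>i>n. y i = 0)" for y
    by (auto simp: S_def topspace_nsphere n2_def)
  have n2_scale: "n2 (\<lambda>i. r * y i) = \<bar>r\<bar> * n2 y" for r y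
    by (simp add: n2_def power_mult_distrib real_sqrt_mult flip: sum_distrib_left)
  have base: "sphere_base \<in> S"
    using in_topspace_nsphere by (simp add: sphere_base_def S_def)
  from homotopic_with_canon_imp[OF hom]
  obtain H where "continuous_on ({0..1::real} \<times> S) H \<and> H \<in> ({0..1} \<times> S) \<rightarrow> B \<and>
    (\<forall>y. H (0, y) = f y) \<and> (\<forall>y. H (1, y) = a)"
    unfolding S_def ..
  then have H: "continuous_on ({0..1} \<times> S) H" "H \<in> ({0..1} \<times> S) \<rightarrow> B" "\<And>y. H (0, y) = f y" "\<And>y. H (1, y) = a"
    by simp_all
  have cont_kappa: "continuous_on ({0..1} \<times> S) \<kappa>"
  proof (rule continuous_on_coordinatewise_then_product)
    fix i
    have "continuous_on ({0..1} \<times> S) (\<lambda>z. (1 - fst z) * snd z i)"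
      by (intro continuous_on_mult continuous_on_diff continuous_on_const continuous_on_fst continuous_on_id
          continuous_on_coordinate[OF continuous_on_snd[OF continuous_on_id]])
    then show "continuous_on ({0..1} \<times> S) (\<lambda>z. \<kappa> z i)"
      by (simp add: \<kappa>_def case_prod_beta)
  qed
  have compat: "H z = H z'" if z: "z \<in> {0..1} \<times> S" "z' \<in> {0..1} \<times> S" "\<kappa> z = \<kappa> z'" for z z'
  proof -
    obtain t y t' y' where [simp]: "z = (t, y)" "z' = (t', y')"
      by (meson surj_pair)
    have y: "n2 y = 1" "n2 y' = 1" "t \<le> 1" "t' \<le> 1"
      using z S[of y] S[of y'] by simp_all
    have eq: "(\<lambda>i. (1 - t) * y i) = (\<lambda>i. (1 - t') * y' i)"
      using z(3) by (simp add: \<kappa>_def)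
    have t: "t' = t"
      using arg_cong[OF eq, of n2] y by (simp add: n2_scale)
    show ?thesis
    proof (cases "t = 1")
      case True
      then show ?thesis
        using t H(4) by simp
    next
      case False
      have "y = y'"
      proof
        show "y i = y' i" for i
          using fun_cong[OF eq, of i] t False by simp
      qed
      then show ?thesis
        using t by simp
    qed
  qed
  obtain G where G: "continuous_on (\<kappa> ` ({0..1} \<times> S)) G" "\<And>z. z \<in> {0..1} \<times> S \<Longrightarrow> G (\<kappa> z) = H z"
    by (rule continuous_on_compact_quotient[OF compact_Times[OF compact_Icc] cont_kappa H(1)],
        simp add: S_def compact_topspace_nsphere, erule (2) compat, rule that)
  have rep: "\<exists>z\<in>{0..1} \<times> S. w = \<kappa> z" if w: "w \<in> W" for w
  proof (cases "n2 w = 0")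
    case True
    then have "w i = 0" for i
      using w by (cases "i \<le> n") (auto simp: n2_def W_def sum_nonneg_eq_0_iff)
    then have "w = \<kappa> (1, sphere_base)"
      by (auto simp: \<kappa>_def)
    then show ?thesis
      using base by (intro bexI[of _ "(1, sphere_base)"]) auto
  next
    case False
    then have pos: "n2 w > 0"
      by (simp add: n2_def sum_nonneg less_le)
    have "n2 w \<le> 1"
      using w by (simp add: n2_def W_def)
    moreover have "(\<lambda>i. (1 / n2 w) * w i) \<in> S"
      using w pos n2_scale[of "1 / n2 w" w] by (simp add: S W_def)
    moreover have "w = \<kappa> (1 - n2 w, \<lambda>i. (1 / n2 w) * w i)"
      using pos by (simp add: \<kappa>_def)
    ultimately show ?thesis
      using pos by (intro bexI[of _ "(1 - n2 w, \<lambda>i. (1 / n2 w) * w i)"]) auto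
  qed
  have W_sub: "W \<subseteq> \<kappa> ` ({0..1} \<times> S)"
    using rep by (intro subsetI) (simp only: image_iff)
  have G_B: "G w \<in> B" if "w \<in> W" for w
  proof -
    from rep[OF that] obtain z where "z \<in> {0..1} \<times> S" "w = \<kappa> z" ..
    then show ?thesis
      using G(2) funcset_mem[OF H(2)] by simp
  qed
  have G_f: "G y = f y" if "y \<in> S" for y
    using G(2)[of "(0, y)"] that H(3) by (simp add: \<kappa>_def)
  define L where "L = (\<lambda>(t::real, y::nat\<Rightarrow>real) i. (1 - t) * y i + t * sphere_base i)"
  have L_W: "L (t, y) \<in> W" if t: "t \<in> {0..1}" and y: "y \<in> S" for t y
  proof -
    \<comment> \<open>Convexity of squaring, summed over the coordinates, gives convexity of the
      ball.\<close>
    have sq: "((1 - t) * r + t * s)\<^sup>2 \<le> (1 - t) * r\<^sup>2 + t * s\<^sup>2" for r s :: real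
    proof -
      have "(1 - t) * r\<^sup>2 + t * s\<^sup>2 - ((1 - t) * r + t * s)\<^sup>2 = (t * (1 - t)) * (r - s)\<^sup>2"
        by (simp add: power2_eq_square algebra_simps)
      moreover have "0 \<le> (t * (1 - t)) * (r - s)\<^sup>2"
        using t by simp
      ultimately show ?thesis by linarith
    qed
    have "(\<Sum>i\<le>n. (L (t, y) i)\<^sup>2) \<le> (\<Sum>i\<le>n. (1 - t) * (y i)\<^sup>2 + t * (sphere_base i)\<^sup>2)"
      unfolding L_def prod.case by (intro sum_mono sq)
    also have "\<dots> = (1 - t) * (\<Sum>i\<le>n. (y i)\<^sup>2) + t * (\<Sum>i\<le>n. (sphere_base i)\<^sup>2)"
      by (simp add: sum.distrib sum_distrib_left)
    also have "\<dots> = 1"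
      using y base by (simp add: S_def topspace_nsphere)
    finally have "(\<Sum>i\<le>n. (L (t, y) i)\<^sup>2) \<le> 1" .
    moreover have "L (t, y) i = 0" if "i > n" for i
      using that y base by (simp add: S_def topspace_nsphere L_def)
    ultimately show ?thesis
      by (simp add: W_def)
  qed
  have L_cont: "continuous_on ({0..1} \<times> S) L"
  proof (rule continuous_on_coordinatewise_then_product)
    fix i
    have "continuous_on ({0..1} \<times> S) (\<lambda>z. (1 - fst z) * snd z i + fst z * sphere_base i)"
      by (intro continuous_on_add continuous_on_mult continuous_on_diff continuous_on_const continuous_on_fst continuous_on_id
          continuous_on_coordinate[OF continuous_on_snd[OF continuous_on_id]])
    then show "continuous_on ({0..1} \<times> S) (\<lambda>z. L z i)"
      by (simp add: L_def case_prod_beta)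
  qed
  have "continuous_on ({0..1} \<times> S) (\<lambda>z. G (L z))"
    by (rule continuous_on_compose2[OF continuous_on_subset[OF G(1) W_sub] L_cont]) (use L_W in auto)
  moreover have "(\<lambda>z. G (L z)) \<in> ({0..1} \<times> S) \<rightarrow> B"
    using G_B L_W by auto
  moreover have Lb: "L (t, sphere_base) = sphere_base" for t
    by (simp add: L_def fun_eq_iff algebra_simps)
  moreover have "L (0, y) = y" "L (1, y) = sphere_base" for y
    by (simp_all add: L_def)
  ultimately have "homotopic_with (\<lambda>h. h sphere_base = f sphere_base) (top_of_set S) (top_of_set B) G (\<lambda>_. f sphere_base)"
    unfolding homotopic_with_def using G_f[OF base]
    by (intro exI[of _ "\<lambda>z. G (L z)"]) (simp add: image_subset_iff_funcset)
  then have "homotopic_with (\<lambda>h. h sphere_base = f sphere_base) (top_of_set S) (top_of_set B) f (\<lambda>_. f sphere_base)"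
    by (rule homotopic_with_eq) (use G_f base in auto)
  then show ?thesis
    unfolding S_def by (subst euclidean_nsphere)
qed

text \<open>Disjointness is assumed downstairs, the homotopy upstairs. The covering is left
  arbitrary so that the identity of \<open>B\<close> can take the place of the universal
  cover.\<close>

lemma nullhomotopic_via_covering:
  fixes c :: "'c::topological_space \<Rightarrow> 'b::topological_space" and f g :: "'s::topological_space \<Rightarrow> 'c"
  assumes \<K>: "finite_complex \<K>" and le: "\<And>\<sigma>. \<sigma> \<in> \<K> \<Longrightarrow> card \<sigma> \<le> n + 1" and n: "n \<ge> 1"
    and \<alpha>: "homeomorphism B (cubulation \<K>) \<alpha> \<alpha>'"
    and cov: "covering_space C c B" and C: "C \<noteq> {}"
    and null: "\<And>k g. \<lbrakk>k < n; continuous_on (Sph k) g; g \<in> Sph k \<rightarrow> C\<rbrakk> \<Longrightarrow>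
      \<exists>a. homotopic_in (Sph k) C g (\<lambda>_. a)"
    and S: "compact S" and hom: "homotopic_in S C f g"
    and disj: "(\<lambda>x. c (f x)) ` S \<inter> (\<lambda>x. c (g x)) ` S = {}"
  shows "\<exists>a. homotopic_in S B (\<lambda>x. c (f x)) (\<lambda>_. a)"
proof -
  have c: "continuous_on C c" "c ` C = B"
    using covering_space_imp_continuous[OF cov] covering_space_imp_surjective[OF cov] .
  have fg: "continuous_on S f" "continuous_on S g" "f \<in> S \<rightarrow> C" "g \<in> S \<rightarrow> C"
    using homotopic_with_imp_continuous[OF hom] homotopic_with_imp_funspace1[OF hom] homotopic_with_imp_funspace2[OF hom] by auto
  have cov': "covering_space C (\<alpha> \<circ> c) (cubulation \<K>)"
    by (rule covering_space_homeomorphism_compose[OF cov \<alpha>])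
  have compact_image: "compact ((\<lambda>x. (\<alpha> \<circ> c) (h x)) ` S)" if "continuous_on S h" "h \<in> S \<rightarrow> C" for h
    using that by (intro compact_continuous_image S continuous_on_compose2[OF covering_space_imp_continuous[OF cov']]) auto
  have "(\<lambda>x. (\<alpha> \<circ> c) (f x)) ` S \<inter> (\<lambda>x. (\<alpha> \<circ> c) (g x)) ` S = {}"
  proof (rule ccontr)
    assume "(\<lambda>x. (\<alpha> \<circ> c) (f x)) ` S \<inter> (\<lambda>x. (\<alpha> \<circ> c) (g x)) ` S \<noteq> {}"
    then obtain x y where xy: "x \<in> S" "y \<in> S" "\<alpha> (c (f x)) = \<alpha> (c (g y))"
      by auto
    have "c (f x) \<in> B" "c (g y) \<in> B"
      using xy fg c(2) by auto
    then have "c (f x) = c (g y)"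
      using homeomorphism_apply1[OF \<alpha>] xy(3) by metis
    then show False
      using disj xy by auto
  qed
  from nullhomotopic_over_cubulation[OF \<K> le n cov' C null compact_image[OF fg(1,3)] compact_image[OF fg(2,4)] this hom]
  obtain a where "homotopic_in S C f (\<lambda>_. a)"
    by auto
  then have "homotopic_in S B (c \<circ> f) (c \<circ> (\<lambda>_. a))"
    by (rule homotopic_with_compose_continuous_left) (use c in auto)
  then show ?thesis
    by (auto simp: o_def)
qed

lemma nullhomotopic_in_polyhedron:
  fixes B :: "'b::topological_space set" and C :: "'c::topological_space set"
  assumes n: "n \<ge> 1" and B: "compact_polyhedron (top_of_set B)" "has_covering_dim (top_of_set B) n"
    and C: "universal_cover C c B" "k_connected (n - 1) (top_of_set C)"
    and hom: "homotopic_in (Sph n) B f g"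
    and disj: "f ` Sph n \<inter> g ` Sph n = {}"
  shows "\<exists>a. homotopic_in (Sph n) B f (\<lambda>_. a)"
proof -
  define S where "S = Sph n"
  have S: "compact S"
    by (simp add: S_def compact_topspace_nsphere)
  obtain \<K> where \<K>: "finite_complex \<K>" "top_of_set B homeomorphic_space realization \<K>"
    using B(1) by (auto simp: compact_polyhedron_def)
  have "covering_dim_le (realization \<K>) n"
    using covering_dim_le_homeomorphic_space[OF \<K>(2)] B(2) by (simp add: has_covering_dim_def)
  then have le: "card \<sigma> \<le> n + 1" if "\<sigma> \<in> \<K>" for \<sigma>
    using card_simplex_le_covering_dim[OF \<K>(1) _ that] by blast
  obtain \<alpha> \<alpha>' where \<alpha>: "homeomorphism B (cubulation \<K>) \<alpha> \<alpha>'"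
  proof -
    obtain u v where "homeomorphic_maps (top_of_set B) (realization \<K>) u v"
      using \<K>(2) unfolding homeomorphic_space_def by blast
    then have "homeomorphic_maps (top_of_set B) (top_of_set (topspace (realization \<K>))) u v"
      using euclidean_realization[of \<K>] by simp
    then have uv: "homeomorphism B (topspace (realization \<K>)) u v"
      unfolding homeomorphic_maps_def by (intro homeomorphismI) (simp_all add: image_subset_iff_funcset)
    obtain u' v' where "homeomorphism (cubulation \<K>) (topspace (realization \<K>)) u' v'"
      using homeomorphism_cubulation[OF \<K>(1)] by auto
    then have "homeomorphism (topspace (realization \<K>)) (cubulation \<K>) v' u'"
      by (rule homeomorphism_symD)
    from homeomorphism_compose[OF uv this] show thesis
      by (rule that)
  qed
  have cov: "covering_space C c B"
    using C(1) by (simp add: universal_cover_def)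
  have "C \<noteq> {}" "path_connected C"
    using C(2) by (auto simp: k_connected_def)
  have fB: "continuous_on S f" "f \<in> S \<rightarrow> B"
    using homotopic_with_imp_continuous[OF hom] homotopic_with_imp_funspace1[OF hom] by (auto simp: S_def)
  show ?thesis
  proof (cases "n = 1")
    case True
    \<comment> \<open>A loop need not lift to a closed loop in the universal cover. But for
      \<open>n = 1\<close> the covering only has to be path-connected, which \<open>B\<close> is as
      an image of \<open>C\<close>, so the identity covering suffices.\<close>
    have "B = c ` C"
      using covering_space_imp_surjective[OF cov] by simp
    then have "B \<noteq> {}" "path_connected B"
      using \<open>C \<noteq> {}\<close> path_connected_continuous_image[OF covering_space_imp_continuous[OF cov] \<open>path_connected C\<close>] by auto
    then have B0: "k_connected (n - 1) (top_of_set B)"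
      by (simp add: k_connected_def True)
    have "homeomorphism B B id id"
      by (simp add: homeomorphism_def)
    then have "covering_space B id B"
      by (rule homeomorphism_imp_covering_space)
    from nullhomotopic_via_covering[OF \<K>(1) le n \<alpha> this \<open>B \<noteq> {}\<close> k_connected_imp_nullhomotopic[OF B0] S hom[folded S_def]] disj
    show ?thesis
      by (simp add: S_def)
  next
    case False
    define m where "m = n - 2"
    have "n = Suc (Suc m)"
      using n False by (simp add: m_def)
    then have S_m: "S = Sph (Suc (Suc m))"
      by (simp add: S_def)
    from homotopic_with_canon_imp[OF hom]
    obtain H where "continuous_on ({0..1::real} \<times> S) H \<and> H \<in> ({0..1} \<times> S) \<rightarrow> B \<and>
      (\<forall>y. H (0, y) = f y) \<and> (\<forall>y. H (1, y) = g y)"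
      unfolding S_def ..
    then have H: "continuous_on ({0..1} \<times> S) H" "H \<in> ({0..1} \<times> S) \<rightarrow> B" "\<And>y. H (0, y) = f y" "\<And>y. H (1, y) = g y"
      by simp_all
    obtain F where F: "continuous_on S F" "F \<in> S \<rightarrow> C" "\<And>x. x \<in> S \<Longrightarrow> c (F x) = f x"
      by (rule covering_lift_sphere[OF cov fB[unfolded S_m], folded S_m]) (rule that)
    have HF: "H (0, y) = c (F y)" if "y \<in> S" for y
      using H(3) F(3)[OF that] by simp
    \<comment> \<open>Only \<open>f\<close> is lifted by itself; the far end of the lifted homotopy
      is then a lift of \<open>g\<close>.\<close>
    obtain K where K: "continuous_on ({0..1} \<times> S) K" "K \<in> ({0..1} \<times> S) \<rightarrow> C"
      "\<And>y. y \<in> S \<Longrightarrow> K (0, y) = F y" "\<And>z. z \<in> {0..1} \<times> S \<Longrightarrow> c (K z) = H z"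
      by (rule covering_lift_homotopy[OF cov S H(1,2) F(1,2)], erule HF, rule that)
    have FK: "homotopic_in S C (\<lambda>y. K (0, y)) (\<lambda>y. K (1, y))"
      unfolding homotopic_with_def using K(1,2) by (intro exI[of _ K]) (simp add: image_subset_iff_funcset)
    have eq: "c (K (0, y)) = f y" "c (K (1, y)) = g y" if "y \<in> S" for y
      using K(4)[of "(0, y)"] K(4)[of "(1, y)"] H(3,4) that by simp_all
    then have "(\<lambda>y. c (K (0, y))) ` S \<inter> (\<lambda>y. c (K (1, y))) ` S = {}"
      using disj by (simp add: S_def)
    from nullhomotopic_via_covering[OF \<K>(1) le n \<alpha> cov \<open>C \<noteq> {}\<close> k_connected_imp_nullhomotopic[OF C(2)] S FK this]
    obtain a where "homotopic_in S B (\<lambda>y. c (K (0, y))) (\<lambda>_. a)"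
      by auto
    then have "homotopic_in S B f (\<lambda>_. a)"
      by (rule homotopic_with_eq) (use eq in auto)
    then show ?thesis
      by (auto simp: S_def)
  qed
qed

section \<open>Inverse limits and rigidity\<close>

lemma continuous_map_earring_incl: "continuous_map (nsphere n) (earring n) (earring_incl j)"
  unfolding continuous_map_def
proof (intro conjI allI impI)
  show "earring_incl j \<in> Sph n \<rightarrow> topspace (earring n)"
    unfolding topspace_earring by blast
  show "openin (nsphere n) {x \<in> Sph n. earring_incl j x \<in> U}" if "openin (earring n) U" for U
    using that unfolding openin_earring earring_open_def by blast
qed

lemma wedge_point_in_earring: "wedge_point \<in> topspace (earring n)"
proof -
  have "sphere_base \<in> Sph n"
    using in_topspace_nsphere by (simp add: sphere_base_def)
  then have "earring_incl 0 sphere_base \<in> topspace (earring n)"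
    unfolding topspace_earring by blast
  then show ?thesis
    by (simp add: earring_incl_def)
qed

text \<open>Here the shrinking topology enters: the preimage of \<open>U\<close> is a neighbourhood
  of the wedge point, so it contains all but finitely many spheres.\<close>

lemma finite_spheres_outside_neighbourhood:
  assumes f: "continuous_map (earring n) Y f" and U: "openin Y U" "f wedge_point \<in> U"
  shows "finite {j. \<not> f ` earring_incl j ` Sph n \<subseteq> U}"
proof -
  define W where "W = {a \<in> topspace (earring n). f a \<in> U}"
  have "earring_open n W"
    using openin_continuous_map_preimage[OF f U(1)] by (simp add: W_def openin_earring)
  moreover have "wedge_point \<in> W"
    using U(2) wedge_point_in_earring by (simp add: W_def)
  ultimately have "finite {j. \<not> earring_incl j ` Sph n \<subseteq> W}"
    by (simp add: earring_open_def)
  moreover have "{j. \<not> f ` earring_incl j ` Sph n \<subseteq> U} \<subseteq> {j. \<not> earring_incl j ` Sph n \<subseteq> W}"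
    by (auto simp: W_def)
  ultimately show ?thesis
    by (rule rev_finite_subset)
qed

section \<open>Based homotopy classes and induced maps\<close>

lemma homotopy_class_eq:
  assumes "homotopic_with (\<lambda>h. h sphere_base = x) (nsphere n) X f g"
  shows "homotopy_class n X x f = homotopy_class n X x g"
  unfolding homotopy_class_def using assms homotopic_with_trans homotopic_with_symD by blast

text \<open>Representatives of one class stay homotopic after composition with \<open>q\<close>, so
  the union that defines \<open>induced_class\<close> is a union of equal sets.\<close>

lemma induced_class_homotopy_class:
  assumes q: "continuous_map X Y q" and f: "continuous_map (nsphere n) X f" "f sphere_base = x"
  shows "induced_class n Y (q x) q (homotopy_class n X x f) = homotopy_class n Y (q x) (q \<circ> f)"
proof -
  have "homotopy_class n Y (q x) (q \<circ> g) = homotopy_class n Y (q x) (q \<circ> f)" if "g \<in> homotopy_class n X x f" for g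
  proof -
    have "homotopic_with (\<lambda>h. h sphere_base = x) (nsphere n) X f g"
      using that by (simp add: homotopy_class_def)
    then have "homotopic_with (\<lambda>h. h sphere_base = q x) (nsphere n) Y (q \<circ> f) (q \<circ> g)"
      using q by (rule homotopic_with_compose_continuous_map_left) simp
    then show ?thesis
      using homotopy_class_eq by metis
  qed
  moreover have "f \<in> homotopy_class n X x f"
    using f by (simp add: homotopy_class_def)
  ultimately show ?thesis
    unfolding induced_class_def by blast
qed

section \<open>Inverse limits and shape injectivity\<close>

lemma inverse_limit_continuous:
  assumes "is_inverse_limit X K p q"
  shows "continuous_map X (K i) (q i)" "x \<in> topspace X \<Longrightarrow> p i (q (Suc i) x) = q i x"
proof -
  have "continuous_map X (subtopology (product_topology K UNIV) {y. \<forall>i. p i (y (Suc i)) = y i}) (\<lambda>x i. q i x)"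
    using assms unfolding is_inverse_limit_def by (auto intro: homeomorphic_imp_continuous_map)
  then have "continuous_map X (product_topology K UNIV) (\<lambda>x i. q i x)"
      "(\<lambda>x i. q i x) \<in> topspace X \<rightarrow> {y. \<forall>i. p i (y (Suc i)) = y i}"
    by (simp_all add: continuous_map_in_subtopology image_subset_iff_funcset)
  then show "continuous_map X (K i) (q i)" "x \<in> topspace X \<Longrightarrow> p i (q (Suc i) x) = q i x"
    by (auto simp: continuous_map_componentwise_UNIV)
qed

text \<open>Shape injectivity speaks of polyhedra on the type \<open>nat \<Rightarrow> real\<close>,
  while the given ones live on another type; this exchanges them for realizations of complexes.
  Continuity of the inverse is again that of a continuous bijection from a compact to a Hausdorff
  space.\<close>

lemma inverse_limit_homeomorphic:
  assumes lim: "is_inverse_limit X K p q" and X: "compact_space X"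
    and ab: "\<And>i. homeomorphic_maps (K i) (K' i) (a i) (b i)" and K': "\<And>i. Hausdorff_space (K' i)"
  shows "is_inverse_limit X K' (\<lambda>i. a i \<circ> p i \<circ> b (Suc i)) (\<lambda>i. a i \<circ> q i)"
proof -
  have a: "continuous_map (K i) (K' i) (a i)" and b: "continuous_map (K' i) (K i) (b i)"
    and ba: "\<And>x. x \<in> topspace (K i) \<Longrightarrow> b i (a i x) = x" and ab': "\<And>y. y \<in> topspace (K' i) \<Longrightarrow> a i (b i y) = y" for i
    using ab[of i] by (simp_all add: homeomorphic_maps_def)
  have p: "continuous_map (K (Suc i)) (K i) (p i)" for i
    using lim by (simp add: is_inverse_limit_def)
  note q = inverse_limit_continuous[OF lim]
  have qK: "q i x \<in> topspace (K i)" if "x \<in> topspace X" for i x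
    using funcset_mem[OF continuous_map_funspace[OF q(1)] that] .
  let ?L = "{y. \<forall>i. p i (y (Suc i)) = y i}"
  let ?L' = "{y. \<forall>i. (a i \<circ> p i \<circ> b (Suc i)) (y (Suc i)) = y i}"
  have hom: "homeomorphic_map X (subtopology (product_topology K UNIV) ?L) (\<lambda>x i. q i x)"
    using lim by (simp add: is_inverse_limit_def)
  have "homeomorphic_map X (subtopology (product_topology K' UNIV) ?L') (\<lambda>x i. (a i \<circ> q i) x)"
  proof (rule continuous_imp_homeomorphic_map[OF _ X])
    show "Hausdorff_space (subtopology (product_topology K' UNIV) ?L')"
      using K' by (intro Hausdorff_space_subtopology) (simp add: Hausdorff_space_product_topology)
    show "continuous_map X (subtopology (product_topology K' UNIV) ?L') (\<lambda>x i. (a i \<circ> q i) x)"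
      unfolding continuous_map_in_subtopology
    proof
      show "continuous_map X (product_topology K' UNIV) (\<lambda>x i. (a i \<circ> q i) x)"
        unfolding continuous_map_componentwise_UNIV using continuous_map_compose[OF q(1) a] by (simp add: o_def)
      show "(\<lambda>x i. (a i \<circ> q i) x) \<in> topspace X \<rightarrow> ?L'"
        using qK ba q(2) by simp
    qed
    show "(\<lambda>x i. (a i \<circ> q i) x) ` topspace X = topspace (subtopology (product_topology K' UNIV) ?L')"
    proof (intro subset_antisym image_subsetI subsetI)
      fix x assume x: "x \<in> topspace X"
      then show "(\<lambda>i. (a i \<circ> q i) x) \<in> topspace (subtopology (product_topology K' UNIV) ?L')"
        using qK[OF x] ba q(2)[OF x] funcset_mem[OF continuous_map_funspace[OF a]] by (simp add: PiE_iff)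
    next
      fix y assume "y \<in> topspace (subtopology (product_topology K' UNIV) ?L')"
      then have yK: "\<And>i. y i \<in> topspace (K' i)" and yL: "\<And>i. a i (p i (b (Suc i) (y (Suc i)))) = y i"
        by (auto simp: PiE_iff)
      have bK: "b i (y i) \<in> topspace (K i)" for i
        using funcset_mem[OF continuous_map_funspace[OF b] yK] .
      have "p i (b (Suc i) (y (Suc i))) = b i (y i)" for i
        using ba[OF funcset_mem[OF continuous_map_funspace[OF p] bK]] yL by metis
      then have "(\<lambda>i. b i (y i)) \<in> topspace (subtopology (product_topology K UNIV) ?L)"
        using bK by (simp add: PiE_iff)
      then have "(\<lambda>i. b i (y i)) \<in> (\<lambda>x i. q i x) ` topspace X"
        using homeomorphic_imp_surjective_map[OF hom] by simp
      then obtain x where x: "x \<in> topspace X" "(\<lambda>i. b i (y i)) = (\<lambda>i. q i x)"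
        by auto
      have "y = (\<lambda>i. (a i \<circ> q i) x)"
      proof
        show "y i = (a i \<circ> q i) x" for i
          using fun_cong[OF x(2), of i] ab'[OF yK[of i]] by simp
      qed
      then show "y \<in> (\<lambda>x i. (a i \<circ> q i) x) ` topspace X"
        using x(1) by (rule image_eqI)
    qed
    show "inj_on (\<lambda>x i. (a i \<circ> q i) x) (topspace X)"
    proof (rule inj_onI)
      fix x y assume xy: "x \<in> topspace X" "y \<in> topspace X" "(\<lambda>i. (a i \<circ> q i) x) = (\<lambda>i. (a i \<circ> q i) y)"
      have "q i x = q i y" for i
      proof -
        have "b i (a i (q i x)) = b i (a i (q i y))"
          using fun_cong[OF xy(3), of i] by simp
        then show ?thesis
          using ba[OF qK[OF xy(1)]] ba[OF qK[OF xy(2)]] by simp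
      qed
      then have "(\<lambda>i. q i x) = (\<lambda>i. q i y)"
        by (rule ext)
      from inj_onD[OF homeomorphic_imp_injective_map[OF hom] this xy(1,2)] show "x = y" .
    qed
  qed
  moreover have "continuous_map (K' (Suc i)) (K' i) (a i \<circ> p i \<circ> b (Suc i))" for i
    using continuous_map_compose[OF continuous_map_compose[OF b p] a] by (simp add: o_assoc)
  ultimately show ?thesis
    by (simp add: is_inverse_limit_def)
qed

text \<open>The classes of \<open>f\<close> and of the constant map at its base point value have the
  same image under \<open>shape_map\<close>. Since these are based classes, the null-homotopies in
  the \<open>K i\<close> must be based; the conclusion is free, to match
  \<open>essential\<close>.\<close>

lemma shape_injective_imp_nullhomotopic:
  fixes K :: "nat \<Rightarrow> (nat \<Rightarrow> real) topology"
  assumes inj: "pi_shape_injective n X" and K: "\<And>i. compact_polyhedron (K i)" "is_inverse_limit X K p q"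
    and f: "continuous_map (nsphere n) X f"
    and null: "\<And>i. homotopic_with (\<lambda>h. h sphere_base = q i (f sphere_base)) (nsphere n) (K i) (q i \<circ> f) (\<lambda>_. q i (f sphere_base))"
  shows "homotopic_with (\<lambda>_. True) (nsphere n) X f (\<lambda>_. f sphere_base)"
proof -
  define x where "x = f sphere_base"
  have base: "sphere_base \<in> Sph n"
    using in_topspace_nsphere by (simp add: sphere_base_def)
  have x: "x \<in> topspace X"
    using funcset_mem[OF continuous_map_funspace[OF f] base] by (simp add: x_def)
  have const: "continuous_map (nsphere n) X (\<lambda>_. x)"
    using x by simp
  have shape: "shape_map n K q x (homotopy_class n X x f) = shape_map n K q x (homotopy_class n X x (\<lambda>_. x))"
    unfolding shape_map_def
  proof
    fix i
    have "homotopy_class n (K i) (q i x) (q i \<circ> f) = homotopy_class n (K i) (q i x) (q i \<circ> (\<lambda>_. x))"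
      using homotopy_class_eq[OF null[of i]] by (simp add: x_def o_def)
    then show "induced_class n (K i) (q i x) (q i) (homotopy_class n X x f)
        = induced_class n (K i) (q i x) (q i) (homotopy_class n X x (\<lambda>_. x))"
      using induced_class_homotopy_class[OF inverse_limit_continuous(1)[OF K(2)] f x_def[symmetric]]
        induced_class_homotopy_class[OF inverse_limit_continuous(1)[OF K(2)] const refl] by simp
  qed
  have "inj_on (shape_map n K q x) (homotopy_classes n X x)"
    using inj K x unfolding pi_shape_injective_def by blast
  moreover have "homotopy_class n X x f \<in> homotopy_classes n X x" "homotopy_class n X x (\<lambda>_. x) \<in> homotopy_classes n X x"
    unfolding homotopy_classes_def using f const x_def by blast+
  ultimately have "homotopy_class n X x f = homotopy_class n X x (\<lambda>_. x)"
    using shape by (simp add: inj_on_eq_iff)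
  moreover have "f \<in> homotopy_class n X x f"
    using f by (simp add: homotopy_class_def x_def)
  ultimately have "homotopic_with (\<lambda>h. h sphere_base = x) (nsphere n) X (\<lambda>_. x) f"
    by (simp add: homotopy_class_def)
  then have "homotopic_with (\<lambda>_. True) (nsphere n) X (\<lambda>_. x) f"
    by (rule homotopic_with_mono) simp
  then show ?thesis
    unfolding x_def by (rule homotopic_with_symD)
qed

lemma Hausdorff_realization: "Hausdorff_space (realization \<K>)"
  by (subst euclidean_realization) (simp add: Hausdorff_space_subtopology)

theorem theorem1p3:
  fixes n :: nat
    and X :: "'a topology"
    and K :: "nat \<Rightarrow> 'b::topological_space set"
    and p :: "nat \<Rightarrow> 'b \<Rightarrow> 'b"
    and q :: "nat \<Rightarrow> 'a \<Rightarrow> 'b"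
    and C :: "nat \<Rightarrow> 'c::topological_space set"
    and c :: "nat \<Rightarrow> 'c \<Rightarrow> 'b"
  assumes "n \<ge> 1"
    and "Peano_continuum X"
    and "has_covering_dim X n"
    and "pi_shape_injective n X"
    and "\<And>i. compact_polyhedron (top_of_set (K i))"
    and "\<And>i. has_covering_dim (top_of_set (K i)) n"
    and "\<And>i. universal_cover (C i) (c i) (K i)"
    and "\<And>i. k_connected (n - 1) (top_of_set (C i))"
    and "is_inverse_limit X (\<lambda>i. top_of_set (K i)) p q"
  shows "completely_pi_rigid n X"
proof -
  note lim = \<open>is_inverse_limit X (\<lambda>i. top_of_set (K i)) p q\<close>
  have q: "continuous_map X (top_of_set (K i)) (q i)" and pq: "x \<in> topspace X \<Longrightarrow> p i (q (Suc i) x) = q i x" for i x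
    using inverse_limit_continuous[OF lim] .
  have "\<exists>\<K> a b. finite_complex \<K> \<and> homeomorphic_maps (top_of_set (K i)) (realization \<K>) a b" for i
    using assms(5)[of i] unfolding compact_polyhedron_def homeomorphic_space_def by blast
  then obtain \<K> a b where \<K>: "\<And>i. finite_complex (\<K> i)"
    and ab: "\<And>i. homeomorphic_maps (top_of_set (K i)) (realization (\<K> i)) (a i) (b i)"
    by metis
  have Hausdorff_K: "Hausdorff_space (top_of_set (K i))" for i
    using ab[of i] Hausdorff_realization homeomorphic_Hausdorff_space unfolding homeomorphic_space_def by blast
  define p' where "p' = (\<lambda>i. a i \<circ> p i \<circ> b (Suc i))"
  define q' where "q' = (\<lambda>i. a i \<circ> q i)"
  have lim': "is_inverse_limit X (\<lambda>i. realization (\<K> i)) p' q'"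
    unfolding p'_def q'_def using assms(2) ab Hausdorff_realization
    by (intro inverse_limit_homeomorphic[OF lim]) (simp_all add: Peano_continuum_def)
  have poly': "compact_polyhedron (realization (\<K> i))" for i
    using \<K>[of i] homeomorphic_space_refl unfolding compact_polyhedron_def by blast
  define S where "S = Sph n"
  have "pi_rigid_at n X x" if x: "x \<in> wild_set n X" for x
  proof -
    from x obtain f where f: "fully_essential n X f" "f wedge_point = x" and xX: "x \<in> topspace X"
      by (auto simp: wild_set_def)
    have f_cont: "continuous_map (earring n) X f"
      using f(1) by (simp add: fully_essential_def)
    have "F (wedge_point, 1) = x"
      if F: "continuous_map (prod_topology (earring n) (top_of_set {0..1::real})) X F"
        and F0: "\<forall>a\<in>topspace (earring n). F (a, 0) = f a" for F
    proof (rule ccontr)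
      define g where "g = (\<lambda>a. F (a, 1))"
      define y where "y = F (wedge_point, 1)"
      assume "F (wedge_point, 1) \<noteq> x"
      then have "x \<noteq> y"
        by (simp add: y_def)
      have g_cont: "continuous_map (earring n) X g"
        unfolding g_def by (rule continuous_map_compose[OF _ F, unfolded o_def]) (simp add: continuous_map_pairedI)
      have yX: "y \<in> topspace X"
        using funcset_mem[OF continuous_map_funspace[OF g_cont] wedge_point_in_earring] by (simp add: y_def g_def)
      \<comment> \<open>Distinct points of the limit are told apart by some projection, and
        Hausdorffness of that polyhedron separates their images by open sets.\<close>
      have "inj_on (\<lambda>x i. q i x) (topspace X)"
        using lim unfolding is_inverse_limit_def by (auto intro: homeomorphic_imp_injective_map)
      then have "(\<lambda>i. q i x) \<noteq> (\<lambda>i. q i y)"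
        using \<open>x \<noteq> y\<close> xX yX by (auto dest: inj_onD)
      then obtain i0 where i0: "q i0 x \<noteq> q i0 y"
        by auto
      obtain U V where UV: "openin (top_of_set (K i0)) U" "openin (top_of_set (K i0)) V" "q i0 x \<in> U" "q i0 y \<in> V" "disjnt U V"
      proof -
        have "q i0 x \<in> topspace (top_of_set (K i0))" "q i0 y \<in> topspace (top_of_set (K i0))"
          using funcset_mem[OF continuous_map_funspace[OF q]] xX yX by auto
        then show thesis
          using Hausdorff_K[of i0] i0 that unfolding Hausdorff_space_def by metis
      qed
      have "finite {j. \<not> (q i0 \<circ> f) ` earring_incl j ` S \<subseteq> U}" "finite {j. \<not> (q i0 \<circ> g) ` earring_incl j ` S \<subseteq> V}"
        unfolding S_def using UV(3,4) f(2)
        by (intro finite_spheres_outside_neighbourhood[OF continuous_map_compose[OF f_cont q] UV(1)]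
            finite_spheres_outside_neighbourhood[OF continuous_map_compose[OF g_cont q] UV(2)]; simp add: g_def y_def)+
      then have "finite ({j. \<not> (q i0 \<circ> f) ` earring_incl j ` S \<subseteq> U} \<union> {j. \<not> (q i0 \<circ> g) ` earring_incl j ` S \<subseteq> V})"
        by simp
      \<comment> \<open>A single index \<open>j\<close> suffices: one inessential sphere already
        contradicts full essentiality.\<close>
      then obtain j where j: "(q i0 \<circ> f) ` earring_incl j ` S \<subseteq> U" "(q i0 \<circ> g) ` earring_incl j ` S \<subseteq> V"
        using ex_new_if_finite[OF infinite_UNIV_nat] by blast
      define fj gj where "fj = f \<circ> earring_incl j" and "gj = g \<circ> earring_incl j"
      have fj: "continuous_map (nsphere n) X fj" and gj: "continuous_map (nsphere n) X gj"
        unfolding fj_def gj_def using continuous_map_compose[OF continuous_map_earring_incl] f_cont g_cont by auto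
      have fjX: "fj s \<in> topspace X" "gj s \<in> topspace X" if "s \<in> S" for s
        using that funcset_mem[OF continuous_map_funspace[OF fj]] funcset_mem[OF continuous_map_funspace[OF gj]]
        by (auto simp: S_def)
      have hom: "homotopic_with (\<lambda>_. True) (nsphere n) X fj gj"
      proof -
        define H where "H = (\<lambda>z. F (earring_incl j (snd z), fst z))"
        have "continuous_map (prod_topology (top_of_set {0..1}) (nsphere n)) X H"
          unfolding H_def
          by (rule continuous_map_compose[OF _ F, unfolded o_def])
             (intro continuous_map_pairedI continuous_map_fst continuous_map_compose[OF continuous_map_snd continuous_map_earring_incl, unfolded o_def])
        then have "homotopic_with (\<lambda>_. True) (nsphere n) X (\<lambda>s. H (0, s)) (\<lambda>s. H (1, s))"
          unfolding homotopic_with_def by (intro exI[of _ H]) simp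
        then show ?thesis
        proof (rule homotopic_with_eq)
          show "fj s = H (0, s)" if "s \<in> Sph n" for s
            using F0 funcset_mem[OF continuous_map_funspace[OF continuous_map_earring_incl] that] by (simp add: H_def fj_def)
          show "gj s = H (1, s)" for s
            by (simp add: H_def gj_def g_def)
        qed simp
      qed
      \<comment> \<open>Points identified at a later stage would be identified at stage
        \<open>i0\<close> as well, by applying the bonding maps.\<close>
      have separated: "q (i0 + d) u \<noteq> q (i0 + d) v" if "u \<in> fj ` S" "v \<in> gj ` S" for d u v
      proof
        assume eq: "q (i0 + d) u = q (i0 + d) v"
        have uv: "u \<in> topspace X" "v \<in> topspace X"
          using that fjX by auto
        have "q i0 u = q i0 v"
          using eq
        proof (induction d)
          case (Suc d)
          then show ?case
            using pq[OF uv(1), of "i0 + d"] pq[OF uv(2), of "i0 + d"] by simp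
        qed simp
        moreover have "q i0 u \<in> U" "q i0 v \<in> V"
          using that j by (auto simp: fj_def gj_def image_subset_iff)
        ultimately show False
          using UV(5) by (auto simp: disjnt_def)
      qed
      define null where "null = (\<lambda>i. \<exists>a. homotopic_in S (K i) (q i \<circ> fj) (\<lambda>_. a))"
      have "null (i0 + d)" for d
        unfolding null_def S_def
      proof (rule nullhomotopic_in_polyhedron[OF assms(1,5,6,7,8)])
        have "homotopic_with (\<lambda>_. True) (nsphere n) (top_of_set (K (i0 + d))) (q (i0 + d) \<circ> fj) (q (i0 + d) \<circ> gj)"
          using hom q by (rule homotopic_with_compose_continuous_map_left) simp
        then show "homotopic_in (Sph n) (K (i0 + d)) (q (i0 + d) \<circ> fj) (q (i0 + d) \<circ> gj)"
          by (subst (asm) euclidean_nsphere)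
        show "(q (i0 + d) \<circ> fj) ` Sph n \<inter> (q (i0 + d) \<circ> gj) ` Sph n = {}"
        proof (rule ccontr)
          assume "(q (i0 + d) \<circ> fj) ` Sph n \<inter> (q (i0 + d) \<circ> gj) ` Sph n \<noteq> {}"
          then obtain s t where "s \<in> S" "t \<in> S" "q (i0 + d) (fj s) = q (i0 + d) (gj t)"
            by (auto simp: S_def)
          then show False
            using separated[of "fj s" "gj t" d] by simp
        qed
      qed
      \<comment> \<open>Shape injectivity asks for every index, including those below
        \<open>i0\<close>, where the images may intersect; the bonding maps supply the
        null-homotopies there.\<close>
      moreover have "null i" if Suc: "null (Suc i)" for i
      proof -
        obtain a where "homotopic_in S (K (Suc i)) (q (Suc i) \<circ> fj) (\<lambda>_. a)"
          using Suc by (auto simp: null_def)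
        then have "homotopic_in S (K i) (p i \<circ> (q (Suc i) \<circ> fj)) (p i \<circ> (\<lambda>_. a))"
          by (rule homotopic_with_compose_continuous_map_left) (use lim in \<open>simp_all add: is_inverse_limit_def\<close>)
        then have "homotopic_in S (K i) (q i \<circ> fj) (\<lambda>_. p i a)"
          by (rule homotopic_with_eq) (use pq fjX in auto)
        then show ?thesis
          by (auto simp: null_def)
      qed
      ultimately have all_null: "null i" for i
      proof -
        have "null i" if "null (i + d)" for d
          using that
        proof (induction d)
          case (Suc d)
          then show ?case
            using \<open>\<And>i. null (Suc i) \<Longrightarrow> null i\<close> by simp
        qed simp
        moreover have "null (i + i0)"
          using \<open>\<And>d. null (i0 + d)\<close>[of i] by (simp add: add.commute)
        ultimately show ?thesis .
      qed
      have "homotopic_with (\<lambda>_. True) (nsphere n) X fj (\<lambda>_. fj sphere_base)"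
      proof (rule shape_injective_imp_nullhomotopic[OF assms(4) poly' lim' fj])
        fix i
        obtain e where "homotopic_in S (K i) (q i \<circ> fj) (\<lambda>_. e)"
          using all_null[of i] by (auto simp: null_def)
        moreover have "continuous_map (top_of_set (K i)) (top_of_set (topspace (realization (\<K> i)))) (a i)"
          using ab[of i] euclidean_realization[of "\<K> i"] by (simp add: homeomorphic_maps_def)
        ultimately have "homotopic_in S (topspace (realization (\<K> i))) (a i \<circ> (q i \<circ> fj)) (a i \<circ> (\<lambda>_. e))"
          by (rule homotopic_with_compose_continuous_map_left) simp
        then have "homotopic_in (Sph n) (topspace (realization (\<K> i))) (q' i \<circ> fj) (\<lambda>_. a i e)"
          by (simp add: S_def q'_def o_def)
        from free_nullhomotopic_imp_based[OF this]
        show "homotopic_with (\<lambda>h. h sphere_base = q' i (fj sphere_base)) (nsphere n) (realization (\<K> i)) (q' i \<circ> fj)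
            (\<lambda>_. q' i (fj sphere_base))"
          by (simp flip: euclidean_realization)
      qed
      moreover have "essential n X fj"
        using f(1) by (simp add: fully_essential_def fj_def)
      ultimately show False
        unfolding essential_def by blast
    qed
    then show ?thesis
      unfolding pi_rigid_at_def using f by blast
  qed
  then have "wild_set n X \<subseteq> rigid_set n X"
    by (auto simp: rigid_set_def wild_set_def)
  moreover have "rigid_set n X \<subseteq> wild_set n X"
    by (auto simp: rigid_set_def wild_set_def pi_rigid_at_def)
  ultimately show ?thesis
    by (simp add: completely_pi_rigid_def)
qed

end
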